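(* Let $H=(Q,\Gamma,O,\delta,\lambda,\{n_q,A_q,B_q,C_q\}_{q\in Q},\{M_{q_1,\gamma,q_2}\}_{q_2\in Q,\gamma\in\Gamma,q_1=\delta(q_2,\gamma)},(q_0,0))$ be a linear hybrid system with zero initial continuous state. Let $\{\mathscr{P}_q\}_{q\in Q}$ be generalized reachability Gramians and $\{\mathscr{Q}_q\}_{q\in Q}$ generalized observability Gramians of $H$. Let $0<r_q\le n_q$, $q\in Q$, be truncation orders, let $\hat H$ be the reduced order model obtained from $H$, these Gramians and these orders by the balanced truncation procedure described in the context, and let $\sigma_{q,1}\ge\dots\ge\sigma_{q,n_q}$, $q\in Q$, be the associated singular values. For any $u\in L_2(\mathbb{R}_+,\mathbb{R}^m)$ and any timed sequence of discrete events $w$, let $(\mathbf{o},y)=\upsilon_H(u,w)$ and $(\hat{\mathbf{o}},\hat y)=\upsilon_{\hat H}(u,w)$. Then $\hat{\mathbf{o}}=\mathbf{o}$ and $$\|y-\hat y\|_{L_2}\le 2\Big(\sum_{q\in Q}\sum_{i=1}^{n_q-r_q}\sigma_{q,r_q+i}\Big)\|u\|_{L_2}.$$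
   Context: Linear hybrid systems. A linear hybrid system is a tuple $H=(Q,\Gamma,O,\delta,\lambda,\{n_q,A_q,B_q,C_q\}_{q\in Q},\{M_{q_1,\gamma,q_2}\}_{q_2\in Q,\gamma\in\Gamma,q_1=\delta(q_2,\gamma)},h_0)$, where $Q$ (discrete states), $\Gamma$ (discrete events), $O$ (discrete outputs) are finite sets; $\delta:Q\times\Gamma\to Q$ and $\lambda:Q\to O$ are functions; for each $q\in Q$, $n_q>0$ is an integer and $A_q\in\mathbb{R}^{n_q\times n_q}$, $B_q\in\mathbb{R}^{n_q\times m}$, $C_q\in\mathbb{R}^{p\times n_q}$; for all $q_2\in Q$, $\gamma\in\Gamma$ and $q_1=\delta(q_2,\gamma)$, $M_{q_1,\gamma,q_2}\in\mathbb{R}^{n_{q_1}\times n_{q_2}}$ is a reset map; and $h_0=(q_0,x_0)$ with $q_0\in Q$, $x_0\in\mathbb{R}^{n_{q_0}}$ is the initial state. Inputs. $\mathbb{R}_+=[0,\infty)$. A timed sequence of discrete events is an infinite sequence $w=(\gamma_1,t_1)(\gamma_2,t_2)\cdots$ with $\gamma_i\in\Gamma$, $t_i\ge 0$ ($t_i=0$ is allowed) and $\sum_{i=1}^{\infty}t_i=\infty$. Put $T_0=0$, $T_i=\sum_{j=1}^i t_j$. The continuous input is $u\in L_2(\mathbb{R}_+,\mathbb{R}^m)$. Trajectories and input-output map. Given an initial state $(q_0,x_0)$ and $(u,w)$, set $q_{i+1}=\delta(q_i,\gamma_{i+1})$ for $i\ge0$; let $z_i:[T_i,T_{i+1}]\to\mathbb{R}^{n_{q_i}}$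 be the unique Carathéodory solution of $\dot z_i=A_{q_i}z_i+B_{q_i}u$ with $z_0(0)=x_0$ and $z_{i+1}(T_{i+1})=M_{q_{i+1},\gamma_{i+1},q_i}z_i(T_{i+1})$. The discrete and continuous state trajectories are $\mathbf q(t)=q_i$ and $x(t)=z_i(t)$ for $t\in[T_i,T_{i+1})$. The outputs are $\mathbf{o}(t)=\lambda(\mathbf q(t))$ and $y(t)=C_{\mathbf q(t)}x(t)$; the input-output map of $H$ is $\upsilon_H(u,w)=(\mathbf{o},y)$, computed from the initial state $h_0$ of $H$. Gramians. Generalized observability Gramians of $H$: a collection of symmetric positive definite matrices $\{\mathscr{Q}_q\}_{q\in Q}$, $\mathscr{Q}_q\in\mathbb{R}^{n_q\times n_q}$, such that for all $q\in Q$, $A_q^T\mathscr{Q}_q+\mathscr{Q}_qA_q+C_q^TC_q<0$ and, for all $\gamma\in\Gamma$ with $q^+=\delta(q,\gamma)$, $M_{q^+,\gamma,q}^T\mathscr{Q}_{q^+}M_{q^+,\gamma,q}-\mathscr{Q}_q\le0$. Generalized reachability Gramians of $H$: a collection of symmetric positive definite matrices $\{\mathscr{P}_q\}_{q\in Q}$, $\mathscr{P}_q\in\mathbb{R}^{n_q\times n_q}$, such that for all $q\in Q$, $A_q\mathscr{P}_q+\mathscr{P}_qA_q^T+B_qB_q^T<0$ and, for all $\gamma\in\Gamma$ with $q^+=\delta(q,\gamma)$, $M_{q^+,\gamma,q}\mathscr{P}_qM_{q^+,\gamma,q}^T-\mathscr{P}_{q^+}\le0$. (Matrix inequalities are in the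 semidefinite order.) Balanced truncation procedure. Given Gramians $\{\mathscr{P}_q\},\{\mathscr{Q}_q\}$: choose square matrices $U_q$ with $\mathscr{P}_q=U_qU_q^T$; take an eigenvalue decomposition $U_q^T\mathscr{Q}_qU_q=V_q\Lambda_q^2V_q^T$ with $V_q$ orthogonal and $\Lambda_q=\mathrm{diag}(\sigma_{q,1},\dots,\sigma_{q,n_q})$, $\sigma_{q,1}\ge\dots\ge\sigma_{q,n_q}>0$; set $S_q=\Lambda_q^{1/2}V_q^TU_q^{-1}$ and $\bar A_q=S_qA_qS_q^{-1}$, $\bar B_q=S_qB_q$, $\bar C_q=C_qS_q^{-1}$, $\bar M_{q_1,\gamma,q_2}=S_{q_1}M_{q_1,\gamma,q_2}S_{q_2}^{-1}$ for $q_1=\delta(q_2,\gamma)$. Given $0<r_q\le n_q$, let $\hat A_q$ be the leading (upper-left) $r_q\times r_q$ block of $\bar A_q$, $\hat B_q$ the first $r_q$ rows of $\bar B_q$, $\hat C_q$ the first $r_q$ columns of $\bar C_q$, and $\hat M_{q_1,\gamma,q_2}$ the upper-left $r_{q_1}\times r_{q_2}$ block of $\bar M_{q_1,\gamma,q_2}$. The reduced order model is $\hat H=(Q,\Gamma,O,\delta,\lambda,\{r_q,\hat A_q,\hat B_q,\hat C_q\}_{q\in Q},\{\hat M_{q_1,\gamma,q_2}\},(q_0,0))$. *)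

theory Defs
  imports
    "HOL-Analysis.Analysis"
    "Jordan_Normal_Form.Matrix"
    "Jordan_Normal_Form.Gauss_Jordan_Elimination"
begin

text \<open>
  The continuous state dimension depends on the discrete state, so vectors and matrices are those
  of \<^theory>\<open>Jordan_Normal_Form.Matrix\<close>, whose dimensions are terms. Their indices start at 0.
  The notation of the type-indexed vectors and of the inner product type class is switched off.
\<close>

unbundle no vec_syntax
unbundle no inner_syntax
hide_const (open) Finite_Cartesian_Product.vec Finite_Cartesian_Product.mat
  Finite_Cartesian_Product.transpose Determinants.det

section \<open>Matrix inequalities\<close>

definition pos_def :: "nat \<Rightarrow> real mat \<Rightarrow> bool" where
  "pos_def n X \<longleftrightarrow> X \<in> carrier_mat n n \<and> transpose_mat X = X \<and>
     (\<forall>v \<in> carrier_vec n. v \<noteq> 0\<^sub>v n \<longrightarrow> v \<bullet> (X *\<^sub>v v) > 0)"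

definition pos_semidef :: "nat \<Rightarrow> real mat \<Rightarrow> bool" where
  "pos_semidef n X \<longleftrightarrow> X \<in> carrier_mat n n \<and> transpose_mat X = X \<and>
     (\<forall>v \<in> carrier_vec n. v \<bullet> (X *\<^sub>v v) \<ge> 0)"

definition mat_less :: "nat \<Rightarrow> real mat \<Rightarrow> real mat \<Rightarrow> bool" where
  "mat_less n X Y \<longleftrightarrow> pos_def n (Y - X)"

definition mat_le :: "nat \<Rightarrow> real mat \<Rightarrow> real mat \<Rightarrow> bool" where
  "mat_le n X Y \<longleftrightarrow> pos_semidef n (Y - X)"

section \<open>Square integrable signals on the half-line\<close>

text \<open>
  Signals are functions on all of \<^typ>\<open>real\<close>; their values at negative times play no role.
  Elements of $L_2$ are represented by functions rather than by classes modulo null sets.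
\<close>

definition L2 :: "nat \<Rightarrow> (real \<Rightarrow> real vec) set" where
  "L2 k = {f. (\<forall>t\<ge>0. f t \<in> carrier_vec k) \<and>
     (\<forall>i<k. (\<lambda>t. f t $ i) \<in> borel_measurable (lebesgue_on {0..}) \<and>
            integrable (lebesgue_on {0..}) (\<lambda>t. (f t $ i)\<^sup>2))}"

definition L2_norm :: "(real \<Rightarrow> real vec) \<Rightarrow> real" where
  "L2_norm f = sqrt (LINT t|lebesgue_on {0..}. f t \<bullet> f t)"

section \<open>Caratheodory solutions\<close>

definition abs_cont_on :: "real \<Rightarrow> real \<Rightarrow> (real \<Rightarrow> real) \<Rightarrow> bool" where
  "abs_cont_on a b f \<longleftrightarrow> (\<forall>\<epsilon>>0. \<exists>d>0. \<forall>(n::nat) l r.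
     (\<forall>k<n. a \<le> l k \<and> l k \<le> r k \<and> r k \<le> b) \<longrightarrow>
     (\<forall>j<n. \<forall>k<n. j \<noteq> k \<longrightarrow> {l j<..<r j} \<inter> {l k<..<r k} = {}) \<longrightarrow>
     (\<Sum>k<n. r k - l k) < d \<longrightarrow>
     (\<Sum>k<n. \<bar>f (r k) - f (l k)\<bar>) < \<epsilon>)"

definition caratheodory_solution ::
  "real mat \<Rightarrow> real mat \<Rightarrow> (real \<Rightarrow> real vec) \<Rightarrow> real \<Rightarrow> real \<Rightarrow> (real \<Rightarrow> real vec) \<Rightarrow> bool" where
  "caratheodory_solution A B u a b z \<longleftrightarrow>
     (\<forall>t\<in>{a..b}. z t \<in> carrier_vec (dim_row A)) \<and>
     (\<forall>i<dim_row A. abs_cont_on a b (\<lambda>t. z t $ i)) \<and>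
     (AE t in lebesgue. t \<in> {a<..<b} \<longrightarrow>
        (\<forall>i<dim_row A.
           ((\<lambda>s. z s $ i) has_real_derivative (A *\<^sub>v z t + B *\<^sub>v u t) $ i) (at t)))"

section \<open>Linear hybrid systems\<close>

text \<open>
  The sets of discrete states, events and discrete outputs are the types \<open>'q\<close>, \<open>'e\<close>, \<open>'o\<close>.
  A reset map $M_{q_1,\gamma,q_2}$ exists only for $q_1 = \delta(q_2,\gamma)$;
  it is \<open>reset H q\<^sub>2 \<gamma>\<close> here.
\<close>

record ('q, 'e, 'o) hybrid_system =
  trans :: "'q \<Rightarrow> 'e \<Rightarrow> 'q"
  disc_out :: "'q \<Rightarrow> 'o"
  in_dim :: nat
  out_dim :: nat
  state_dim :: "'q \<Rightarrow> nat"
  mat_A :: "'q \<Rightarrow> real mat"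
  mat_B :: "'q \<Rightarrow> real mat"
  mat_C :: "'q \<Rightarrow> real mat"
  reset :: "'q \<Rightarrow> 'e \<Rightarrow> real mat"
  init_disc :: 'q
  init_cont :: "real vec"

definition linear_hybrid_system ::
  "('q::finite, 'e::finite, 'o::finite) hybrid_system \<Rightarrow> bool" where
  "linear_hybrid_system H \<longleftrightarrow>
     (\<forall>q. state_dim H q > 0 \<and>
          mat_A H q \<in> carrier_mat (state_dim H q) (state_dim H q) \<and>
          mat_B H q \<in> carrier_mat (state_dim H q) (in_dim H) \<and>
          mat_C H q \<in> carrier_mat (out_dim H) (state_dim H q) \<and>
          (\<forall>\<gamma>. reset H q \<gamma> \<in> carrier_mat (state_dim H (trans H q \<gamma>)) (state_dim H q))) \<and>
     init_cont H \<in> carrier_vec (state_dim H (init_disc H))"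

section \<open>Trajectories and the input-output map\<close>

text \<open>The pair $(\gamma_{i+1}, t_{i+1})$ of a timed sequence \<open>w\<close> of events is \<open>w i\<close>.\<close>

definition timed_event_seq :: "(nat \<Rightarrow> 'e \<times> real) \<Rightarrow> bool" where
  "timed_event_seq w \<longleftrightarrow> (\<forall>i. snd (w i) \<ge> 0) \<and>
     filterlim (\<lambda>n. \<Sum>i<n. snd (w i)) at_top sequentially"

definition event_time :: "(nat \<Rightarrow> 'e \<times> real) \<Rightarrow> nat \<Rightarrow> real" where
  "event_time w i = (\<Sum>j<i. snd (w j))"

primrec disc_seq :: "('q, 'e, 'o) hybrid_system \<Rightarrow> (nat \<Rightarrow> 'e \<times> real) \<Rightarrow> nat \<Rightarrow> 'q" where
  "disc_seq H w 0 = init_disc H"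
| "disc_seq H w (Suc i) = trans H (disc_seq H w i) (fst (w i))"

definition solution_segments ::
  "('q, 'e, 'o) hybrid_system \<Rightarrow> (real \<Rightarrow> real vec) \<Rightarrow> (nat \<Rightarrow> 'e \<times> real) \<Rightarrow>
   (nat \<Rightarrow> real \<Rightarrow> real vec) \<Rightarrow> bool" where
  "solution_segments H u w z \<longleftrightarrow>
     z 0 0 = init_cont H \<and>
     (\<forall>i. caratheodory_solution (mat_A H (disc_seq H w i)) (mat_B H (disc_seq H w i)) u
            (event_time w i) (event_time w (Suc i)) (z i)) \<and>
     (\<forall>i. z (Suc i) (event_time w (Suc i)) =
            reset H (disc_seq H w i) (fst (w i)) *\<^sub>v z i (event_time w (Suc i)))"

text \<open>
  The segments \<open>z i\<close> are unique on the closed interval between consecutive event times only;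
  elsewhere their values are arbitrary and are not used.
\<close>

definition segments ::
  "('q, 'e, 'o) hybrid_system \<Rightarrow> (real \<Rightarrow> real vec) \<Rightarrow> (nat \<Rightarrow> 'e \<times> real) \<Rightarrow>
   nat \<Rightarrow> real \<Rightarrow> real vec" where
  "segments H u w = (SOME z. solution_segments H u w z)"

definition active_index :: "(nat \<Rightarrow> 'e \<times> real) \<Rightarrow> real \<Rightarrow> nat" where
  "active_index w t = (THE i. event_time w i \<le> t \<and> t < event_time w (Suc i))"

definition disc_state :: "('q, 'e, 'o) hybrid_system \<Rightarrow> (nat \<Rightarrow> 'e \<times> real) \<Rightarrow> real \<Rightarrow> 'q" where
  "disc_state H w t = disc_seq H w (active_index w t)"

definition cont_state ::
  "('q, 'e, 'o) hybrid_system \<Rightarrow> (real \<Rightarrow> real vec) \<Rightarrow> (nat \<Rightarrow> 'e \<times> real) \<Rightarrow> real \<Rightarrow> real vec" where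
  "cont_state H u w t = segments H u w (active_index w t) t"

definition io_map ::
  "('q, 'e, 'o) hybrid_system \<Rightarrow> (real \<Rightarrow> real vec) \<Rightarrow> (nat \<Rightarrow> 'e \<times> real) \<Rightarrow>
   (real \<Rightarrow> 'o) \<times> (real \<Rightarrow> real vec)" where
  "io_map H u w =
     (\<lambda>t. disc_out H (disc_state H w t),
      \<lambda>t. mat_C H (disc_state H w t) *\<^sub>v cont_state H u w t)"

section \<open>Generalized Gramians\<close>

definition observability_gramians ::
  "('q, 'e, 'o) hybrid_system \<Rightarrow> ('q \<Rightarrow> real mat) \<Rightarrow> bool" where
  "observability_gramians H Gq \<longleftrightarrow> (\<forall>q.
     pos_def (state_dim H q) (Gq q) \<and>
     mat_less (state_dim H q)
       (transpose_mat (mat_A H q) * Gq q + Gq q * mat_A H q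
          + transpose_mat (mat_C H q) * mat_C H q)
       (0\<^sub>m (state_dim H q) (state_dim H q)) \<and>
     (\<forall>\<gamma>. mat_le (state_dim H q)
        (transpose_mat (reset H q \<gamma>) * Gq (trans H q \<gamma>) * reset H q \<gamma> - Gq q)
        (0\<^sub>m (state_dim H q) (state_dim H q))))"

definition reachability_gramians ::
  "('q, 'e, 'o) hybrid_system \<Rightarrow> ('q \<Rightarrow> real mat) \<Rightarrow> bool" where
  "reachability_gramians H Gp \<longleftrightarrow> (\<forall>q.
     pos_def (state_dim H q) (Gp q) \<and>
     mat_less (state_dim H q)
       (mat_A H q * Gp q + Gp q * transpose_mat (mat_A H q)
          + mat_B H q * transpose_mat (mat_B H q))
       (0\<^sub>m (state_dim H q) (state_dim H q)) \<and>
     (\<forall>\<gamma>. mat_le (state_dim H (trans H q \<gamma>))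
        (reset H q \<gamma> * Gp q * transpose_mat (reset H q \<gamma>) - Gp (trans H q \<gamma>))
        (0\<^sub>m (state_dim H (trans H q \<gamma>)) (state_dim H (trans H q \<gamma>)))))"

section \<open>Balanced truncation\<close>

text \<open>The singular value $\sigma_{q,i+1}$ is \<open>\<sigma> q i\<close>.\<close>

definition balancing_factors ::
  "nat \<Rightarrow> real mat \<Rightarrow> real mat \<Rightarrow> real mat \<Rightarrow> real mat \<Rightarrow> (nat \<Rightarrow> real) \<Rightarrow> bool" where
  "balancing_factors n P Q U V s \<longleftrightarrow>
     U \<in> carrier_mat n n \<and> P = U * transpose_mat U \<and>
     V \<in> carrier_mat n n \<and> transpose_mat V * V = 1\<^sub>m n \<and> V * transpose_mat V = 1\<^sub>m n \<and>
     transpose_mat U * Q * U = V * (mat_diag n s * mat_diag n s) * transpose_mat V \<and>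
     (\<forall>i j. i \<le> j \<longrightarrow> j < n \<longrightarrow> s j \<le> s i) \<and> (\<forall>i<n. s i > 0)"

definition balancing_map :: "nat \<Rightarrow> real mat \<Rightarrow> real mat \<Rightarrow> (nat \<Rightarrow> real) \<Rightarrow> real mat" where
  "balancing_map n U V s =
     mat_diag n (\<lambda>i. sqrt (s i)) * transpose_mat V * the (mat_inverse U)"

definition transformed_system ::
  "('q, 'e, 'o) hybrid_system \<Rightarrow> ('q \<Rightarrow> real mat) \<Rightarrow> ('q, 'e, 'o) hybrid_system" where
  "transformed_system H S = H\<lparr>
     mat_A := \<lambda>q. S q * mat_A H q * the (mat_inverse (S q)),
     mat_B := \<lambda>q. S q * mat_B H q,
     mat_C := \<lambda>q. mat_C H q * the (mat_inverse (S q)),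
     reset := \<lambda>q \<gamma>. S (trans H q \<gamma>) * reset H q \<gamma> * the (mat_inverse (S q)),
     init_cont := S (init_disc H) *\<^sub>v init_cont H\<rparr>"

definition leading_block :: "nat \<Rightarrow> nat \<Rightarrow> real mat \<Rightarrow> real mat" where
  "leading_block k l X = mat k l (\<lambda>(i, j). X $$ (i, j))"

definition truncated_system ::
  "('q, 'e, 'o) hybrid_system \<Rightarrow> ('q \<Rightarrow> nat) \<Rightarrow> ('q, 'e, 'o) hybrid_system" where
  "truncated_system H r = H\<lparr>
     state_dim := r,
     mat_A := \<lambda>q. leading_block (r q) (r q) (mat_A H q),
     mat_B := \<lambda>q. leading_block (r q) (in_dim H) (mat_B H q),
     mat_C := \<lambda>q. leading_block (out_dim H) (r q) (mat_C H q),
     reset := \<lambda>q \<gamma>. leading_block (r (trans H q \<gamma>)) (r q) (reset H q \<gamma>),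
     init_cont := 0\<^sub>v (r (init_disc H))\<rparr>"

text \<open>
  The procedure involves choices (of \<open>U\<close> and \<open>V\<close>), so it is a relation between the data and its
  possible results \<open>\<sigma>\<close> and \<open>Hr\<close>.
\<close>

definition balanced_truncation ::
  "('q, 'e, 'o) hybrid_system \<Rightarrow> ('q \<Rightarrow> real mat) \<Rightarrow> ('q \<Rightarrow> real mat) \<Rightarrow> ('q \<Rightarrow> nat) \<Rightarrow>
   ('q \<Rightarrow> nat \<Rightarrow> real) \<Rightarrow> ('q, 'e, 'o) hybrid_system \<Rightarrow> bool" where
  "balanced_truncation H Gp Gq r \<sigma> Hr \<longleftrightarrow> (\<exists>U V.
     (\<forall>q. balancing_factors (state_dim H q) (Gp q) (Gq q) (U q) (V q) (\<sigma> q)) \<and>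
     Hr = truncated_system
       (transformed_system H (\<lambda>q. balancing_map (state_dim H q) (U q) (V q) (\<sigma> q))) r)"

end

theory Submission
  imports Defs "Jordan_Normal_Form.Determinant"
begin

text \<open>
  In balanced coordinates both Gramians of mode $q$ become the diagonal matrix
  $\Lambda_q = \mathrm{diag}(\sigma_{q,i})$. Suppose only coordinates with one common singular value
  $r$ are dropped. Padding the truncated state $X$ with zeros, the function
  \[ V = (x-X)^T \Lambda_q (x-X) + r^2 (x+X)^T \Lambda_q^{-1} (x+X) \]
  satisfies $\dot V \le 4 r^2 |u|^2 - |y-\hat y|^2$ almost everywhere, because the contributions of
  the dropped equations to the two terms cancel, and $V$ does not increase at a reset. Hence
  $\|y-\hat y\|_{L_2} \le 2 r \|u\|_{L_2}$. Dropping the coordinates one at a time, in one mode at a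
  time, and adding up the errors gives the bound. The inequalities for the padded state only use the
  Gramian inequalities of the full system, so intermediate systems need no Gramians of their own.

  The bound holds for every choice of Caratheodory solutions. Their existence has to be proved,
  because the trajectories are selected by Hilbert's operator.
\<close>

section \<open>Absolutely continuous functions\<close>

text \<open>The two terms of V use the Gramians in opposite roles: \<Lambda> measures the error x -
  X by the output it can produce, and the inverse of \<Lambda> measures x + X by the input needed to
  reach it. In a kept equation the input drops out of x - X and enters x + X as 2 B u, whence 4 r^2
  |u|^2 and the factor 2 of the bound. A dropped coordinate has X_i = 0 and derivative 0 where the
  full equation would give (A X + B u)_i. This defect contributes with factor 2 \<sigma>_i x_i to
  the derivative of the first term and with factor -2 r^2 x_i / \<sigma>_i to that of the second,
  and these cancel exactly when \<sigma>_i = r. Hence a step may only drop coordinates with one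
  singular value, and a single coordinate always qualifies. Two obstacles remain. The reachability
  condition on a reset concerns its transpose, so it has to be dualised before it speaks about
  inverse weights. And the equations hold only almost everywhere: the increments of V are controlled
  by its derivative only through absolute continuity, and solutions exist only because primitives of
  square integrable inputs are absolutely continuous and differentiable almost everywhere.\<close>

lemma abs_cont_onD:
  fixes f :: "real \<Rightarrow> real"
  assumes "abs_cont_on a b f" "0 < e"
  shows "\<exists>d>0. \<forall>(I :: 'i set) l r. finite I \<longrightarrow> (\<forall>i\<in>I. a \<le> l i \<and> l i \<le> r i \<and> r i \<le> b) \<longrightarrow>
      (\<forall>i\<in>I. \<forall>j\<in>I. i \<noteq> j \<longrightarrow> {l i<..<r i} \<inter> {l j<..<r j} = {}) \<longrightarrow>
      (\<Sum>i\<in>I. r i - l i) < d \<longrightarrow> (\<Sum>i\<in>I. \<bar>f (r i) - f (l i)\<bar>) < e"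
proof -
  note * = assms(1)[unfolded abs_cont_on_def, THEN spec, THEN mp, OF assms(2)]
  from * obtain d where "0 < d" and
    d: "\<forall>(n::nat) l r. (\<forall>k<n. a \<le> l k \<and> l k \<le> r k \<and> r k \<le> b) \<longrightarrow>
     (\<forall>j<n. \<forall>k<n. j \<noteq> k \<longrightarrow> {l j<..<r j} \<inter> {l k<..<r k} = {}) \<longrightarrow>
     (\<Sum>k<n. r k - l k) < d \<longrightarrow> (\<Sum>k<n. \<bar>f (r k) - f (l k)\<bar>) < e"
    by (elim exE conjE)
  show ?thesis
  proof (intro exI[of _ d] conjI \<open>0 < d\<close> allI impI)
    fix I :: "'i set" and l r :: "'i \<Rightarrow> real"
    assume I: "finite I" and lr: "\<forall>i\<in>I. a \<le> l i \<and> l i \<le> r i \<and> r i \<le> b"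
      and disj: "\<forall>i\<in>I. \<forall>j\<in>I. i \<noteq> j \<longrightarrow> {l i<..<r i} \<inter> {l j<..<r j} = {}"
      and less: "(\<Sum>i\<in>I. r i - l i) < d"
    \<comment> \<open>The definition numbers its intervals. A bijection frees the index type, so
      that a single interval or the cells of a tagged division can be used directly.\<close>
    obtain h where h: "bij_betw h {..<card I} I"
      using bij_betw_from_nat_into_finite[OF I] by blast
    have hI: "h k \<in> I" if "k < card I" for k
      using h that by (auto simp: bij_betw_def)
    have hinj: "h j \<noteq> h k" if "j < card I" "k < card I" "j \<noteq> k" for j k
      using h that by (auto simp: bij_betw_def inj_on_def)
    have "(\<Sum>k<card I. \<bar>f (r (h k)) - f (l (h k))\<bar>) < e"
    proof (rule d[THEN spec, THEN spec, THEN spec, THEN mp, THEN mp, THEN mp])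
      show "(\<Sum>k<card I. r (h k) - l (h k)) < d"
        using less sum.reindex_bij_betw[OF h, of "\<lambda>i. r i - l i"] by simp
      show "\<forall>k<card I. a \<le> l (h k) \<and> l (h k) \<le> r (h k) \<and> r (h k) \<le> b"
        using lr hI by simp
      show "\<forall>j<card I. \<forall>k<card I. j \<noteq> k \<longrightarrow> {l (h j)<..<r (h j)} \<inter> {l (h k)<..<r (h k)} = {}"
        using disj hI hinj by simp
    qed
    then show "(\<Sum>i\<in>I. \<bar>f (r i) - f (l i)\<bar>) < e"
      using sum.reindex_bij_betw[OF h, of "\<lambda>i. \<bar>f (r i) - f (l i)\<bar>"] by simp
  qed
qed

lemma abs_cont_on_imp_continuous_on:
  assumes "abs_cont_on a b f"
  shows "continuous_on {a..b} f"
  unfolding continuous_on_iff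
proof (intro ballI allI impI)
  fix x e :: real assume x: "x \<in> {a..b}" and "0 < e"
  note * = abs_cont_onD[OF assms \<open>0 < e\<close>, where 'i=unit]
  then obtain d where "0 < d" and
    d: "\<forall>(I :: unit set) l r. finite I \<longrightarrow> (\<forall>i\<in>I. a \<le> l i \<and> l i \<le> r i \<and> r i \<le> b) \<longrightarrow>
      (\<forall>i\<in>I. \<forall>j\<in>I. i \<noteq> j \<longrightarrow> {l i<..<r i} \<inter> {l j<..<r j} = {}) \<longrightarrow>
      (\<Sum>i\<in>I. r i - l i) < d \<longrightarrow> (\<Sum>i\<in>I. \<bar>f (r i) - f (l i)\<bar>) < e"
    by (elim exE conjE)
  have "dist (f y) (f x) < e" if "y \<in> {a..b}" "dist y x < d" for y
  proof -
    have "(\<Sum>i\<in>{()}. \<bar>f (max x y) - f (min x y)\<bar>) < e"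
      using that x by (intro d[THEN spec, THEN spec, THEN spec, THEN mp, THEN mp, THEN mp, THEN mp])
        (auto simp: dist_real_def)
    then show ?thesis by (auto simp: dist_real_def max_def min_def abs_minus_commute split: if_splits)
  qed
  then show "\<exists>d>0. \<forall>y\<in>{a..b}. dist y x < d \<longrightarrow> dist (f y) (f x) < e"
    using \<open>0 < d\<close> by blast
qed

text \<open>The closure properties below all reduce to this domination. Two dominating functions are
  enough for sums and products.\<close>

lemma abs_cont_on_dominated:
  assumes f: "abs_cont_on a b f" and g: "abs_cont_on a b g"
    and K: "\<And>s t. a \<le> s \<Longrightarrow> s \<le> t \<Longrightarrow> t \<le> b \<Longrightarrow>
      \<bar>h t - h s\<bar> \<le> K * (\<bar>f t - f s\<bar> + \<bar>g t - g s\<bar>)"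
  shows "abs_cont_on a b h"
  unfolding abs_cont_on_def
proof (intro allI impI)
  fix e :: real assume "0 < e"
  \<comment> \<open>\<open>K\<close> may be zero or negative; \<open>K'\<close> is a positive
    majorant by which \<open>e\<close> can be divided.\<close>
  define K' where "K' = \<bar>K\<bar> + 1"
  have "0 < K'" unfolding K'_def by simp
  then have e': "0 < e / (2 * K')" using \<open>0 < e\<close> by simp
  note df = f[unfolded abs_cont_on_def, THEN spec, THEN mp, OF e']
  from df obtain d1 where "0 < d1" and
    d1: "\<forall>(n::nat) l r. (\<forall>k<n. a \<le> l k \<and> l k \<le> r k \<and> r k \<le> b) \<longrightarrow>
     (\<forall>j<n. \<forall>k<n. j \<noteq> k \<longrightarrow> {l j<..<r j} \<inter> {l k<..<r k} = {}) \<longrightarrow>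
     (\<Sum>k<n. r k - l k) < d1 \<longrightarrow> (\<Sum>k<n. \<bar>f (r k) - f (l k)\<bar>) < e / (2 * K')"
    by (elim exE conjE)
  note dg = g[unfolded abs_cont_on_def, THEN spec, THEN mp, OF e']
  from dg obtain d2 where "0 < d2" and
    d2: "\<forall>(n::nat) l r. (\<forall>k<n. a \<le> l k \<and> l k \<le> r k \<and> r k \<le> b) \<longrightarrow>
     (\<forall>j<n. \<forall>k<n. j \<noteq> k \<longrightarrow> {l j<..<r j} \<inter> {l k<..<r k} = {}) \<longrightarrow>
     (\<Sum>k<n. r k - l k) < d2 \<longrightarrow> (\<Sum>k<n. \<bar>g (r k) - g (l k)\<bar>) < e / (2 * K')"
    by (elim exE conjE)
  show "\<exists>d>0. \<forall>(n::nat) l r.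
     (\<forall>k<n. a \<le> l k \<and> l k \<le> r k \<and> r k \<le> b) \<longrightarrow>
     (\<forall>j<n. \<forall>k<n. j \<noteq> k \<longrightarrow> {l j<..<r j} \<inter> {l k<..<r k} = {}) \<longrightarrow>
     (\<Sum>k<n. r k - l k) < d \<longrightarrow>
     (\<Sum>k<n. \<bar>h (r k) - h (l k)\<bar>) < e"
  proof (intro exI[of _ "min d1 d2"] conjI allI impI)
    fix n :: nat and l r :: "nat \<Rightarrow> real"
    assume lr: "\<forall>k<n. a \<le> l k \<and> l k \<le> r k \<and> r k \<le> b"
      and dj: "\<forall>j<n. \<forall>k<n. j \<noteq> k \<longrightarrow> {l j<..<r j} \<inter> {l k<..<r k} = {}"
      and sm: "(\<Sum>k<n. r k - l k) < min d1 d2"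
    have "(\<Sum>k<n. \<bar>h (r k) - h (l k)\<bar>) \<le>
        (\<Sum>k<n. K' * (\<bar>f (r k) - f (l k)\<bar> + \<bar>g (r k) - g (l k)\<bar>))"
    proof (rule sum_mono)
      fix k assume "k \<in> {..<n}"
      then have "\<bar>h (r k) - h (l k)\<bar> \<le> K * (\<bar>f (r k) - f (l k)\<bar> + \<bar>g (r k) - g (l k)\<bar>)"
        using K lr by auto
      also have "\<dots> \<le> K' * (\<bar>f (r k) - f (l k)\<bar> + \<bar>g (r k) - g (l k)\<bar>)"
        unfolding K'_def by (intro mult_right_mono) auto
      finally show "\<bar>h (r k) - h (l k)\<bar> \<le> K' * (\<bar>f (r k) - f (l k)\<bar> + \<bar>g (r k) - g (l k)\<bar>)" .
    qed
    also have "\<dots> = K' * ((\<Sum>k<n. \<bar>f (r k) - f (l k)\<bar>) + (\<Sum>k<n. \<bar>g (r k) - g (l k)\<bar>))"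
      by (simp only: sum_distrib_left[symmetric] sum.distrib)
    also have "\<dots> < K' * (e / (2 * K') + e / (2 * K'))"
      using d1[THEN spec, THEN spec, THEN spec, THEN mp, THEN mp, THEN mp, OF lr dj] sm
        d2[THEN spec, THEN spec, THEN spec, THEN mp, THEN mp, THEN mp, OF lr dj] \<open>0 < K'\<close> by (intro mult_strict_left_mono) auto
    also have "\<dots> = e" using \<open>0 < K'\<close> by (simp add: field_simps)
    finally show "(\<Sum>k<n. \<bar>h (r k) - h (l k)\<bar>) < e" .
  qed (use \<open>0 < d1\<close> \<open>0 < d2\<close> in auto)
qed

lemma abs_cont_on_cong:
  assumes "abs_cont_on a b f" "\<And>t. a \<le> t \<Longrightarrow> t \<le> b \<Longrightarrow> g t = f t"
  shows "abs_cont_on a b g"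
  by (rule abs_cont_on_dominated[OF assms(1) assms(1), where K=1]) (use assms(2) in auto)

lemma abs_cont_on_const: "abs_cont_on a b (\<lambda>t. c)"
  unfolding abs_cont_on_def by (auto intro: exI[of _ 1])

lemma abs_cont_on_add:
  assumes "abs_cont_on a b f" "abs_cont_on a b g"
  shows "abs_cont_on a b (\<lambda>t. f t + g t)"
  by (rule abs_cont_on_dominated[OF assms, where K=1]) auto

lemma abs_cont_on_cmult:
  assumes "abs_cont_on a b f"
  shows "abs_cont_on a b (\<lambda>t. c * f t)"
proof (rule abs_cont_on_dominated[OF assms assms, where K="\<bar>c\<bar>"])
  fix s t
  have "\<bar>c * f t - c * f s\<bar> = \<bar>c\<bar> * \<bar>f t - f s\<bar>"
    by (simp add: abs_mult flip: right_diff_distrib)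
  also have "\<dots> \<le> \<bar>c\<bar> * (\<bar>f t - f s\<bar> + \<bar>f t - f s\<bar>)"
    by (intro mult_left_mono) auto
  finally show "\<bar>c * f t - c * f s\<bar> \<le> \<bar>c\<bar> * (\<bar>f t - f s\<bar> + \<bar>f t - f s\<bar>)" .
qed

lemma abs_cont_on_sum:
  assumes "finite I" "\<And>i. i \<in> I \<Longrightarrow> abs_cont_on a b (f i)"
  shows "abs_cont_on a b (\<lambda>t. \<Sum>i\<in>I. f i t)"
  using assms
proof (induction I)
  case (insert i I)
  then show ?case
    using abs_cont_on_add[of a b "f i" "\<lambda>t. \<Sum>i\<in>I. f i t"] by simp
qed (simp add: abs_cont_on_const)

text \<open>Both factors are continuous, hence bounded on the compact interval, and a common bound
  dominates the increments of the product.\<close>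

lemma abs_cont_on_mult:
  assumes f: "abs_cont_on a b f" and g: "abs_cont_on a b g"
  shows "abs_cont_on a b (\<lambda>t. f t * g t)"
proof -
  have "\<exists>C. \<forall>t\<in>{a..b}. \<bar>h t\<bar> \<le> C" if "abs_cont_on a b h" for h
    using compact_imp_bounded[OF compact_continuous_image[OF abs_cont_on_imp_continuous_on[OF that]]]
    by (auto simp: bounded_iff)
  then obtain C D where C: "\<And>t. t \<in> {a..b} \<Longrightarrow> \<bar>f t\<bar> \<le> C" and D: "\<And>t. t \<in> {a..b} \<Longrightarrow> \<bar>g t\<bar> \<le> D"
    using f g by metis
  show ?thesis
  proof (rule abs_cont_on_dominated[OF f g, where K="max C D"])
    fix s t assume st: "a \<le> s" "s \<le> t" "t \<le> b"
    have "f t * g t - f s * g s = g t * (f t - f s) + f s * (g t - g s)"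
      by (simp add: algebra_simps)
    then have "\<bar>f t * g t - f s * g s\<bar> \<le> \<bar>g t\<bar> * \<bar>f t - f s\<bar> + \<bar>f s\<bar> * \<bar>g t - g s\<bar>"
      by (metis abs_triangle_ineq abs_mult)
    also have "\<dots> \<le> max C D * \<bar>f t - f s\<bar> + max C D * \<bar>g t - g s\<bar>"
      using C[of s] D[of t] st by (intro add_mono mult_right_mono) (auto simp: le_max_iff_disj)
    finally show "\<bar>f t * g t - f s * g s\<bar> \<le> max C D * (\<bar>f t - f s\<bar> + \<bar>g t - g s\<bar>)"
      by (simp add: algebra_simps)
  qed
qed

section \<open>The fundamental theorem of calculus for absolutely continuous functions\<close>

lemma sum_content_le_measure:
  fixes I :: "'i set" and l r :: "'i \<Rightarrow> real"
  assumes I: "finite I" and lr: "\<And>i. i \<in> I \<Longrightarrow> l i \<le> r i"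
    and disj: "\<And>i j. i \<in> I \<Longrightarrow> j \<in> I \<Longrightarrow> i \<noteq> j \<Longrightarrow> {l i<..<r i} \<inter> {l j<..<r j} = {}"
    and sub: "\<And>i. i \<in> I \<Longrightarrow> {l i<..<r i} \<subseteq> T" and T: "T \<in> lmeasurable"
  shows "(\<Sum>i\<in>I. r i - l i) \<le> measure lebesgue T"
proof -
  have *: "{l i<..<r i} \<in> lmeasurable" for i
    using lmeasurable_box[of "l i" "r i"] by simp
  have "(\<Sum>i\<in>I. r i - l i) = (\<Sum>i\<in>I. measure lebesgue {l i<..<r i})"
    using lr by (intro sum.cong) auto
  also have "\<dots> = measure lebesgue (\<Union>i\<in>I. {l i<..<r i})"
    using disj * by (intro measure_UNION'[symmetric] I) (auto simp: pairwise_def disjnt_def)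
  also have "\<dots> \<le> measure lebesgue T"
    using sub * I by (intro measure_mono_fmeasurable[OF _ _ T]) (auto intro!: sets.finite_UN)
  finally show ?thesis .
qed

text \<open>The straddle lemma: since \<open>x\<close> lies between \<open>u\<close> and
  \<open>v\<close>, the two one-sided errors add up to \<open>e * (v - u)\<close>. This fits the
  cells of a tagged division, which contain their tags.\<close>

lemma straddle_has_real_derivative:
  assumes "(f has_real_derivative D) (at x)" "0 < e"
  obtains d where "0 < d"
    and "\<And>u v. u \<le> x \<Longrightarrow> x \<le> v \<Longrightarrow> u \<in> ball x d \<Longrightarrow> v \<in> ball x d \<Longrightarrow>
      \<bar>(v - u) * D - (f v - f u)\<bar> \<le> e * (v - u)"
proof -
  from assms obtain d where "0 < d"
    and d: "\<And>y. \<bar>y - x\<bar> < d \<Longrightarrow> \<bar>f y - f x - D * (y - x)\<bar> \<le> e * \<bar>y - x\<bar>"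
    unfolding has_field_derivative_def has_derivative_at_alt by auto
  have "\<bar>(v - u) * D - (f v - f u)\<bar> \<le> e * (v - u)"
    if "u \<le> x" "x \<le> v" "u \<in> ball x d" "v \<in> ball x d" for u v
  proof -
    have "(v - u) * D - (f v - f u) = (f u - f x - D * (u - x)) - (f v - f x - D * (v - x))"
      by (simp add: algebra_simps)
    then have "\<bar>(v - u) * D - (f v - f u)\<bar> \<le> e * \<bar>u - x\<bar> + e * \<bar>v - x\<bar>"
      using d[of u] d[of v] that by (auto simp: dist_real_def)
    also have "\<dots> = e * (v - u)" using that by (simp add: algebra_simps)
    finally show ?thesis .
  qed
  then show thesis using that \<open>0 < d\<close> by blast
qed

text \<open>
  The primitive is compared with Riemann sums on a fine tagged division: cells tagged outside the
  exceptional null set are handled by differentiability, and the remaining cells lie in an open set of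
  small measure, so absolute continuity bounds their total increment.
\<close>

theorem abs_cont_on_has_integral:
  assumes f: "abs_cont_on a b f" and "a \<le> b"
    and deriv: "AE t in lebesgue. t \<in> {a<..<b} \<longrightarrow> (f has_real_derivative g t) (at t)"
  shows "(g has_integral f b - f a) {a..b}"
proof -
  obtain N0 where N0: "negligible N0" "{t. \<not> (t \<in> {a<..<b} \<longrightarrow> (f has_real_derivative g t) (at t))} \<subseteq> N0"
    using deriv unfolding eventually_ae_filter_negligible by blast
  \<comment> \<open>The endpoints join the null set because \<open>deriv\<close> is silent
    there.\<close>
  define N where "N = N0 \<union> {a, b}"
  have "negligible N"
    unfolding N_def by (rule negligible_Un[OF N0(1)]) simp
  \<comment> \<open>With value 0 on \<open>N\<close>, the cells tagged there add nothing to the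
    Riemann sum, and only the increments of \<open>f\<close> over them remain to be
    estimated.\<close>
  define g0 where "g0 t = (if t \<in> N then 0 else g t)" for t
  have "(g0 has_integral f b - f a) {a..b}"
    unfolding has_integral_real
  proof (intro allI impI)
    fix e :: real assume "0 < e"
    \<comment> \<open>The summand 1 keeps the denominator positive when
      \<open>a = b\<close>.\<close>
    define e1 where "e1 = e / (2 * (b - a + 1))"
    have e1: "0 < e1" "e1 * (b - a) < e / 2"
      using \<open>0 < e\<close> \<open>a \<le> b\<close> by (auto simp: e1_def field_simps)
    have "\<exists>d>0. \<forall>u v. u \<le> x \<longrightarrow> x \<le> v \<longrightarrow> u \<in> ball x d \<longrightarrow> v \<in> ball x d \<longrightarrow>
      \<bar>(v - u) * g x - (f v - f u)\<bar> \<le> e1 * (v - u)" if "x \<in> {a..b} - N" for x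
    proof -
      from that have "(f has_real_derivative g x) (at x)" using N0(2) by (auto simp: N_def less_le)
      from straddle_has_real_derivative[OF this e1(1)] show ?thesis by metis
    qed
    then obtain D where D0: "\<And>x. x \<in> {a..b} - N \<Longrightarrow> 0 < D x" and
      D: "\<And>x u v. x \<in> {a..b} - N \<Longrightarrow> u \<le> x \<Longrightarrow> x \<le> v \<Longrightarrow> u \<in> ball x (D x) \<Longrightarrow> v \<in> ball x (D x) \<Longrightarrow>
      \<bar>(v - u) * g x - (f v - f u)\<bar> \<le> e1 * (v - u)" by metis
    note * = abs_cont_onD[OF f half_gt_zero[OF \<open>0 < e\<close>], where 'i="real \<times> real set"]
    then obtain d where "0 < d" and
      d: "\<forall>(I :: (real \<times> real set) set) l r. finite I \<longrightarrow> (\<forall>i\<in>I. a \<le> l i \<and> l i \<le> r i \<and> r i \<le> b) \<longrightarrow>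
      (\<forall>i\<in>I. \<forall>j\<in>I. i \<noteq> j \<longrightarrow> {l i<..<r i} \<inter> {l j<..<r j} = {}) \<longrightarrow>
      (\<Sum>i\<in>I. r i - l i) < d \<longrightarrow> (\<Sum>i\<in>I. \<bar>f (r i) - f (l i)\<bar>) < e / 2"
      by (elim exE conjE)
    obtain T where T: "open T" "N \<subseteq> T" "T \<in> lmeasurable" "measure lebesgue T < d"
    proof -
      obtain T where T: "open T" "N \<subseteq> T" "T - N \<in> lmeasurable" "emeasure lebesgue (T - N) < ennreal d"
        using sets_lebesgue_outer_open[OF _ \<open>0 < d\<close>, of N] negligible_imp_sets[OF \<open>negligible N\<close>] by auto
      have T_eq: "T = (T - N) \<union> N" using T(2) by auto
      have "T \<in> lmeasurable"
        using T(3) negligible_imp_measurable[OF \<open>negligible N\<close>] by (subst T_eq) (rule fmeasurable.Un)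
      moreover have "measure lebesgue T = measure lebesgue (T - N)"
        using measure_Un_null_set[of "T - N" lebesgue N] T(3) \<open>negligible N\<close> T_eq
        by (auto simp: negligible_iff_null_sets fmeasurable_def)
      moreover have "measure lebesgue (T - N) < d"
        using T(3,4) \<open>0 < d\<close> by (simp add: emeasure_eq_measure2 ennreal_less_iff)
      ultimately show ?thesis using that[of T] T by simp
    qed
    \<comment> \<open>A tag in \<open>N\<close> confines its cell to the small open set
      \<open>T\<close>; any other tag in the interval confines it to its straddle ball.\<close>
    define \<gamma> where "\<gamma> x = (if x \<in> N then T else if x \<in> {a..b} then ball x (D x) else ball x 1)" for x
    show "\<exists>\<gamma>. gauge \<gamma> \<and> (\<forall>\<D>. \<D> tagged_division_of {a..b} \<and> \<gamma> fine \<D> \<longrightarrow>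
        norm ((\<Sum>(x, k)\<in>\<D>. measure lborel k *\<^sub>R g0 x) - (f b - f a)) < e)"
    proof (intro exI[of _ \<gamma>] conjI allI impI)
      show "gauge \<gamma>" using T D0 by (auto simp: gauge_def \<gamma>_def)
    next
      fix p assume "p tagged_division_of {a..b} \<and> \<gamma> fine p"
      then have p: "p tagged_division_of {a..b}" and fine: "\<gamma> fine p" by auto
      have p': "p tagged_partial_division_of {a..b}"
        using p by (simp add: tagged_division_of_def)
      note pD = tagged_partial_division_ofD[OF p']
      have K: "\<exists>u v. snd i = {u..v} \<and> u \<le> fst i \<and> fst i \<le> v \<and> a \<le> u \<and> v \<le> b \<and> Inf (snd i) = u \<and> Sup (snd i) = v
          \<and> measure lborel (snd i) = v - u" if "i \<in> p" for i
      proof -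
        have i: "(fst i, snd i) \<in> p" using that by simp
        obtain u v where uv: "snd i = {u..v}" using pD(4)[OF i] by auto
        moreover have "fst i \<in> {u..v}" "{u..v} \<subseteq> {a..b}" using pD(2,3)[OF i] uv by auto
        ultimately show ?thesis by (auto intro!: exI[of _ u] exI[of _ v])
      qed
      define l r where "l i = Inf (snd i)" and "r i = Sup (snd i)" for i :: "real \<times> real set"
      have lr: "snd i = {l i..r i}" "l i \<le> fst i" "fst i \<le> r i" "a \<le> l i" "r i \<le> b"
        "measure lborel (snd i) = r i - l i" if "i \<in> p" for i
        using K[OF that] by (auto simp: l_def r_def)
      have disj: "{l i<..<r i} \<inter> {l j<..<r j} = {}" if "i \<in> p" "j \<in> p" "i \<noteq> j" for i j
      proof -
        have "(fst i, snd i) \<in> p" "(fst j, snd j) \<in> p" "(fst i, snd i) \<noteq> (fst j, snd j)"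
          using that by (auto simp: prod_eq_iff)
        from pD(5)[OF this] show ?thesis
          unfolding lr(1)[OF that(1)] lr(1)[OF that(2)] interior_atLeastAtMost_real .
      qed
      have fine': "snd i \<subseteq> \<gamma> (fst i)" if "i \<in> p" for i
        using fine that by (cases i) (auto simp: fine_def)
      have "finite p" by (rule pD(1))
      have telescope: "(\<Sum>i\<in>p. f (r i) - f (l i)) = f b - f a" "(\<Sum>i\<in>p. r i - l i) = b - a"
        using additive_tagged_division_1[OF \<open>a \<le> b\<close> p, of f]
          additive_tagged_division_1[OF \<open>a \<le> b\<close> p, of "\<lambda>x. x"]
        by (simp_all add: l_def r_def case_prod_beta)
      define p1 where "p1 = {i \<in> p. fst i \<in> N}"
      have p1: "p1 \<subseteq> p" "finite p1" using \<open>finite p\<close> by (auto simp: p1_def)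
      have small: "(\<Sum>i\<in>p1. \<bar>f (r i) - f (l i)\<bar>) < e / 2"
      proof (rule d[THEN spec, THEN spec, THEN spec, THEN mp, THEN mp, THEN mp, THEN mp, OF p1(2)])
        have "(\<Sum>i\<in>p1. r i - l i) \<le> measure lebesgue T"
        proof (rule sum_content_le_measure[OF p1(2) _ _ _ T(3)])
          fix i assume "i \<in> p1"
          then have "i \<in> p" "fst i \<in> N" by (auto simp: p1_def)
          then show "{l i<..<r i} \<subseteq> T"
            using fine'[of i] lr(1)[of i] by (auto simp: \<gamma>_def)
        next
          fix i assume "i \<in> p1"
          then show "l i \<le> r i" using lr(2,3)[of i] p1 by auto
        qed (use disj p1 in blast)
        with T(4) show "(\<Sum>i\<in>p1. r i - l i) < d" by simp
      next
        show "\<forall>i\<in>p1. a \<le> l i \<and> l i \<le> r i \<and> r i \<le> b" using lr p1 by (meson order_trans subsetD)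
        show "\<forall>i\<in>p1. \<forall>j\<in>p1. i \<noteq> j \<longrightarrow> {l i<..<r i} \<inter> {l j<..<r j} = {}" using disj p1 by blast
      qed
      have "\<bar>(\<Sum>i\<in>p. measure lborel (snd i) * g0 (fst i)) - (f b - f a)\<bar>
          = \<bar>\<Sum>i\<in>p. measure lborel (snd i) * g0 (fst i) - (f (r i) - f (l i))\<bar>"
        by (subst sum_subtractf) (simp only: telescope)
      also have "\<dots> \<le> (\<Sum>i\<in>p. \<bar>measure lborel (snd i) * g0 (fst i) - (f (r i) - f (l i))\<bar>)"
        by (rule sum_abs)
      also have "\<dots> \<le> (\<Sum>i\<in>p. e1 * (r i - l i) + (if i \<in> p1 then \<bar>f (r i) - f (l i)\<bar> else 0))"
      proof (rule sum_mono)
        fix i assume i: "i \<in> p"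
        have ge: "0 \<le> e1 * (r i - l i)" using lr(2,3)[OF i] e1 by simp
        show "\<bar>measure lborel (snd i) * g0 (fst i) - (f (r i) - f (l i))\<bar>
          \<le> e1 * (r i - l i) + (if i \<in> p1 then \<bar>f (r i) - f (l i)\<bar> else 0)"
        proof (cases "i \<in> p1")
          case True
          then have "g0 (fst i) = 0" by (auto simp: p1_def g0_def)
          then show ?thesis using True ge by simp
        next
          case False
          with i have N: "fst i \<notin> N" by (auto simp: p1_def)
          have x: "fst i \<in> {a..b} - N" using N lr[OF i] by auto
          have "{l i..r i} \<subseteq> ball (fst i) (D (fst i))"
            using fine'[OF i] lr(1)[OF i] N x by (auto simp: \<gamma>_def)
          moreover have "l i \<in> {l i..r i}" "r i \<in> {l i..r i}" using lr(2,3)[OF i] by auto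
          ultimately have "\<bar>(r i - l i) * g (fst i) - (f (r i) - f (l i))\<bar> \<le> e1 * (r i - l i)"
            by (intro D[OF x lr(2,3)[OF i]]) (rule subsetD, assumption+)+
          then show ?thesis using False N lr(6)[OF i] by (simp add: g0_def)
        qed
      qed
      also have "\<dots> = e1 * (b - a) + (\<Sum>i\<in>p1. \<bar>f (r i) - f (l i)\<bar>)"
        using \<open>finite p\<close> p1(1) telescope(2)
        by (simp add: sum.distrib flip: sum_distrib_left)
           (simp add: sum.inter_restrict[symmetric] Int_absorb1)
      also have "\<dots> < e" using small e1(2) by simp
      finally show "norm ((\<Sum>(x, k)\<in>p. measure lborel k *\<^sub>R g0 x) - (f b - f a)) < e"
        by (simp add: case_prod_beta)
    qed
  qed
  then show ?thesis
    by (rule has_integral_spike[OF \<open>negligible N\<close>, rotated]) (auto simp: g0_def)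
qed

section \<open>Differentiation of the indefinite integral\<close>

text \<open>
  Cells on which the difference quotient is far from \<open>f t\<close> form a Vitali cover of the bad set, and
  by the Henstock lemma disjoint cells of this kind have small total length.
\<close>

lemma AE_indefinite_integral_deriv:
  fixes f :: "real \<Rightarrow> real"
  assumes f: "f integrable_on {a..b}"
  shows "AE t in lebesgue. t \<in> {a<..<b} \<longrightarrow>
    ((\<lambda>x. integral {a..x} f) has_real_derivative f t) (at t)"
proof -
  define F where "F x = integral {a..x} f" for x
  \<comment> \<open>The last condition says that the difference quotient between \<open>t\<close>
    and \<open>y\<close> misses \<open>f t\<close> by more than \<open>1 / Suc n\<close>. Outside
    all the sets \<open>E n\<close> the primitive has derivative \<open>f t\<close>.\<close>
  define E where "E n = {t \<in> {a<..<b}. \<forall>d>0. \<exists>y\<in>{a<..<b}. y \<noteq> t \<and> \<bar>y - t\<bar> < d \<and>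
    \<bar>y - t\<bar> < real (Suc n) * \<bar>F y - F t - f t * (y - t)\<bar>}" for n
  have Fdiff: "integral {x..y} f = F y - F x" if "a \<le> x" "x \<le> y" "y \<le> b" for x y
    using Henstock_Kurzweil_Integration.integral_combine[of a x y f] that
      integrable_subinterval_real[OF f, of a y]
    by (simp add: F_def)
  have "negligible (E n)" for n
    unfolding negligible_outer_le
  proof (intro allI impI)
    fix e :: real assume "0 < e"
    \<comment> \<open>The length of a cell of the cover is less than \<open>Suc n\<close> times its
      Henstock error, so a total error below \<open>e'\<close> gives total length at most
      \<open>e\<close>.\<close>
    define e' where "e' = e / real (Suc n)"
    have "0 < e'" using \<open>0 < e\<close> by (simp add: e'_def)
    have "f integrable_on cbox a b" using f by simp
    from Henstock_lemma[OF this \<open>0 < e'\<close>] obtain \<gamma> where "gauge \<gamma>"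
      and \<gamma>: "\<And>p. p tagged_partial_division_of (cbox a b) \<Longrightarrow> \<gamma> fine p \<Longrightarrow>
             sum (\<lambda>(x,k). norm(measure lborel k *\<^sub>R f x - integral k f)) p < e'" by auto
    \<comment> \<open>The second point \<open>y\<close> may lie on either side of \<open>t\<close>.
      Centre and radius are introduced because the covering theorem is about balls.\<close>
    define I where "I i = {min (fst i) (snd i)..max (fst i) (snd i)}" for i :: "real \<times> real"
    define c where "c i = (fst i + snd i) / 2" for i :: "real \<times> real"
    define r where "r i = \<bar>snd i - fst i\<bar> / 2" for i :: "real \<times> real"
    have I_cball: "cball (c i) (r i) = I i" for i
      unfolding cball_eq_atLeastAtMost I_def c_def r_def
      by (auto simp: min_def max_def field_simps abs_if)
    define K where "K = {(t, y). t \<in> {a<..<b} \<and> y \<in> {a<..<b} \<and> y \<noteq> t \<and> I (t, y) \<subseteq> \<gamma> t \<and>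
      \<bar>y - t\<bar> < real (Suc n) * \<bar>F y - F t - f t * (y - t)\<bar>}"
    have rK: "0 < r i" if "i \<in> K" for i using that by (auto simp: K_def r_def)
    have cover: "\<exists>i. i \<in> K \<and> t \<in> cball (c i) (r i) \<and> r i < d" if t: "t \<in> E n" and "0 < d" for t d
    proof -
      have "open (\<gamma> t)" "t \<in> \<gamma> t" using \<open>gauge \<gamma>\<close> by (auto simp: gauge_def)
      then obtain d' where d': "0 < d'" "ball t d' \<subseteq> \<gamma> t" by (meson open_contains_ball)
      have "0 < min d d'" using \<open>0 < d\<close> d' by simp
      with t obtain y where y: "y \<in> {a<..<b}" "y \<noteq> t" "\<bar>y - t\<bar> < min d d'"
        "\<bar>y - t\<bar> < real (Suc n) * \<bar>F y - F t - f t * (y - t)\<bar>"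
        unfolding E_def by blast
      have "I (t, y) \<subseteq> ball t d'"
        using y by (auto simp: I_def dist_real_def)
      then have "(t, y) \<in> K" using y t d' by (auto simp: K_def E_def)
      moreover have "t \<in> cball (c (t, y)) (r (t, y))" unfolding I_cball by (auto simp: I_def)
      moreover have "r (t, y) < d" using y \<open>0 < d\<close> by (auto simp: r_def)
      ultimately show ?thesis by blast
    qed
    obtain C where C: "countable C" "C \<subseteq> K"
     "pairwise (\<lambda>i j. disjnt (cball (c i) (r i)) (cball (c j) (r j))) C"
     "negligible (E n - (\<Union>i \<in> C. cball (c i) (r i)))"
      by (rule Vitali_covering_theorem_cballs[of K r "E n" c, OF rK cover]) (assumption | (rule that; assumption))+
    \<comment> \<open>The Henstock lemma handles finitely many cells at a time; the bound is uniform
      and therefore passes to the countable union.\<close>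
    have fin: "measure lebesgue (\<Union>i\<in>C'. I i) \<le> e" if C': "C' \<subseteq> C" "finite C'" for C'
    proof -
      have dj: "I i \<inter> I j = {}" if "i \<in> C'" "j \<in> C'" "i \<noteq> j" for i j
        using C(3) C' that unfolding I_cball pairwise_def disjnt_def by blast
      have fstI: "fst i \<in> I i" for i by (auto simp: I_def)
      \<comment> \<open>Each cell is tagged at its endpoint \<open>t\<close>, the point whose
        difference quotient is bad.\<close>
      define p where "p = (\<lambda>i. (fst i, I i)) ` C'"
      have inj: "inj_on (\<lambda>i. (fst i, I i)) C'"
        using dj fstI by (intro inj_onI) (metis Pair_inject disjoint_iff)
      have "p tagged_partial_division_of (cbox a b)"
        unfolding tagged_partial_division_of_def
      proof (intro conjI allI impI)
        show "finite p" using C' by (simp add: p_def)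
        fix x1 K1 x2 K2 assume "(x1, K1) \<in> p \<and> (x2, K2) \<in> p \<and> (x1, K1) \<noteq> (x2, K2)"
        then obtain i j where "i \<in> C'" "j \<in> C'" "i \<noteq> j" "K1 = I i" "K2 = I j"
          by (auto simp: p_def)
        then show "interior K1 \<inter> interior K2 = {}"
          using dj interior_subset by blast
      next
        fix x K' assume "(x, K') \<in> p"
        then obtain i where i: "i \<in> C'" "x = fst i" "K' = I i" by (auto simp: p_def)
        then show "x \<in> K'" using fstI by simp
        have "i \<in> K" using i C' C by auto
        then show "K' \<subseteq> cbox a b" using i by (auto simp: K_def I_def)
        show "\<exists>a b. K' = cbox a b" unfolding i I_def by auto
      qed
      moreover have "\<gamma> fine p"
        using C C' by (fastforce simp: fine_def p_def K_def)
      ultimately have "sum (\<lambda>(x,k). norm(measure lborel k *\<^sub>R f x - integral k f)) p < e'"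
        by (rule \<gamma>)
      then have sum_less: "(\<Sum>i\<in>C'. \<bar>measure lborel (I i) * f (fst i) - integral (I i) f\<bar>) < e'"
        unfolding p_def by (simp add: sum.reindex[OF inj])
      have "measure lebesgue (\<Union>i\<in>C'. I i) \<le> (\<Sum>i\<in>C'. measure lebesgue (I i))"
        using C' by (intro measure_UNION_le) (auto simp: I_def)
      also have "\<dots> \<le> (\<Sum>i\<in>C'. real (Suc n) * \<bar>measure lborel (I i) * f (fst i) - integral (I i) f\<bar>)"
      proof (rule sum_mono)
        fix i assume "i \<in> C'"
        then have i: "i \<in> K" using C C' by auto
        obtain t y where ty: "i = (t, y)" by force
        have m: "measure lebesgue (I i) = \<bar>y - t\<bar>" "measure lborel (I i) = \<bar>y - t\<bar>"
          by (auto simp: I_def ty)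
        have "\<bar>F y - F t - f t * (y - t)\<bar> = \<bar>measure lborel (I i) * f (fst i) - integral (I i) f\<bar>"
        proof (cases "t \<le> y")
          case True
          then have "integral (I i) f = F y - F t"
            using i by (simp add: I_def ty K_def Fdiff)
          then show ?thesis using True unfolding m by (simp add: ty abs_minus_commute mult.commute)
        next
          case False
          then have "integral (I i) f = F t - F y"
            using i by (simp add: I_def ty K_def Fdiff)
          then show ?thesis using False unfolding m by (simp add: ty algebra_simps)
        qed
        then show "measure lebesgue (I i) \<le> real (Suc n) * \<bar>measure lborel (I i) * f (fst i) - integral (I i) f\<bar>"
          using i unfolding m(1) by (simp add: K_def ty)
      qed
      also have "\<dots> \<le> real (Suc n) * e'"
        using sum_less by (simp only: sum_distrib_left[symmetric]) (intro mult_left_mono, auto)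
      also have "\<dots> = e" by (simp add: e'_def)
      finally show ?thesis .
    qed
    have meas: "I i \<in> lmeasurable" for i by (simp add: I_def)
    have U: "(\<Union>i\<in>C. I i) \<in> lmeasurable" "measure lebesgue (\<Union>i\<in>C. I i) \<le> e"
      using fmeasurable_UN_bound[OF C(1) meas fin] measure_UN_bound[OF C(1) meas fin] by auto
    have N: "negligible (E n - (\<Union>i\<in>C. I i))" using C(4) unfolding I_cball .
    show "\<exists>T. E n \<subseteq> T \<and> T \<in> lmeasurable \<and> measure lebesgue T \<le> e"
    proof (intro exI[of _ "(\<Union>i\<in>C. I i) \<union> (E n - (\<Union>i\<in>C. I i))"] conjI)
      show "(\<Union>i\<in>C. I i) \<union> (E n - (\<Union>i\<in>C. I i)) \<in> lmeasurable"
        using U N by (intro fmeasurable.Un) (auto simp: negligible_imp_measurable)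
      show "measure lebesgue ((\<Union>i\<in>C. I i) \<union> (E n - (\<Union>i\<in>C. I i))) \<le> e"
        using U N measure_Un_null_set[of "\<Union>i\<in>C. I i" lebesgue "E n - (\<Union>i\<in>C. I i)"]
        by (simp add: negligible_iff_null_sets fmeasurableD)
    qed auto
  qed
  then have negl: "negligible (\<Union>n. E n)" by (intro negligible_countable_Union) auto
  have good: "(F has_real_derivative f t) (at t)" if t: "t \<in> {a<..<b}" and "t \<notin> (\<Union>n. E n)" for t
    unfolding has_field_derivative_def has_derivative_at_alt
  proof (intro conjI allI impI bounded_linear_mult_right)
    fix e :: real assume "0 < e"
    obtain n where n: "inverse (real (Suc n)) < e" using reals_Archimedean[OF \<open>0 < e\<close>] by blast
    have "t \<notin> E n" using that by auto
    then have "\<exists>d>0. \<forall>y\<in>{a<..<b}. y = t \<or> d \<le> \<bar>y - t\<bar> \<or>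
        real (Suc n) * \<bar>F y - F t - f t * (y - t)\<bar> \<le> \<bar>y - t\<bar>"
      using t unfolding E_def by (simp add: not_less)
    then obtain d where "0 < d" and d: "\<forall>y\<in>{a<..<b}. y = t \<or> d \<le> \<bar>y - t\<bar> \<or>
        real (Suc n) * \<bar>F y - F t - f t * (y - t)\<bar> \<le> \<bar>y - t\<bar>" by (elim exE conjE)
    define d' where "d' = min d (min (t - a) (b - t))"
    have "0 < d'" using \<open>0 < d\<close> t by (auto simp: d'_def)
    moreover have "norm (F y - F t - f t * (y - t)) \<le> e * norm (y - t)" if "norm (y - t) < d'" for y
    proof (cases "y = t")
      case False
      have "y \<in> {a<..<b}" "\<bar>y - t\<bar> < d" using that by (auto simp: d'_def)
      then have "real (Suc n) * \<bar>F y - F t - f t * (y - t)\<bar> \<le> \<bar>y - t\<bar>"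
        using d False by (meson not_less)
      then have "\<bar>F y - F t - f t * (y - t)\<bar> \<le> inverse (real (Suc n)) * \<bar>y - t\<bar>"
        by (simp add: field_simps)
      also have "\<dots> \<le> e * \<bar>y - t\<bar>" using n by (intro mult_right_mono) auto
      finally show ?thesis by simp
    qed simp
    ultimately show "\<exists>d>0. \<forall>y. norm (y - t) < d \<longrightarrow> norm (F y - F t - f t * (y - t)) \<le> e * norm (y - t)"
      by blast
  qed
  show ?thesis
    unfolding eventually_ae_filter_negligible
    by (rule exI[of _ "\<Union>n. E n"]) (use negl good in \<open>auto simp: F_def[abs_def]\<close>)
qed

text \<open>
  Square integrability allows the direct estimate
  $|f| \le \frac{c}{2} f^2 + \frac{1}{2c}$ with a suitable constant $c$.
\<close>

lemma abs_cont_on_indefinite_integral: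
  fixes f :: "real \<Rightarrow> real"
  assumes f: "f absolutely_integrable_on {a..b}" and f2: "(\<lambda>t. (f t)\<^sup>2) integrable_on {a..b}"
  shows "abs_cont_on a b (\<lambda>x. integral {a..x} f)"
  unfolding abs_cont_on_def
proof (intro allI impI)
  fix e :: real assume "0 < e"
  define J where "J = integral {a..b} (\<lambda>t. (f t)\<^sup>2)"
  have "0 \<le> J" unfolding J_def by (rule integral_nonneg[OF f2]) simp
  \<comment> \<open>With this \<open>c\<close> the terms \<open>c / 2 * f^2\<close> integrate to at
    most \<open>e / 2\<close>. The constant \<open>1 / (2 * c)\<close> costs less than
    \<open>e / 2\<close> on a set of total length below \<open>c * e\<close>, which is the witness
    chosen next.\<close>
  define c where "c = e / (J + 1)"
  have "0 < c" using \<open>0 < e\<close> \<open>0 \<le> J\<close> by (simp add: c_def)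
  have fi: "f integrable_on {a..b}" using f by (rule set_lebesgue_integral_eq_integral)
  show "\<exists>d>0. \<forall>(n::nat) l r. (\<forall>k<n. a \<le> l k \<and> l k \<le> r k \<and> r k \<le> b) \<longrightarrow>
     (\<forall>j<n. \<forall>k<n. j \<noteq> k \<longrightarrow> {l j<..<r j} \<inter> {l k<..<r k} = {}) \<longrightarrow>
     (\<Sum>k<n. r k - l k) < d \<longrightarrow>
     (\<Sum>k<n. \<bar>integral {a..r k} f - integral {a..l k} f\<bar>) < e"
  proof (intro exI[of _ "c * e"] conjI allI impI)
    show "0 < c * e" using \<open>0 < c\<close> \<open>0 < e\<close> by simp
    fix n :: nat and l r :: "nat \<Rightarrow> real"
    assume lr: "\<forall>k<n. a \<le> l k \<and> l k \<le> r k \<and> r k \<le> b"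
      and dj: "\<forall>j<n. \<forall>k<n. j \<noteq> k \<longrightarrow> {l j<..<r j} \<inter> {l k<..<r k} = {}"
      and sm: "(\<Sum>k<n. r k - l k) < c * e"
    have sub: "{l k..r k} \<subseteq> {a..b}" if "k < n" for k using lr that by auto
    have c2: "(\<lambda>t. c / 2 * (f t)\<^sup>2) integrable_on {l k..r k}" if "k < n" for k
      using integrable_cmul[OF integrable_subinterval_real[OF f2 sub[OF that]], of "c / 2"]
      unfolding real_scaleR_def .
    have each: "\<bar>integral {a..r k} f - integral {a..l k} f\<bar>
        \<le> c / 2 * integral {l k..r k} (\<lambda>t. (f t)\<^sup>2) + (r k - l k) / (2 * c)" if k: "k < n" for k
    proof -
      have "integral {a..r k} f - integral {a..l k} f = integral {l k..r k} f"
        using Henstock_Kurzweil_Integration.integral_combine[of a "l k" "r k" f] lr k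
          integrable_subinterval_real[OF fi, of a "r k"] by simp
      also have "\<bar>\<dots>\<bar> \<le> integral {l k..r k} (\<lambda>t. c / 2 * (f t)\<^sup>2 + 1 / (2 * c))"
        unfolding real_norm_def[symmetric]
      proof (rule integral_norm_bound_integral)
        show "f integrable_on {l k..r k}" by (rule integrable_subinterval_real[OF fi sub[OF k]])
        show "(\<lambda>t. c / 2 * (f t)\<^sup>2 + 1 / (2 * c)) integrable_on {l k..r k}"
          by (intro integrable_add c2[OF k]) auto
        fix x
        have "0 \<le> (c * \<bar>f x\<bar> - 1)\<^sup>2" by simp
        then have "2 * c * \<bar>f x\<bar> \<le> c * c * (f x)\<^sup>2 + 1"
          by (simp add: power2_eq_square algebra_simps)
        then show "norm (f x) \<le> c / 2 * (f x)\<^sup>2 + 1 / (2 * c)"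
          using \<open>0 < c\<close> by (simp add: field_simps)
      qed
      also have "\<dots> = c / 2 * integral {l k..r k} (\<lambda>t. (f t)\<^sup>2) + (r k - l k) / (2 * c)"
        using lr k c2[OF k] by (subst integral_add) auto
      finally show ?thesis .
    qed
    have "(\<Sum>k<n. integral {l k..r k} (\<lambda>t. (f t)\<^sup>2)) \<le> J"
    proof -
      have fk: "(\<lambda>t. (f t)\<^sup>2) integrable_on {l k..r k}" if "k < n" for k
        by (rule integrable_subinterval_real[OF f2 sub[OF that]])
      have U: "((\<lambda>t. (f t)\<^sup>2) has_integral (\<Sum>k<n. integral {l k..r k} (\<lambda>t. (f t)\<^sup>2))) (\<Union>k<n. {l k..r k})"
      proof (rule has_integral_UN)
        show "pairwise (\<lambda>i j. negligible ({l i..r i} \<inter> {l j..r j})) {..<n}"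
        proof (rule pairwiseI)
          fix i j assume "i \<in> {..<n}" "j \<in> {..<n}" "i \<noteq> j"
          then have "{l i<..<r i} \<inter> {l j<..<r j} = {}" using dj by simp
          then have "{l i..r i} \<inter> {l j..r j} \<subseteq> {l i, r i, l j, r j}"
          proof -
            assume *: "{l i<..<r i} \<inter> {l j<..<r j} = {}"
            show ?thesis
            proof (rule subsetI, rule ccontr)
              fix x assume "x \<in> {l i..r i} \<inter> {l j..r j}" "x \<notin> {l i, r i, l j, r j}"
              then have "x \<in> {l i<..<r i} \<inter> {l j<..<r j}" by (auto simp: less_le)
              with * show False by blast
            qed
          qed
          then show "negligible ({l i..r i} \<inter> {l j..r j})"
            by (rule negligible_subset[rotated]) simp
        qed
      qed (use fk in \<open>auto intro: integrable_integral\<close>)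
      then have "(\<Sum>k<n. integral {l k..r k} (\<lambda>t. (f t)\<^sup>2)) = integral (\<Union>k<n. {l k..r k}) (\<lambda>t. (f t)\<^sup>2)"
        by (rule integral_unique[symmetric])
      also have "\<dots> \<le> J" unfolding J_def
        using sub by (intro integral_subset_le has_integral_integrable[OF U] f2 UN_least) auto
      finally show ?thesis .
    qed
    then have "(\<Sum>k<n. \<bar>integral {a..r k} f - integral {a..l k} f\<bar>) \<le> c / 2 * J + (\<Sum>k<n. r k - l k) / (2 * c)"
    proof -
      assume J: "(\<Sum>k<n. integral {l k..r k} (\<lambda>t. (f t)\<^sup>2)) \<le> J"
      have "(\<Sum>k<n. \<bar>integral {a..r k} f - integral {a..l k} f\<bar>)
         \<le> (\<Sum>k<n. c / 2 * integral {l k..r k} (\<lambda>t. (f t)\<^sup>2) + (r k - l k) / (2 * c))"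
        using each by (intro sum_mono) auto
      also have "\<dots> = c / 2 * (\<Sum>k<n. integral {l k..r k} (\<lambda>t. (f t)\<^sup>2)) + (\<Sum>k<n. r k - l k) / (2 * c)"
        by (simp only: sum.distrib sum_distrib_left sum_divide_distrib)
      finally show ?thesis using J \<open>0 < c\<close> by (smt (verit) mult_left_mono half_gt_zero)
    qed
    also have "\<dots> < e / 2 + e / 2"
    proof (rule add_le_less_mono)
      show "c / 2 * J \<le> e / 2" using \<open>0 \<le> J\<close> \<open>0 < e\<close> by (simp add: c_def field_simps)
      show "(\<Sum>k<n. r k - l k) / (2 * c) < e / 2" using sm \<open>0 < c\<close> by (simp add: field_simps)
    qed
    finally show "(\<Sum>k<n. \<bar>integral {a..r k} f - integral {a..l k} f\<bar>) < e" by simp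
  qed
qed

section \<open>Linear differential equations with square integrable input\<close>

lemma uniform_limit_finite_sum:
  fixes f :: "'i \<Rightarrow> 'a \<Rightarrow> 'b \<Rightarrow> 'c::real_normed_vector"
  assumes "finite I" "\<And>i. i \<in> I \<Longrightarrow> uniform_limit X (f i) (l i) F"
  shows "uniform_limit X (\<lambda>m x. \<Sum>i\<in>I. f i m x) (\<lambda>x. \<Sum>i\<in>I. l i x) F"
  using assms by (induction I) (simp_all add: uniform_limit_const uniform_limit_add)

text \<open>The solution is the Neumann series \<open>\<Sum>k. h k\<close> of Picard increments.\<close>

lemma linear_integral_equation_solvable:
  fixes A :: "nat \<Rightarrow> nat \<Rightarrow> real" and g :: "nat \<Rightarrow> real \<Rightarrow> real"
  assumes "a \<le> b" and g: "\<And>i. i < n \<Longrightarrow> continuous_on {a..b} (g i)"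
  shows "\<exists>z. \<forall>i<n. continuous_on {a..b} (z i) \<and>
    (\<forall>t\<in>{a..b}. z i t = g i t + integral {a..t} (\<lambda>s. \<Sum>j<n. A i j * z j s))"
proof -
  \<comment> \<open>Increment 0 is \<open>g\<close>, and each further increment is the integral
    operator applied to the one before.\<close>
  define h where "h = rec_nat g (\<lambda>k hk i t. integral {a..t} (\<lambda>s. \<Sum>j<n. A i j * hk j s))"
  have h0: "h 0 = g" and hS: "h (Suc k) i t = integral {a..t} (\<lambda>s. \<Sum>j<n. A i j * h k j s)" for k i t
    by (simp_all add: h_def)
  have h_cont: "\<forall>i<n. continuous_on {a..b} (h k i)" for k
  proof (induction k)
    case (Suc k)
    show ?case
    proof (intro allI impI)
      fix i
      have "continuous_on {a..b} (\<lambda>s. \<Sum>j<n. A i j * h k j s)"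
        using Suc by (intro continuous_intros) auto
      then show "continuous_on {a..b} (h (Suc k) i)"
        using indefinite_integral_continuous_1[OF integrable_continuous_real]
        by (simp add: hS[abs_def])
    qed
  qed (use g h0 in auto)
  have "\<exists>G. \<forall>t\<in>{a..b}. \<bar>g i t\<bar> \<le> G" if "i < n" for i
    using compact_imp_bounded[OF compact_continuous_image[OF g[OF that]]]
    by (auto simp: bounded_iff)
  then obtain G0 where G0: "\<And>i t. i < n \<Longrightarrow> t \<in> {a..b} \<Longrightarrow> \<bar>g i t\<bar> \<le> G0 i" by metis
  define G where "G = (\<Sum>i<n. \<bar>G0 i\<bar>)"
  have "0 \<le> G" by (simp add: G_def sum_nonneg)
  have G: "\<bar>g i t\<bar> \<le> G" if "i < n" "t \<in> {a..b}" for i t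
  proof -
    have "\<bar>g i t\<bar> \<le> \<bar>G0 i\<bar>" using G0[OF that] by simp
    also have "\<dots> \<le> G" unfolding G_def using that by (intro member_le_sum) auto
    finally show ?thesis .
  qed
  \<comment> \<open>The sum of all entries is a crude common bound for the row sums.\<close>
  define L where "L = (\<Sum>i<n. \<Sum>j<n. \<bar>A i j\<bar>)"
  have "0 \<le> L" by (simp add: L_def sum_nonneg)
  have L: "(\<Sum>j<n. \<bar>A i j\<bar>) \<le> L" if "i < n" for i
    unfolding L_def using that by (intro member_le_sum[of i "{..<n}" "\<lambda>i. \<Sum>j<n. \<bar>A i j\<bar>"]) (auto simp: sum_nonneg)
  \<comment> \<open>The factorial makes the series converge on the whole interval, whatever its
    length and the size of \<open>A\<close>.\<close>
  have h_bound: "\<forall>i<n. \<forall>t\<in>{a..b}. \<bar>h k i t\<bar> \<le> G * (L * (t - a)) ^ k / fact k" for k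
  proof (induction k)
    case (Suc k)
    show ?case
    proof (intro allI impI ballI)
      fix i t assume i: "i < n" and t: "t \<in> {a..b}"
      have cont: "continuous_on {a..t} (\<lambda>s. \<Sum>j<n. A i j * h k j s)"
        using h_cont[of k] t by (intro continuous_intros) (auto intro: continuous_on_subset)
      have I: "((\<lambda>s. L * (G * (L * (s - a)) ^ k / fact k)) has_integral
          (G * (L * (t - a)) ^ Suc k / fact (Suc k) - G * (L * (a - a)) ^ Suc k / fact (Suc k))) {a..t}"
      proof (rule fundamental_theorem_of_calculus)
        fix x
        have "((\<lambda>s. G * (L * (s - a)) ^ Suc k / fact (Suc k)) has_real_derivative
            L * (G * (L * (x - a)) ^ k / fact k)) (at x)"
          by (rule derivative_eq_intros refl | simp)+
        then show "((\<lambda>s. G * (L * (s - a)) ^ Suc k / fact (Suc k)) has_vector_derivative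
            L * (G * (L * (x - a)) ^ k / fact k)) (at x within {a..t})"
          by (simp add: has_real_derivative_iff_has_vector_derivative[symmetric] has_field_derivative_at_within)
      qed (use t in auto)
      have "\<bar>h (Suc k) i t\<bar> \<le> integral {a..t} (\<lambda>s. L * (G * (L * (s - a)) ^ k / fact k))"
        unfolding hS real_norm_def[symmetric]
      proof (rule integral_norm_bound_integral)
        show "(\<lambda>s. \<Sum>j<n. A i j * h k j s) integrable_on {a..t}"
          by (rule integrable_continuous_real[OF cont])
        show "(\<lambda>s. L * (G * (L * (s - a)) ^ k / fact k)) integrable_on {a..t}"
          using I by (rule has_integral_integrable)
        fix s assume s: "s \<in> {a..t}"
        have "norm (\<Sum>j<n. A i j * h k j s) \<le> (\<Sum>j<n. \<bar>A i j\<bar> * (G * (L * (s - a)) ^ k / fact k))"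
        proof (rule sum_norm_le)
          fix j assume "j \<in> {..<n}"
          then have "\<bar>h k j s\<bar> \<le> G * (L * (s - a)) ^ k / fact k" using Suc s t by auto
          from mult_left_mono[OF this abs_ge_zero]
          show "norm (A i j * h k j s) \<le> \<bar>A i j\<bar> * (G * (L * (s - a)) ^ k / fact k)"
            by (simp only: real_norm_def abs_mult)
        qed
        also have "\<dots> = (\<Sum>j<n. \<bar>A i j\<bar>) * (G * (L * (s - a)) ^ k / fact k)"
          by (rule sum_distrib_right[symmetric])
        also have "\<dots> \<le> L * (G * (L * (s - a)) ^ k / fact k)"
          using L[OF i] \<open>0 \<le> G\<close> \<open>0 \<le> L\<close> s by (intro mult_right_mono) auto
        finally show "norm (\<Sum>j<n. A i j * h k j s) \<le> L * (G * (L * (s - a)) ^ k / fact k)" .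
      qed
      also have "\<dots> = G * (L * (t - a)) ^ Suc k / fact (Suc k)"
        using integral_unique[OF I] by simp
      finally show "\<bar>h (Suc k) i t\<bar> \<le> G * (L * (t - a)) ^ Suc k / fact (Suc k)" .
    qed
  qed (use G h0 in auto)
  define M where "M k = G * ((L * (b - a)) ^ k / fact k)" for k
  have "summable M"
    unfolding M_def using summable_exp[of "L * (b - a)"]
    by (intro summable_mult) (simp add: divide_inverse mult.commute)
  have hM: "norm (h k i t) \<le> M k" if "i < n" "t \<in> {a..b}" for k i t
  proof -
    have "\<bar>h k i t\<bar> \<le> G * (L * (t - a)) ^ k / fact k" using h_bound that by blast
    also have "\<dots> = G * ((L * (t - a)) ^ k / fact k)" by simp
    also have "\<dots> \<le> M k"
      unfolding M_def using that \<open>0 \<le> G\<close> \<open>0 \<le> L\<close> \<open>a \<le> b\<close>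
      by (intro mult_left_mono divide_right_mono power_mono) auto
    finally show ?thesis by simp
  qed
  define z where "z i t = (\<Sum>k. h k i t)" for i t
  define P where "P m i t = (\<Sum>k<m. h k i t)" for m i t
  have P_cont: "continuous_on {a..b} (P m i)" if "i < n" for m i
    unfolding P_def using h_cont that by (intro continuous_intros) auto
  have P_lim: "uniform_limit {a..b} (\<lambda>m. P m i) (z i) sequentially" if "i < n" for i
    using Weierstrass_m_test[of "{a..b}" "\<lambda>k. h k i" M] hM[OF that] \<open>summable M\<close>
    by (simp add: P_def[abs_def] z_def[abs_def])
  have z_cont: "continuous_on {a..b} (z i)" if "i < n" for i
    by (rule uniform_limit_theorem[OF _ P_lim[OF that]]) (auto intro!: always_eventually P_cont[OF that])
  \<comment> \<open>The partial sums satisfy the equation up to a shift of the index, and the shift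
    disappears in the uniform limit.\<close>
  have P_Suc: "P (Suc m) i t = g i t + integral {a..t} (\<lambda>s. \<Sum>j<n. A i j * P m j s)"
    if "i < n" "t \<in> {a..b}" for m i t
  proof (induction m)
    case 0
    then show ?case by (simp add: P_def h0)
  next
    case (Suc m)
    have c: "(\<lambda>s. \<Sum>j<n. A i j * f j s) integrable_on {a..t}" if "\<And>j. j < n \<Longrightarrow> continuous_on {a..b} (f j)" for f
      using that \<open>t \<in> {a..b}\<close>
      by (intro integrable_continuous_real continuous_intros) (auto intro: continuous_on_subset[of "{a..b}"])
    have "P (Suc (Suc m)) i t = P (Suc m) i t + h (Suc m) i t" by (simp add: P_def)
    also have "\<dots> = g i t + (integral {a..t} (\<lambda>s. \<Sum>j<n. A i j * P m j s)
        + integral {a..t} (\<lambda>s. \<Sum>j<n. A i j * h m j s))"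
      by (simp add: Suc hS)
    also have "\<dots> = g i t + integral {a..t} (\<lambda>s. (\<Sum>j<n. A i j * P m j s) + (\<Sum>j<n. A i j * h m j s))"
      using P_cont h_cont by (subst integral_add) (auto intro!: c)
    also have "(\<lambda>s. (\<Sum>j<n. A i j * P m j s) + (\<Sum>j<n. A i j * h m j s)) = (\<lambda>s. \<Sum>j<n. A i j * P (Suc m) j s)"
      by (simp add: P_def distrib_left sum.distrib)
    finally show ?case .
  qed
  have "z i t = g i t + integral {a..t} (\<lambda>s. \<Sum>j<n. A i j * z j s)" if i: "i < n" and t: "t \<in> {a..b}" for i t
  proof (rule LIMSEQ_unique)
    have "(\<lambda>m. P m i t) \<longlonglongrightarrow> z i t" by (rule tendsto_uniform_limitI[OF P_lim[OF i] t])
    then show "(\<lambda>m. P (Suc m) i t) \<longlonglongrightarrow> z i t" by (rule LIMSEQ_Suc)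
    have ul: "uniform_limit {a..t} (\<lambda>m s. \<Sum>j<n. A i j * P m j s) (\<lambda>s. \<Sum>j<n. A i j * z j s) sequentially"
    proof (rule uniform_limit_finite_sum[OF finite_lessThan])
      fix j assume "j \<in> {..<n}"
      then have "uniform_limit {a..t} (\<lambda>m. P m j) (z j) sequentially"
        using t by (intro uniform_limit_on_subset[OF P_lim]) auto
      then show "uniform_limit {a..t} (\<lambda>m s. A i j * P m j s) (\<lambda>s. A i j * z j s) sequentially"
        by (rule bounded_linear.uniform_limit[OF bounded_linear_mult_right])
    qed
    have ct: "continuous_on {a..t} (\<lambda>s. \<Sum>j<n. A i j * P m j s)" for m
      using P_cont t by (intro continuous_intros) (auto intro: continuous_on_subset[of "{a..b}"])
    obtain I J where IJ: "\<And>m. ((\<lambda>s. \<Sum>j<n. A i j * P m j s) has_integral I m) {a..t}"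
      "((\<lambda>s. \<Sum>j<n. A i j * z j s) has_integral J) {a..t}" "I \<longlonglongrightarrow> J"
      using uniform_limit_integral[OF ul ct] by auto
    have "(\<lambda>m. integral {a..t} (\<lambda>s. \<Sum>j<n. A i j * P m j s)) \<longlonglongrightarrow> integral {a..t} (\<lambda>s. \<Sum>j<n. A i j * z j s)"
      using IJ(3) by (simp add: integral_unique[OF IJ(1)] integral_unique[OF IJ(2)])
    then show "(\<lambda>m. P (Suc m) i t) \<longlonglongrightarrow> g i t + integral {a..t} (\<lambda>s. \<Sum>j<n. A i j * z j s)"
      unfolding P_Suc[OF i t] by (intro tendsto_intros)
  qed
  with z_cont show ?thesis by blast
qed

text \<open>Integrating the input first moves it into a continuous forcing term, so that only an
  integral equation with continuous data has to be solved. The differential equation then holds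
  wherever all the primitives are differentiable.\<close>

lemma linear_ode_solvable:
  fixes A B :: "nat \<Rightarrow> nat \<Rightarrow> real" and u :: "nat \<Rightarrow> real \<Rightarrow> real" and x0 :: "nat \<Rightarrow> real"
  assumes "a \<le> b"
    and u: "\<And>l. l < m \<Longrightarrow> u l absolutely_integrable_on {a..b}"
    and u2: "\<And>l. l < m \<Longrightarrow> (\<lambda>t. (u l t)\<^sup>2) integrable_on {a..b}"
  shows "\<exists>z. (\<forall>i<n. z i a = x0 i \<and> abs_cont_on a b (z i)) \<and>
    (AE t in lebesgue. t \<in> {a<..<b} \<longrightarrow> (\<forall>i<n. (z i has_real_derivative
       (\<Sum>j<n. A i j * z j t) + (\<Sum>l<m. B i l * u l t)) (at t)))"
proof -
  define g where "g i t = x0 i + (\<Sum>l<m. B i l * integral {a..t} (u l))" for i t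
  have g_ac: "abs_cont_on a b (g i)" for i
    unfolding g_def using u u2
    by (intro abs_cont_on_add abs_cont_on_const abs_cont_on_sum abs_cont_on_cmult
        abs_cont_on_indefinite_integral) auto
  then have g_cont: "continuous_on {a..b} (g i)" for i
    by (rule abs_cont_on_imp_continuous_on)
  have "\<exists>z. \<forall>i<n. continuous_on {a..b} (z i) \<and>
      (\<forall>t\<in>{a..b}. z i t = g i t + integral {a..t} (\<lambda>s. \<Sum>j<n. A i j * z j s))"
    by (rule linear_integral_equation_solvable[OF \<open>a \<le> b\<close> g_cont])
  then obtain y where "\<forall>i<n. continuous_on {a..b} (y i) \<and>
      (\<forall>t\<in>{a..b}. y i t = g i t + integral {a..t} (\<lambda>s. \<Sum>j<n. A i j * y j s))"
    by (elim exE)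
  then have y: "continuous_on {a..b} (y i)"
    and y_eq: "t \<in> {a..b} \<Longrightarrow> y i t = g i t + integral {a..t} (\<lambda>s. \<Sum>j<n. A i j * y j s)"
    if "i < n" for i t using that by simp_all
  define f where "f i s = (\<Sum>j<n. A i j * y j s)" for i s
  have f_cont: "continuous_on {a..b} (f i)" for i
    unfolding f_def using y by (intro continuous_intros) auto
  \<comment> \<open>The equation for \<open>y\<close> is known on the interval only.
    \<open>z\<close> is given by its right-hand side for every \<open>t\<close>, so the derivative
    rules apply to it directly.\<close>
  define z where "z i t = g i t + integral {a..t} (f i)" for i t
  have z_eq: "z i t = y i t" if "i < n" "t \<in> {a..b}" for i t
    using y_eq[OF that] by (simp add: z_def f_def[abs_def])
  have "AE t in lebesgue. \<forall>l\<in>{..<m}. t \<in> {a<..<b} \<longrightarrow>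
      ((\<lambda>x. integral {a..x} (u l)) has_real_derivative u l t) (at t)"
    using u by (intro AE_finite_allI AE_indefinite_integral_deriv set_lebesgue_integral_eq_integral(1)) auto
  moreover have "AE t in lebesgue. \<forall>i\<in>{..<n}. t \<in> {a<..<b} \<longrightarrow>
      ((\<lambda>x. integral {a..x} (f i)) has_real_derivative f i t) (at t)"
    by (intro AE_finite_allI AE_indefinite_integral_deriv integrable_continuous_real f_cont) auto
  ultimately have "AE t in lebesgue. t \<in> {a<..<b} \<longrightarrow> (\<forall>i<n. (z i has_real_derivative
       (\<Sum>j<n. A i j * z j t) + (\<Sum>l<m. B i l * u l t)) (at t))"
  proof eventually_elim
    case (elim t)
    show ?case
    proof (intro impI allI)
      fix i assume t: "t \<in> {a<..<b}" and i: "i < n"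
      have "(z i has_real_derivative (0 + (\<Sum>l<m. B i l * u l t)) + f i t) (at t)"
        unfolding z_def g_def using elim t i
        by (intro DERIV_add DERIV_const DERIV_sum DERIV_cmult) auto
      moreover have "f i t = (\<Sum>j<n. A i j * z j t)"
        using t by (simp add: f_def z_eq)
      ultimately show "(z i has_real_derivative
       (\<Sum>j<n. A i j * z j t) + (\<Sum>l<m. B i l * u l t)) (at t)" by (simp add: add.commute)
    qed
  qed
  moreover have "z i a = x0 i" for i by (simp add: z_def g_def)
  moreover have "abs_cont_on a b (z i)" for i
    unfolding z_def using f_cont
    by (intro abs_cont_on_add g_ac abs_cont_on_indefinite_integral
        absolutely_integrable_continuous_real integrable_continuous_real continuous_intros)
  ultimately show ?thesis by blast
qed

section \<open>Dissipation inequalities\<close>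

text \<open>The observability inequality is evaluated at \<open>z = x - X\<close>, the reachability
  inequality at \<open>v = (x + X) / \<mu>\<close>, chosen so that \<open>\<mu> * v\<close> is
  \<open>x + X\<close> again. The two systems keep \<open>k\<close> and \<open>k'\<close>
  coordinates, and the comparison is made coordinate by coordinate.\<close>

lemma dissipation_inequality:
  fixes A B C :: "nat \<Rightarrow> nat \<Rightarrow> real" and \<mu> x X dx dX u :: "nat \<Rightarrow> real"
  assumes "0 < s" and pos: "\<And>i. i < n \<Longrightarrow> 0 < \<mu> i"
    and obs: "\<And>v. 2 * (\<Sum>i<n. \<mu> i * v i * (\<Sum>j<n. A i j * v j)) + (\<Sum>l<p. (\<Sum>j<n. C l j * v j)\<^sup>2) \<le> 0"
    and reach: "\<And>v. 2 * (\<Sum>i<n. v i * (\<Sum>j<n. A i j * (\<mu> j * v j))) + (\<Sum>l<m. (\<Sum>i<n. B i l * v i)\<^sup>2) \<le> 0"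
    and k: "k' \<le> k" and eq: "\<And>i. k' \<le> i \<Longrightarrow> i < k \<Longrightarrow> \<mu> i = s"
    and x0: "\<And>i. k \<le> i \<Longrightarrow> x i = 0" and X0: "\<And>i. k' \<le> i \<Longrightarrow> X i = 0"
    and dx: "\<And>i. i < k \<Longrightarrow> dx i = (\<Sum>j<n. A i j * x j) + (\<Sum>l<m. B i l * u l)"
    and dX: "\<And>i. i < k' \<Longrightarrow> dX i = (\<Sum>j<n. A i j * X j) + (\<Sum>l<m. B i l * u l)"
    and dX0: "\<And>i. k' \<le> i \<Longrightarrow> dX i = 0"
  shows "(\<Sum>i<n. 2 * \<mu> i * (x i - X i) * (dx i - dX i) + s\<^sup>2 * (2 * (x i + X i) * (dx i + dX i) / \<mu> i))
    \<le> 4 * s\<^sup>2 * (\<Sum>l<m. (u l)\<^sup>2) - (\<Sum>l<p. ((\<Sum>j<n. C l j * x j) - (\<Sum>j<n. C l j * X j))\<^sup>2)"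
proof -
  define z where "z i = x i - X i" for i
  define v where "v i = (x i + X i) / \<mu> i" for i
  define b where "b i = (\<Sum>l<m. B i l * u l)" for i
  have Az: "(\<Sum>j<n. A i j * z j) = (\<Sum>j<n. A i j * x j) - (\<Sum>j<n. A i j * X j)" for i
    by (simp add: z_def right_diff_distrib sum_subtractf)
  have Av: "(\<Sum>j<n. A i j * (\<mu> j * v j)) = (\<Sum>j<n. A i j * x j) + (\<Sum>j<n. A i j * X j)" for i
  proof -
    have "(\<Sum>j<n. A i j * (\<mu> j * v j)) = (\<Sum>j<n. A i j * (x j + X j))"
      using pos by (intro sum.cong) (force simp: v_def)+
    then show ?thesis by (simp add: distrib_left sum.distrib)
  qed
  have Cz: "(\<Sum>j<n. C l j * z j) = (\<Sum>j<n. C l j * x j) - (\<Sum>j<n. C l j * X j)" for l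
    by (simp add: z_def right_diff_distrib sum_subtractf)
  have term_eq: "2 * \<mu> i * (x i - X i) * (dx i - dX i) + s\<^sup>2 * (2 * (x i + X i) * (dx i + dX i) / \<mu> i)
     = 2 * (\<mu> i * z i * (\<Sum>j<n. A i j * z j))
       + s\<^sup>2 * (2 * (v i * (\<Sum>j<n. A i j * (\<mu> j * v j))) + 4 * (v i * b i))" if "i < n" for i
  proof -
    consider "i < k'" | "k' \<le> i" "i < k" | "k \<le> i" by linarith
    then show ?thesis
    proof cases
      case 1
      then have "dx i = (\<Sum>j<n. A i j * x j) + b i" "dX i = (\<Sum>j<n. A i j * X j) + b i"
        using dx dX k by (auto simp: b_def)
      then show ?thesis unfolding Az Av by (simp add: z_def v_def algebra_simps add_divide_distrib)
    next
      \<comment> \<open>Only the smaller system drops this coordinate. With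
        \<open>\<mu> i = s\<close> the terms containing \<open>A X\<close> cancel, and both sides
        become \<open>4 * s * x i * dx i\<close>.\<close>
      case 2
      then have "dx i = (\<Sum>j<n. A i j * x j) + b i" "dX i = 0" "X i = 0" "\<mu> i = s"
        using dx dX0 X0 eq by (auto simp: b_def)
      then show ?thesis unfolding Az Av using \<open>0 < s\<close>
        by (simp add: z_def v_def field_simps power2_eq_square)
    next
      case 3
      then have "x i = 0" "X i = 0" using x0 X0 k by auto
      then show ?thesis by (simp add: z_def v_def)
    qed
  qed
  \<comment> \<open>Completing the square: the square of \<open>B\<close> transposed applied to
    \<open>v\<close> is what the reachability inequality absorbs, leaving four times the squared
    input.\<close>
  have cross: "4 * (\<Sum>i<n. v i * b i) \<le> (\<Sum>l<m. (\<Sum>i<n. B i l * v i)\<^sup>2) + 4 * (\<Sum>l<m. (u l)\<^sup>2)"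
  proof -
    have "(\<Sum>i<n. v i * b i) = (\<Sum>i<n. \<Sum>l<m. B i l * v i * u l)"
      by (simp add: b_def sum_distrib_left mult_ac)
    also have "\<dots> = (\<Sum>l<m. (\<Sum>i<n. B i l * v i) * u l)"
      by (subst sum.swap) (simp add: sum_distrib_right)
    finally have "4 * (\<Sum>i<n. v i * b i) = (\<Sum>l<m. 4 * ((\<Sum>i<n. B i l * v i) * u l))"
      by (simp add: sum_distrib_left)
    also have "\<dots> \<le> (\<Sum>l<m. (\<Sum>i<n. B i l * v i)\<^sup>2 + 4 * (u l)\<^sup>2)"
    proof (rule sum_mono)
      fix l
      have "0 \<le> ((\<Sum>i<n. B i l * v i) - 2 * u l)\<^sup>2" by simp
      then show "4 * ((\<Sum>i<n. B i l * v i) * u l) \<le> (\<Sum>i<n. B i l * v i)\<^sup>2 + 4 * (u l)\<^sup>2"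
        by (simp add: power2_eq_square algebra_simps)
    qed
    finally show ?thesis by (simp add: sum.distrib sum_distrib_left)
  qed
  have "(\<Sum>i<n. 2 * \<mu> i * (x i - X i) * (dx i - dX i) + s\<^sup>2 * (2 * (x i + X i) * (dx i + dX i) / \<mu> i))
    = 2 * (\<Sum>i<n. \<mu> i * z i * (\<Sum>j<n. A i j * z j))
      + s\<^sup>2 * (2 * (\<Sum>i<n. v i * (\<Sum>j<n. A i j * (\<mu> j * v j))) + 4 * (\<Sum>i<n. v i * b i))"
    (is "_ = ?R")
  proof -
    have "(\<Sum>i<n. 2 * \<mu> i * (x i - X i) * (dx i - dX i) + s\<^sup>2 * (2 * (x i + X i) * (dx i + dX i) / \<mu> i))
      = (\<Sum>i<n. 2 * (\<mu> i * z i * (\<Sum>j<n. A i j * z j))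
       + s\<^sup>2 * (2 * (v i * (\<Sum>j<n. A i j * (\<mu> j * v j))) + 4 * (v i * b i)))"
      by (rule sum.cong[OF refl], rule term_eq) simp
    also have "\<dots> = ?R"
      by (simp only: sum.distrib sum_distrib_left[symmetric])
    finally show ?thesis .
  qed
  also have "\<dots> \<le> - (\<Sum>l<p. (\<Sum>j<n. C l j * z j)\<^sup>2) + s\<^sup>2 * (4 * (\<Sum>l<m. (u l)\<^sup>2))"
    using obs[of z] reach[of v] cross by (intro add_mono mult_left_mono) auto
  finally show ?thesis by (simp add: Cz)
qed

text \<open>A truncated reset is the full reset of the padded state followed by deletion of
  coordinates, where \<open>k\<close> and \<open>k'\<close> are the orders of the target mode.
  Deletion in both systems discards nonnegative terms; the delicate coordinates are those deleted in
  one system only.\<close>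

lemma storage_reset:
  fixes M :: "nat \<Rightarrow> nat \<Rightarrow> real" and \<mu> \<nu> x X x' X' :: "nat \<Rightarrow> real"
  assumes "0 < s" and pos: "\<And>i. i < n' \<Longrightarrow> 0 < \<nu> i"
    and obs: "\<And>v. (\<Sum>i<n'. \<nu> i * (\<Sum>j<n. M i j * v j)\<^sup>2) \<le> (\<Sum>j<n. \<mu> j * (v j)\<^sup>2)"
    and reach: "\<And>v. (\<Sum>i<n'. (\<Sum>j<n. M i j * v j)\<^sup>2 / \<nu> i) \<le> (\<Sum>j<n. (v j)\<^sup>2 / \<mu> j)"
    and k: "k' \<le> k" and eq: "\<And>i. k' \<le> i \<Longrightarrow> i < k \<Longrightarrow> \<nu> i = s"
    and x': "\<And>i. i < k \<Longrightarrow> x' i = (\<Sum>j<n. M i j * x j)" and x'0: "\<And>i. k \<le> i \<Longrightarrow> x' i = 0"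
    and X': "\<And>i. i < k' \<Longrightarrow> X' i = (\<Sum>j<n. M i j * X j)" and X'0: "\<And>i. k' \<le> i \<Longrightarrow> X' i = 0"
  shows "(\<Sum>i<n'. \<nu> i * (x' i - X' i)\<^sup>2 + s\<^sup>2 * ((x' i + X' i)\<^sup>2 / \<nu> i))
    \<le> (\<Sum>j<n. \<mu> j * (x j - X j)\<^sup>2 + s\<^sup>2 * ((x j + X j)\<^sup>2 / \<mu> j))"
proof -
  have "(\<Sum>i<n'. \<nu> i * (x' i - X' i)\<^sup>2 + s\<^sup>2 * ((x' i + X' i)\<^sup>2 / \<nu> i))
    \<le> (\<Sum>i<n'. \<nu> i * (\<Sum>j<n. M i j * (x j - X j))\<^sup>2 + s\<^sup>2 * ((\<Sum>j<n. M i j * (x j + X j))\<^sup>2 / \<nu> i))"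
  proof (rule sum_mono)
    fix i assume "i \<in> {..<n'}"
    then have "0 < \<nu> i" using pos by simp
    define c d where "c = (\<Sum>j<n. M i j * x j)" and "d = (\<Sum>j<n. M i j * X j)"
    have cd: "(\<Sum>j<n. M i j * (x j - X j)) = c - d" "(\<Sum>j<n. M i j * (x j + X j)) = c + d"
      by (simp_all add: c_def d_def algebra_simps sum.distrib sum_subtractf)
    consider "i < k'" | "k' \<le> i" "i < k" | "k \<le> i" by linarith
    then show "\<nu> i * (x' i - X' i)\<^sup>2 + s\<^sup>2 * ((x' i + X' i)\<^sup>2 / \<nu> i)
        \<le> \<nu> i * (\<Sum>j<n. M i j * (x j - X j))\<^sup>2 + s\<^sup>2 * ((\<Sum>j<n. M i j * (x j + X j))\<^sup>2 / \<nu> i)"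
      unfolding cd
    proof cases
      case 1
      then show "\<nu> i * (x' i - X' i)\<^sup>2 + s\<^sup>2 * ((x' i + X' i)\<^sup>2 / \<nu> i)
        \<le> \<nu> i * (c - d)\<^sup>2 + s\<^sup>2 * ((c + d)\<^sup>2 / \<nu> i)"
        using x' X' k by (simp add: c_def d_def)
    next
      \<comment> \<open>The common weight \<open>s\<close> removes the mixed terms from the sum of
        \<open>(c - d)^2\<close> and \<open>(c + d)^2\<close>, so deleting \<open>d\<close> can only
        lower the value.\<close>
      case 2
      then have *: "\<nu> i = s" "x' i = c" "X' i = 0" using eq x' X'0 by (auto simp: c_def)
      have sr: "s\<^sup>2 * (r / s) = s * r" for r using \<open>0 < s\<close> by (simp add: power2_eq_square)
      have "\<nu> i * (x' i - X' i)\<^sup>2 + s\<^sup>2 * ((x' i + X' i)\<^sup>2 / \<nu> i) = s * (2 * c\<^sup>2)"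
        "\<nu> i * (c - d)\<^sup>2 + s\<^sup>2 * ((c + d)\<^sup>2 / \<nu> i) = s * (2 * c\<^sup>2 + 2 * d\<^sup>2)"
        by (simp_all only: * sr) (simp_all add: power2_eq_square algebra_simps)
      then show "\<nu> i * (x' i - X' i)\<^sup>2 + s\<^sup>2 * ((x' i + X' i)\<^sup>2 / \<nu> i)
        \<le> \<nu> i * (c - d)\<^sup>2 + s\<^sup>2 * ((c + d)\<^sup>2 / \<nu> i)"
        using \<open>0 < s\<close> by simp
    next
      case 3
      then have "x' i = 0" "X' i = 0" using x'0 X'0 k by auto
      then show "\<nu> i * (x' i - X' i)\<^sup>2 + s\<^sup>2 * ((x' i + X' i)\<^sup>2 / \<nu> i)
        \<le> \<nu> i * (c - d)\<^sup>2 + s\<^sup>2 * ((c + d)\<^sup>2 / \<nu> i)"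
        using \<open>0 < \<nu> i\<close> by simp
    qed
  qed
  also have "\<dots> \<le> (\<Sum>j<n. \<mu> j * (x j - X j)\<^sup>2) + s\<^sup>2 * (\<Sum>j<n. (x j + X j)\<^sup>2 / \<mu> j)"
    using mult_left_mono[OF reach[of "\<lambda>j. x j + X j"], of "s\<^sup>2"] obs[of "\<lambda>j. x j - X j"]
    by (simp add: sum.distrib sum_distrib_left)
  also have "\<dots> = (\<Sum>j<n. \<mu> j * (x j - X j)\<^sup>2 + s\<^sup>2 * ((x j + X j)\<^sup>2 / \<mu> j))"
    by (simp add: sum.distrib sum_distrib_left)
  finally show ?thesis .
qed

text \<open>
  All states are padded with zeros to the full dimension \<open>n g\<close> of the mode, so the truncated
  systems share the coefficients of the full one.
\<close>

locale balanced_run =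
  fixes n :: "'q::finite \<Rightarrow> nat" and m p :: nat
    and A B C :: "'q \<Rightarrow> nat \<Rightarrow> nat \<Rightarrow> real" and M :: "'q \<Rightarrow> 'e \<Rightarrow> nat \<Rightarrow> nat \<Rightarrow> real"
    and \<delta> :: "'q \<Rightarrow> 'e \<Rightarrow> 'q" and \<sigma> :: "'q \<Rightarrow> nat \<Rightarrow> real"
    and q :: "nat \<Rightarrow> 'q" and \<gamma> :: "nat \<Rightarrow> 'e" and T :: "nat \<Rightarrow> real" and u :: "nat \<Rightarrow> real \<Rightarrow> real"
  assumes sigma_pos: "i < n g \<Longrightarrow> 0 < \<sigma> g i"
    and obs: "2 * (\<Sum>i<n g. \<sigma> g i * v i * (\<Sum>j<n g. A g i j * v j))
      + (\<Sum>l<p. (\<Sum>j<n g. C g l j * v j)\<^sup>2) \<le> 0"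
    and reach: "2 * (\<Sum>i<n g. v i * (\<Sum>j<n g. A g i j * (\<sigma> g j * v j)))
      + (\<Sum>l<m. (\<Sum>i<n g. B g i l * v i)\<^sup>2) \<le> 0"
    and obs_reset: "(\<Sum>i<n (\<delta> g e). \<sigma> (\<delta> g e) i * (\<Sum>j<n g. M g e i j * v j)\<^sup>2)
      \<le> (\<Sum>j<n g. \<sigma> g j * (v j)\<^sup>2)"
    and reach_reset: "(\<Sum>i<n (\<delta> g e). (\<Sum>j<n g. M g e i j * v j)\<^sup>2 / \<sigma> (\<delta> g e) i)
      \<le> (\<Sum>j<n g. (v j)\<^sup>2 / \<sigma> g j)"
    and q_Suc: "q (Suc s) = \<delta> (q s) (\<gamma> s)"
    and T_0: "T 0 = 0" and T_mono: "T s \<le> T (Suc s)" and T_lim: "filterlim T at_top sequentially"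
    and u_meas: "l < m \<Longrightarrow> u l \<in> borel_measurable (lebesgue_on {0..})"
    and u_sq: "l < m \<Longrightarrow> integrable (lebesgue_on {0..}) (\<lambda>t. (u l t)\<^sup>2)"
begin

text \<open>Dropped coordinates vanish at every real time, not only on the segment, so they are
  differentiable with derivative 0. For the same reason the sums over all \<open>n\<close>
  coordinates only see the kept ones.\<close>

definition trajectory :: "('q \<Rightarrow> nat) \<Rightarrow> (nat \<Rightarrow> nat \<Rightarrow> real \<Rightarrow> real) \<Rightarrow> bool" where
  "trajectory k x \<longleftrightarrow>
    (\<forall>i. x 0 i 0 = 0) \<and>
    (\<forall>s i. abs_cont_on (T s) (T (Suc s)) (x s i)) \<and>
    (\<forall>s i t. k (q s) \<le> i \<longrightarrow> x s i t = 0) \<and>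
    (\<forall>s. AE t in lebesgue. t \<in> {T s<..<T (Suc s)} \<longrightarrow> (\<forall>i<k (q s). (x s i has_real_derivative
       (\<Sum>j<n (q s). A (q s) i j * x s j t) + (\<Sum>l<m. B (q s) i l * u l t)) (at t))) \<and>
    (\<forall>s. \<forall>i<k (q (Suc s)). x (Suc s) i (T (Suc s)) = (\<Sum>j<n (q s). M (q s) (\<gamma> s) i j * x s j (T (Suc s))))"

definition out :: "(nat \<Rightarrow> nat \<Rightarrow> real \<Rightarrow> real) \<Rightarrow> nat \<Rightarrow> nat \<Rightarrow> real \<Rightarrow> real" where
  "out x s l t = (\<Sum>j<n (q s). C (q s) l j * x s j t)"

lemma T_mono': "s \<le> s' \<Longrightarrow> T s \<le> T s'"
  by (rule lift_Suc_mono_le[of T]) (auto simp: T_mono)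

lemma T_nonneg: "0 \<le> T s"
  using T_mono'[of 0 s] T_0 by simp

lemma out_cont:
  assumes "trajectory k x"
  shows "continuous_on {T s..T (Suc s)} (out x s l)"
  unfolding out_def using assms
  by (intro continuous_intros abs_cont_on_imp_continuous_on) (auto simp: trajectory_def)

lemma u_sq_integrable_on:
  assumes "l < m" "0 \<le> a"
  shows "(\<lambda>t. (u l t)\<^sup>2) integrable_on {a..b}"
proof -
  have "(\<lambda>t. (u l t)\<^sup>2) absolutely_integrable_on {0..}"
    using u_sq[OF assms(1)] by (simp add: integrable_restrict_space set_integrable_def)
  then have "(\<lambda>t. (u l t)\<^sup>2) absolutely_integrable_on {a..b}"
    by (rule set_integrable_subset) (use assms in auto)
  then show ?thesis by (rule set_lebesgue_integral_eq_integral)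
qed

text \<open>On a bounded interval \<open>\<bar>u\<bar> \<le> u^2 + 1\<close> makes a square
  integrable input integrable.\<close>

lemma u_integrable_on:
  assumes "l < m" "0 \<le> a"
  shows "u l absolutely_integrable_on {a..b}"
proof (rule measurable_bounded_by_integrable_imp_absolutely_integrable)
  show "u l \<in> borel_measurable (lebesgue_on {a..b})"
    by (rule measurable_restrict_mono[OF u_meas[OF assms(1)]]) (use assms in auto)
  show "(\<lambda>t. (u l t)\<^sup>2 + 1) integrable_on {a..b}"
    by (intro integrable_add u_sq_integrable_on assms) auto
  show "norm (u l t) \<le> (u l t)\<^sup>2 + 1" for t
  proof -
    have "0 \<le> (\<bar>u l t\<bar> - 1)\<^sup>2" by simp
    then show ?thesis by (simp add: power2_eq_square algebra_simps)
  qed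
qed auto

text \<open>The storage \<open>V s\<close> uses the weights of mode \<open>q s\<close>. At the event
  time \<open>T (Suc s)\<close>, \<open>V s\<close> is thus the value before the reset and
  \<open>V (Suc s)\<close> the value after it. Segments of length zero are included.\<close>

lemma segment_energy:
  assumes x: "trajectory k x" and X: "trajectory k' X" and "0 < r"
    and k: "\<And>g. k' g \<le> k g" "\<And>g. k g \<le> n g" and eq: "\<And>g i. k' g \<le> i \<Longrightarrow> i < k g \<Longrightarrow> \<sigma> g i = r"
  defines "V \<equiv> \<lambda>s t. \<Sum>i<n (q s). \<sigma> (q s) i * (x s i t - X s i t)\<^sup>2 + r\<^sup>2 * ((x s i t + X s i t)\<^sup>2 / \<sigma> (q s) i)"
  shows "integral {T s..T (Suc s)} (\<lambda>t. \<Sum>l<p. (out x s l t - out X s l t)\<^sup>2) + V s (T (Suc s))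
     \<le> V s (T s) + 4 * r\<^sup>2 * integral {T s..T (Suc s)} (\<lambda>t. \<Sum>l<m. (u l t)\<^sup>2)" (is ?seg)
   and "V (Suc s) (T (Suc s)) \<le> V s (T (Suc s))" (is ?reset)
proof -
  define a b where "a = T s" and "b = T (Suc s)"
  have ab: "0 \<le> a" "a \<le> b" using T_nonneg T_mono by (auto simp: a_def b_def)
  define g where "g = q s"
  \<comment> \<open>The value 0 beyond the kept coordinates is the derivative of the
    padding.\<close>
  define dx where "dx i t = (if i < k g then (\<Sum>j<n g. A g i j * x s j t) + (\<Sum>l<m. B g i l * u l t) else 0)" for i t
  define dX where "dX i t = (if i < k' g then (\<Sum>j<n g. A g i j * X s j t) + (\<Sum>l<m. B g i l * u l t) else 0)" for i t
  define dV where "dV t = (\<Sum>i<n g. 2 * \<sigma> g i * (x s i t - X s i t) * (dx i t - dX i t)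
     + r\<^sup>2 * (2 * (x s i t + X s i t) * (dx i t + dX i t) / \<sigma> g i))" for t
  have nz: "\<sigma> g i \<noteq> 0" if "i < n g" for i using sigma_pos[OF that] by simp
  have x0: "x s i t = 0" if "k g \<le> i" for i t using x that by (simp add: trajectory_def g_def)
  have X0: "X s i t = 0" if "k' g \<le> i" for i t using X that by (simp add: trajectory_def g_def)
  have acx: "abs_cont_on a b (x s i)" "abs_cont_on a b (X s i)" for i
    using x X by (auto simp: trajectory_def a_def b_def)
  have acV: "abs_cont_on a b (V s)"
  proof -
    have 1: "abs_cont_on a b (\<lambda>t. x s i t - X s i t)" for i
      using abs_cont_on_add[OF acx(1)[of i] abs_cont_on_cmult[OF acx(2)[of i], of "-1"]] by simp
    have 2: "abs_cont_on a b (\<lambda>t. (x s i t + X s i t))" for i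
      using acx by (intro abs_cont_on_add)
    have "abs_cont_on a b (\<lambda>t. \<Sum>i<n g. \<sigma> g i * ((x s i t - X s i t) * (x s i t - X s i t))
        + r\<^sup>2 / \<sigma> g i * ((x s i t + X s i t) * (x s i t + X s i t)))"
      by (intro abs_cont_on_sum abs_cont_on_add[OF abs_cont_on_cmult abs_cont_on_cmult]
          abs_cont_on_mult[OF 1 1] abs_cont_on_mult[OF 2 2]) auto
    then show ?thesis by (simp add: V_def g_def power2_eq_square)
  qed
  have derV: "AE t in lebesgue. t \<in> {a<..<b} \<longrightarrow> (V s has_real_derivative dV t) (at t)"
  proof -
    have "AE t in lebesgue. t \<in> {a<..<b} \<longrightarrow> (\<forall>i<k g. (x s i has_real_derivative dx i t) (at t))"
      using x by (simp add: trajectory_def a_def b_def dx_def g_def)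
    moreover have "AE t in lebesgue. t \<in> {a<..<b} \<longrightarrow> (\<forall>i<k' g. (X s i has_real_derivative dX i t) (at t))"
      using X by (simp add: trajectory_def a_def b_def dX_def g_def)
    ultimately show ?thesis
    proof eventually_elim
      case (elim t)
      show ?case
      proof
        assume t: "t \<in> {a<..<b}"
        have "(x s i has_real_derivative dx i t) (at t)" for i
        proof (cases "i < k g")
          case False
          then have "x s i = (\<lambda>_. 0)" "dx i t = 0" using x0[of i] by (auto simp: dx_def)
          then show ?thesis by simp
        qed (use elim t in blast)
        moreover have "(X s i has_real_derivative dX i t) (at t)" for i
        proof (cases "i < k' g")
          case False
          then have "X s i = (\<lambda>_. 0)" "dX i t = 0" using X0[of i] by (auto simp: dX_def)
          then show ?thesis by simp
        qed (use elim t in blast)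
        ultimately show "(V s has_real_derivative dV t) (at t)"
          unfolding V_def dV_def g_def[symmetric]
          by (auto intro!: derivative_eq_intros sum.cong simp: mult_ac nz)
      qed
    qed
  qed
  have I: "(dV has_integral V s b - V s a) {a..b}"
    by (rule abs_cont_on_has_integral[OF acV ab(2) derV])
  define Y U where "Y t = (\<Sum>l<p. (out x s l t - out X s l t)\<^sup>2)" and "U t = (\<Sum>l<m. (u l t)\<^sup>2)" for t
  have Yi: "Y integrable_on {a..b}"
    unfolding Y_def a_def b_def using out_cont[OF x] out_cont[OF X]
    by (intro integrable_continuous_real continuous_intros)
  have Ui: "U integrable_on {a..b}"
    unfolding U_def using u_sq_integrable_on[OF _ ab(1)] by (intro integrable_sum) auto
  have le: "dV t \<le> 4 * r\<^sup>2 * U t - Y t" for t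
    unfolding dV_def U_def Y_def out_def g_def[symmetric]
  proof (rule dissipation_inequality[where k="k g" and k'="k' g" and A="A g" and B="B g"])
  qed (use \<open>0 < r\<close> sigma_pos obs reach k eq x0 X0 in \<open>simp_all add: dx_def dX_def\<close>)
  have "V s b - V s a \<le> integral {a..b} (\<lambda>t. 4 * r\<^sup>2 * U t - Y t)"
    using I by (rule has_integral_le[OF _ integrable_integral])
      (auto intro!: integrable_diff Yi integrable_on_mult_right Ui le)
  also have "\<dots> = 4 * r\<^sup>2 * integral {a..b} U - integral {a..b} Y"
    using Ui Yi by (subst integral_diff) (auto intro!: integrable_on_mult_right)
  finally show ?seg by (simp add: a_def b_def Y_def[abs_def] U_def[abs_def])
  show ?reset
    unfolding V_def
    by (rule storage_reset[where k="k (q (Suc s))" and k'="k' (q (Suc s))" and M="M (q s) (\<gamma> s)"])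
      (use \<open>0 < r\<close> sigma_pos obs_reset reach_reset k eq x X in \<open>simp_all add: q_Suc trajectory_def\<close>)
qed

end

section \<open>Truncation error in balanced coordinates\<close>

text \<open>Measurability and integrability belong to the bound because the integral of a
  non-integrable function is 0 by convention. Requiring \<open>0 \<le> b\<close> makes the
  comparison of squares a comparison of norms.\<close>

definition l2_bound :: "nat \<Rightarrow> (nat \<Rightarrow> real \<Rightarrow> real) \<Rightarrow> real \<Rightarrow> bool" where
  "l2_bound p f b \<longleftrightarrow> 0 \<le> b \<and>
    (\<forall>l<p. f l \<in> borel_measurable (lebesgue_on {0..}) \<and> integrable (lebesgue_on {0..}) (\<lambda>t. (f l t)\<^sup>2)) \<and>
    (LINT t|lebesgue_on {0..}. (\<Sum>l<p. (f l t)\<^sup>2)) \<le> b\<^sup>2"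

lemma l2_boundD:
  "l2_bound p f b \<Longrightarrow> (LINT t|lebesgue_on {0..}. (\<Sum>l<p. (f l t)\<^sup>2)) \<le> b\<^sup>2"
  by (simp only: l2_bound_def)

text \<open>Arbitrarily small slack can be removed. This allows division by bounds that might be
  zero, and gives error 0 when nothing is truncated.\<close>

lemma l2_bound_limit:
  assumes "\<And>e. 0 < e \<Longrightarrow> l2_bound p f (b + c * e)" "0 \<le> b"
  shows "l2_bound p f b"
proof -
  have "((\<lambda>e. (b + c * e)\<^sup>2) \<longlongrightarrow> b\<^sup>2) (at_right 0)"
    by (auto intro!: tendsto_eq_intros)
  moreover have "\<forall>\<^sub>F e in at_right 0. (LINT t|lebesgue_on {0..}. (\<Sum>l<p. (f l t)\<^sup>2)) \<le> (b + c * e)\<^sup>2"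
    using eventually_at_right_less[of "0::real"] by eventually_elim (rule l2_boundD[OF assms(1)])
  ultimately have "(LINT t|lebesgue_on {0..}. (\<Sum>l<p. (f l t)\<^sup>2)) \<le> b\<^sup>2"
    by (rule tendsto_lowerbound) simp
  moreover have "l2_bound p f (b + c * 1)" by (rule assms(1)) simp
  ultimately show ?thesis using \<open>0 \<le> b\<close> unfolding l2_bound_def by blast
qed

text \<open>Minkowski's inequality from a weighted Young inequality. The weights
  \<open>1 + b' / a'\<close> and \<open>1 + a' / b'\<close> are those for which the bounds
  \<open>a'\<^sup>2\<close> and \<open>b'\<^sup>2\<close> combine to the square of
  \<open>a' + b'\<close>.\<close>

lemma l2_bound_add:
  assumes f: "l2_bound p f a" and g: "l2_bound p g b"
  shows "l2_bound p (\<lambda>l t. f l t + g l t) (a + b)"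
proof (rule l2_bound_limit[where c=2])
  let ?\<Omega> = "lebesgue_on {0..} :: real measure"
  show "0 \<le> a + b" using f g by (simp add: l2_bound_def)
  fix e :: real assume "0 < e"
  \<comment> \<open>The slack \<open>e\<close> keeps both denominators positive; the two slacks
    together account for \<open>c = 2\<close>.\<close>
  define a' b' where "a' = a + e" and "b' = b + e"
  have pos: "0 < a'" "0 < b'" and sq: "a\<^sup>2 \<le> a'\<^sup>2" "b\<^sup>2 \<le> b'\<^sup>2"
    using \<open>0 < e\<close> f g by (auto simp: a'_def b'_def l2_bound_def intro: power_mono)
  have young: "(r + s)\<^sup>2 \<le> (1 + b' / a') * r\<^sup>2 + (1 + a' / b') * s\<^sup>2" for r s :: real
  proof -
    have "0 \<le> (b' * r - a' * s)\<^sup>2 / (a' * b')" using pos by simp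
    also have "\<dots> = (1 + b' / a') * r\<^sup>2 + (1 + a' / b') * s\<^sup>2 - (r + s)\<^sup>2"
      using pos by (simp add: field_simps power2_eq_square)
    finally show ?thesis by simp
  qed
  have fi: "integrable ?\<Omega> (\<lambda>t. (f l t)\<^sup>2)" "f l \<in> borel_measurable ?\<Omega>" and
    gi: "integrable ?\<Omega> (\<lambda>t. (g l t)\<^sup>2)" "g l \<in> borel_measurable ?\<Omega>" if "l < p" for l
    using f g that by (auto simp: l2_bound_def)
  have int: "integrable ?\<Omega> (\<lambda>t. (f l t + g l t)\<^sup>2)" if "l < p" for l
  proof (rule Bochner_Integration.integrable_bound)
    show "integrable ?\<Omega> (\<lambda>t. (1 + b' / a') * (f l t)\<^sup>2 + (1 + a' / b') * (g l t)\<^sup>2)"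
      using fi(1)[OF that] gi(1)[OF that] by auto
    show "(\<lambda>t. (f l t + g l t)\<^sup>2) \<in> borel_measurable ?\<Omega>"
      using fi(2)[OF that] gi(2)[OF that] by measurable
    show "AE t in ?\<Omega>. norm ((f l t + g l t)\<^sup>2) \<le> norm ((1 + b' / a') * (f l t)\<^sup>2 + (1 + a' / b') * (g l t)\<^sup>2)"
      using young pos by (intro AE_I2) (simp add: abs_of_nonneg)
  qed
  have "(LINT t|?\<Omega>. (\<Sum>l<p. (f l t + g l t)\<^sup>2))
      \<le> (LINT t|?\<Omega>. (1 + b' / a') * (\<Sum>l<p. (f l t)\<^sup>2) + (1 + a' / b') * (\<Sum>l<p. (g l t)\<^sup>2))"
  proof (rule integral_mono)
    show "integrable ?\<Omega> (\<lambda>t. \<Sum>l<p. (f l t + g l t)\<^sup>2)"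
      using int by (intro Bochner_Integration.integrable_sum) auto
    show "integrable ?\<Omega> (\<lambda>t. (1 + b' / a') * (\<Sum>l<p. (f l t)\<^sup>2) + (1 + a' / b') * (\<Sum>l<p. (g l t)\<^sup>2))"
      using fi gi by (intro Bochner_Integration.integrable_add Bochner_Integration.integrable_mult_right
          Bochner_Integration.integrable_sum) auto
    show "(\<Sum>l<p. (f l t + g l t)\<^sup>2) \<le> (1 + b' / a') * (\<Sum>l<p. (f l t)\<^sup>2) + (1 + a' / b') * (\<Sum>l<p. (g l t)\<^sup>2)" for t
      unfolding sum_distrib_left sum.distrib[symmetric] by (intro sum_mono young)
  qed
  also have "\<dots> = (1 + b' / a') * (LINT t|?\<Omega>. (\<Sum>l<p. (f l t)\<^sup>2)) + (1 + a' / b') * (LINT t|?\<Omega>. (\<Sum>l<p. (g l t)\<^sup>2))"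
    using fi gi by (subst Bochner_Integration.integral_add) (auto intro!: Bochner_Integration.integrable_sum)
  also have "\<dots> \<le> (1 + b' / a') * a'\<^sup>2 + (1 + a' / b') * b'\<^sup>2"
    using pos by (intro add_mono mult_left_mono order_trans[OF l2_boundD[OF f] sq(1)]
        order_trans[OF l2_boundD[OF g] sq(2)]) auto
  also have "\<dots> = (a + b + 2 * e)\<^sup>2"
    using pos by (simp add: field_simps power2_eq_square a'_def[symmetric] b'_def[symmetric])
      (simp add: a'_def b'_def algebra_simps)
  finally show "l2_bound p (\<lambda>l t. f l t + g l t) (a + b + 2 * e)"
    unfolding l2_bound_def
  proof (intro conjI allI impI)
    show "0 \<le> a + b + 2 * e" using f g \<open>0 < e\<close> by (simp add: l2_bound_def)
  qed (use int fi gi in \<open>auto intro!: borel_measurable_add\<close>)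
qed

lemma sum_lessThan_pad:
  fixes k n :: nat and f z :: "nat \<Rightarrow> real"
  assumes "k \<le> n"
  shows "(\<Sum>j<n. f j * (if j < k then z j else 0)) = (\<Sum>j<k. f j * z j)"
proof -
  have "(\<Sum>j<k. f j * z j) = (\<Sum>j<k. f j * (if j < k then z j else 0))" by simp
  also have "\<dots> = (\<Sum>j<n. f j * (if j < k then z j else 0))"
    using assms by (intro sum.mono_neutral_left) auto
  finally show ?thesis by simp
qed

section \<open>Existence of trajectories and energy balance on the half-line\<close>

context balanced_run
begin

text \<open>Supplies the intermediate truncations of the induction as well as solutions of the two
  given systems.\<close>

lemma trajectory_exists:
  assumes k: "\<And>g. k g \<le> n g"
  shows "\<exists>x. trajectory k x"
proof -
  \<comment> \<open>A solution is chosen for every possible initial value of a segment, because the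
    actual value is known only once the preceding segment has been solved.\<close>
  have "\<forall>s \<xi>. \<exists>z. (\<forall>i<k (q s). z i (T s) = \<xi> i \<and> abs_cont_on (T s) (T (Suc s)) (z i)) \<and>
    (AE t in lebesgue. t \<in> {T s<..<T (Suc s)} \<longrightarrow> (\<forall>i<k (q s). (z i has_real_derivative
       (\<Sum>j<k (q s). A (q s) i j * z j t) + (\<Sum>l<m. B (q s) i l * u l t)) (at t)))"
    by (intro allI linear_ode_solvable T_mono u_integrable_on u_sq_integrable_on T_nonneg)
  then obtain Z where Z: "\<And>s \<xi> i. i < k (q s) \<Longrightarrow> Z s \<xi> i (T s) = \<xi> i"
      "\<And>s \<xi> i. i < k (q s) \<Longrightarrow> abs_cont_on (T s) (T (Suc s)) (Z s \<xi> i)"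
    and Z': "\<And>s \<xi>. AE t in lebesgue. t \<in> {T s<..<T (Suc s)} \<longrightarrow> (\<forall>i<k (q s). (Z s \<xi> i has_real_derivative
       (\<Sum>j<k (q s). A (q s) i j * Z s \<xi> j t) + (\<Sum>l<m. B (q s) i l * u l t)) (at t))"
    unfolding choice_iff by auto
  define \<xi> where "\<xi> = rec_nat (\<lambda>_. 0) (\<lambda>s \<xi>s i. \<Sum>j<k (q s). M (q s) (\<gamma> s) i j * Z s \<xi>s j (T (Suc s)))"
  have \<xi>0: "\<xi> 0 i = 0" and \<xi>S: "\<xi> (Suc s) i = (\<Sum>j<k (q s). M (q s) (\<gamma> s) i j * Z s (\<xi> s) j (T (Suc s)))" for s i
    by (simp_all add: \<xi>_def)
  define x where "x s i t = (if i < k (q s) then Z s (\<xi> s) i t else 0)" for s i t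
  have xZ: "x s i = Z s (\<xi> s) i" if "i < k (q s)" for s i using that by (simp add: x_def[abs_def])
  have x0: "x s i = (\<lambda>_. 0)" if "\<not> i < k (q s)" for s i using that by (simp add: x_def[abs_def])
  have sum_eq: "(\<Sum>j<n (q s). f j * x s j t) = (\<Sum>j<k (q s). f j * Z s (\<xi> s) j t)" for s f t
    unfolding x_def by (rule sum_lessThan_pad[OF k])
  have "trajectory k x"
    unfolding trajectory_def sum_eq
  proof (intro conjI allI impI)
    show "x 0 i 0 = 0" for i
      using Z(1)[of i 0 "\<xi> 0"] by (cases "i < k (q 0)") (simp_all add: xZ x0 T_0 \<xi>0)
    show "abs_cont_on (T s) (T (Suc s)) (x s i)" for s i
      by (cases "i < k (q s)") (simp_all add: xZ x0 Z abs_cont_on_const)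
    show "x s i t = 0" if "k (q s) \<le> i" for s i t using x0 that by simp
    show "AE t in lebesgue. t \<in> {T s<..<T (Suc s)} \<longrightarrow> (\<forall>i<k (q s). (x s i has_real_derivative
       (\<Sum>j<k (q s). A (q s) i j * Z s (\<xi> s) j t) + (\<Sum>l<m. B (q s) i l * u l t)) (at t))" for s
      using Z'[of s "\<xi> s"] by eventually_elim (simp add: xZ)
    show "x (Suc s) i (T (Suc s)) = (\<Sum>j<k (q s). M (q s) (\<gamma> s) i j * Z s (\<xi> s) j (T (Suc s)))"
      if "i < k (q (Suc s))" for s i
      using Z(1)[OF that] by (simp add: xZ[OF that] \<xi>S)
  qed
  then show ?thesis by (intro exI)
qed

definition u_energy :: real where
  "u_energy = (LINT t|lebesgue_on {0..}. (\<Sum>l<m. (u l t)\<^sup>2))"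

lemma u_energy_bound:
  assumes "0 \<le> b"
  shows "integral {0..b} (\<lambda>t. \<Sum>l<m. (u l t)\<^sup>2) \<le> u_energy"
proof -
  have i: "integrable (lebesgue_on {0..}) (\<lambda>t. \<Sum>l<m. (u l t)\<^sup>2)"
    using u_sq by (intro Bochner_Integration.integrable_sum) auto
  then have "(\<lambda>t. \<Sum>l<m. (u l t)\<^sup>2) absolutely_integrable_on {0..}"
    by (simp add: integrable_restrict_space set_integrable_def)
  then have *: "(\<lambda>t. \<Sum>l<m. (u l t)\<^sup>2) integrable_on {0..}"
    by (rule set_lebesgue_integral_eq_integral)
  have "u_energy = integral {0..} (\<lambda>t. \<Sum>l<m. (u l t)\<^sup>2)"
    unfolding u_energy_def by (rule lebesgue_integral_eq_integral[OF i]) simp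
  moreover have "(\<lambda>t. \<Sum>l<m. (u l t)\<^sup>2) integrable_on {0..b}"
    using u_sq_integrable_on by (intro integrable_sum) auto
  ultimately show ?thesis
    using * by (auto intro!: integral_subset_le sum_nonneg)
qed

lemma u_energy_nonneg: "0 \<le> u_energy"
  unfolding u_energy_def by (intro Bochner_Integration.integral_nonneg sum_nonneg) auto

text \<open>The segment inequalities telescope. The storage starts at 0 because both states do, and
  its final value is nonnegative and can be discarded.\<close>

lemma total_energy:
  assumes x: "trajectory k x" and X: "trajectory k' X" and "0 < r"
    and k: "\<And>g. k' g \<le> k g" "\<And>g. k g \<le> n g" and eq: "\<And>g i. k' g \<le> i \<Longrightarrow> i < k g \<Longrightarrow> \<sigma> g i = r"
  shows "(\<Sum>s<N. integral {T s..T (Suc s)} (\<lambda>t. \<Sum>l<p. (out x s l t - out X s l t)\<^sup>2)) \<le> (2 * r * sqrt u_energy)\<^sup>2"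
proof -
  define V where "V s t = (\<Sum>i<n (q s). \<sigma> (q s) i * (x s i t - X s i t)\<^sup>2
    + r\<^sup>2 * ((x s i t + X s i t)\<^sup>2 / \<sigma> (q s) i))" for s t
  define Y where "Y s = integral {T s..T (Suc s)} (\<lambda>t. \<Sum>l<p. (out x s l t - out X s l t)\<^sup>2)" for s
  define U where "U t = (\<Sum>l<m. (u l t)\<^sup>2)" for t
  have V_nonneg: "0 \<le> V s t" for s t
    unfolding V_def using sigma_pos by (intro sum_nonneg) (simp add: less_imp_le)
  have seg: "Y s + V s (T (Suc s)) \<le> V s (T s) + 4 * r\<^sup>2 * integral {T s..T (Suc s)} U"
    and res: "V (Suc s) (T (Suc s)) \<le> V s (T (Suc s))" for s
    using segment_energy[OF x X \<open>0 < r\<close> k eq, of s] by (auto simp: V_def Y_def U_def[abs_def])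
  have Ui: "U integrable_on {0..b}" for b
    unfolding U_def using u_sq_integrable_on by (intro integrable_sum) auto
  \<comment> \<open>\<open>V N (T N)\<close> is the storage after the reset at \<open>T N\<close>;
    it has to stay in the induction hypothesis to start the next segment.\<close>
  have "(\<Sum>s<N. Y s) + V N (T N) \<le> 4 * r\<^sup>2 * integral {0..T N} U"
  proof (induction N)
    case 0
    have "V 0 0 = 0" using x X by (simp add: V_def trajectory_def)
    then show ?case by (simp add: T_0)
  next
    case (Suc N)
    have "integral {0..T (Suc N)} U = integral {0..T N} U + integral {T N..T (Suc N)} U"
      using Henstock_Kurzweil_Integration.integral_combine[OF T_nonneg T_mono Ui] by simp
    then show ?case using Suc seg[of N] res[of N] by (simp add: distrib_left)
  qed
  also have "\<dots> \<le> 4 * r\<^sup>2 * u_energy"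
    using u_energy_bound[OF T_nonneg] by (simp add: U_def[abs_def] mult_left_mono)
  also have "\<dots> = (2 * r * sqrt u_energy)\<^sup>2"
    using u_energy_nonneg by (simp add: power_mult_distrib)
  finally show ?thesis using V_nonneg[of N "T N"] by (simp add: Y_def)
qed

text \<open>Half-open intervals make the index unique at event times and pass over segments of
  length zero. The formula is that of \<open>active_index\<close>.\<close>

definition idx :: "real \<Rightarrow> nat" where
  "idx t = (THE s. T s \<le> t \<and> t < T (Suc s))"

lemma idx_unique:
  assumes "T s \<le> t" "t < T (Suc s)"
  shows "idx t = s"
  unfolding idx_def
proof (rule the_equality)
  fix s' assume s': "T s' \<le> t \<and> t < T (Suc s')"
  show "s' = s"
  proof (rule ccontr)
    assume "s' \<noteq> s"
    then have "Suc s \<le> s' \<or> Suc s' \<le> s" by auto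
    then show False using T_mono'[of "Suc s" s'] T_mono'[of "Suc s'" s] s' assms by auto
  qed
qed (use assms in auto)

text \<open>Event times tend to infinity, so some of them exceed \<open>t\<close>; the first of
  these is not \<open>T 0 = 0\<close>, and its predecessor is the index.\<close>

lemma idx_exists:
  assumes "0 \<le> t"
  shows "\<exists>s. T s \<le> t \<and> t < T (Suc s)"
proof -
  have "\<exists>N. \<forall>n\<ge>N. t < T n"
    using T_lim unfolding filterlim_at_top_dense eventually_sequentially by blast
  then have "\<exists>N. t < T N" by blast
  then have "t < T (LEAST N. t < T N)" by (rule LeastI_ex)
  moreover have "(LEAST N. t < T N) \<noteq> 0"
  proof
    assume "(LEAST N. t < T N) = 0"
    with calculation have "t < T 0" by simp
    then show False using assms T_0 by simp
  qed
  then obtain s where s: "(LEAST N. t < T N) = Suc s" by (cases "LEAST N. t < T N") auto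
  moreover have "\<not> t < T s" using not_less_Least[of s "\<lambda>N. t < T N"] s by auto
  ultimately show ?thesis by (intro exI[of _ s]) (simp add: not_less)
qed

text \<open>Monotone convergence along the intervals \<open>{0..T N}\<close>: they exhaust the
  half-line, and the bound \<open>E\<close> on the partial sums makes the limit integrable.\<close>

lemma glue_integrable:
  fixes f :: "real \<Rightarrow> real" and h :: "nat \<Rightarrow> real \<Rightarrow> real"
  assumes h: "\<And>s. continuous_on {T s..T (Suc s)} (h s)"
    and fh: "\<And>s t. T s \<le> t \<Longrightarrow> t < T (Suc s) \<Longrightarrow> f t = h s t"
    and nonneg: "\<And>t. 0 \<le> t \<Longrightarrow> 0 \<le> f t"
    and E: "\<And>N. (\<Sum>s<N. integral {T s..T (Suc s)} (h s)) \<le> E"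
  shows "integrable (lebesgue_on {0..}) f" "(LINT t|lebesgue_on {0..}. f t) \<le> E"
proof -
  have f_int: "(f has_integral (\<Sum>s<N. integral {T s..T (Suc s)} (h s))) {0..T N}" for N
  proof (induction N)
    case (Suc N)
    have "(h N has_integral integral {T N..T (Suc N)} (h N)) {T N..T (Suc N)}"
      by (rule integrable_integral[OF integrable_continuous_real[OF h]])
    \<comment> \<open>At the right endpoint the next segment takes over, so \<open>f\<close> may
      differ from \<open>h N\<close> at this one point.\<close>
    then have "(f has_integral integral {T N..T (Suc N)} (h N)) {T N..T (Suc N)}"
      by (rule has_integral_spike[of "{T (Suc N)}", rotated 2]) (auto simp: fh)
    from has_integral_combine[OF T_nonneg T_mono Suc this] show ?case by simp
  qed (simp add: T_0 has_integral_refl)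
  define F where "F N t = (if t \<in> {0..T N} then f t else 0)" for N t
  have F_int: "(F N has_integral (\<Sum>s<N. integral {T s..T (Suc s)} (h s))) {0..}" for N
    using has_integral_restrict[of "{0..T N}" "{0..}" f] f_int[of N] by (auto simp: F_def[abs_def])
  have "f integrable_on {0..} \<and> (\<lambda>N. integral {0..} (F N)) \<longlonglongrightarrow> integral {0..} f"
  proof (rule monotone_convergence_increasing)
    show "F N integrable_on {0..}" for N using F_int by (rule has_integral_integrable)
    show "F N t \<le> F (Suc N) t" if "t \<in> {0..}" for N t
      using nonneg that T_mono[of N] by (auto simp: F_def)
    show "(\<lambda>N. F N t) \<longlonglongrightarrow> f t" if "t \<in> {0..}" for t
    proof (rule tendsto_eventually)
      have "\<forall>\<^sub>F N in sequentially. t \<le> T N" using T_lim by (simp add: filterlim_at_top)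
      then show "\<forall>\<^sub>F N in sequentially. F N t = f t"
        by eventually_elim (use that in \<open>auto simp: F_def\<close>)
    qed
    have "0 \<le> (\<Sum>s<N. integral {T s..T (Suc s)} (h s))" for N
      using f_int[of N] nonneg by (auto intro: has_integral_nonneg)
    then show "bounded (range (\<lambda>N. integral {0..} (F N)))"
      using E by (auto simp: integral_unique[OF F_int] bounded_iff intro!: exI[of _ E])
  qed
  then have i: "f integrable_on {0..}" and lim: "(\<lambda>N. integral {0..} (F N)) \<longlonglongrightarrow> integral {0..} f" by auto
  have "f absolutely_integrable_on {0..}"
    using i nonneg by (intro nonnegative_absolutely_integrable_1) auto
  then show int: "integrable (lebesgue_on {0..}) f"
    by (simp add: integrable_restrict_space set_integrable_def)
  have "integral {0..} f \<le> E"
    using E by (intro LIMSEQ_le_const2[OF lim]) (auto simp: integral_unique[OF F_int])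
  then show "(LINT t|lebesgue_on {0..}. f t) \<le> E"
    using lebesgue_integral_eq_integral[OF int] by simp
qed

lemma glue_measurable:
  fixes f :: "real \<Rightarrow> real" and h :: "nat \<Rightarrow> real \<Rightarrow> real"
  assumes h: "\<And>s. continuous_on {T s..T (Suc s)} (h s)"
    and fh: "\<And>s t. T s \<le> t \<Longrightarrow> t < T (Suc s) \<Longrightarrow> f t = h s t"
  shows "f \<in> borel_measurable (lebesgue_on {0..})"
proof (rule measurable_piecewise_restrict[of "range (\<lambda>s. {T s..<T (Suc s)})"])
  fix D assume "D \<in> range (\<lambda>s. {T s..<T (Suc s)})"
  then obtain s where D: "D = {T s..<T (Suc s)}" by auto
  have sub: "D \<subseteq> {0..}" using T_nonneg[of s] by (auto simp: D)
  show "D \<inter> space (lebesgue_on {0..}) \<in> sets (lebesgue_on {0..})"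
    using sub by (auto simp: D sets_restrict_space)
  have "h s \<in> borel_measurable (lebesgue_on D)"
    using h[of s] by (intro continuous_imp_measurable_on_sets_lebesgue)
      (auto simp: D intro: continuous_on_subset)
  then have "f \<in> borel_measurable (lebesgue_on D)"
    by (rule measurable_cong[THEN iffD1, rotated]) (auto simp: D fh)
  moreover have "restrict_space (lebesgue_on {0..}) D = lebesgue_on D"
    using sub by (simp add: restrict_restrict_space D Int_absorb1)
  ultimately show "f \<in> borel_measurable (restrict_space (lebesgue_on {0..}) D)" by simp
qed (use idx_exists in auto)

definition signal :: "(nat \<Rightarrow> nat \<Rightarrow> real \<Rightarrow> real) \<Rightarrow> nat \<Rightarrow> real \<Rightarrow> real" where
  "signal x l t = out x (idx t) l t"

lemma one_step_error:
  assumes x: "trajectory k x" and X: "trajectory k' X" and "0 < r"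
    and k: "\<And>g. k' g \<le> k g" "\<And>g. k g \<le> n g" and eq: "\<And>g i. k' g \<le> i \<Longrightarrow> i < k g \<Longrightarrow> \<sigma> g i = r"
  shows "l2_bound p (\<lambda>l t. signal x l t - signal X l t) (2 * r * sqrt u_energy)"
proof -
  let ?\<Omega> = "lebesgue_on {0..} :: real measure"
  let ?f = "\<lambda>l t. signal x l t - signal X l t"
  have c: "continuous_on {T s..T (Suc s)} (\<lambda>t. out x s l t - out X s l t)" for s l
    using out_cont[OF x] out_cont[OF X] by (intro continuous_intros)
  have meas: "?f l \<in> borel_measurable ?\<Omega>" for l
    by (rule glue_measurable[OF c]) (simp add: signal_def idx_unique)
  have "integrable ?\<Omega> (\<lambda>t. \<Sum>l<p. (?f l t)\<^sup>2) \<and> (LINT t|?\<Omega>. (\<Sum>l<p. (?f l t)\<^sup>2)) \<le> (2 * r * sqrt u_energy)\<^sup>2"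
  proof (intro conjI glue_integrable[where h="\<lambda>s t. \<Sum>l<p. (out x s l t - out X s l t)\<^sup>2"])
    show "(\<Sum>s<N. integral {T s..T (Suc s)} (\<lambda>t. \<Sum>l<p. (out x s l t - out X s l t)\<^sup>2)) \<le> (2 * r * sqrt u_energy)\<^sup>2" for N
      by (rule total_energy[OF x X \<open>0 < r\<close> k eq])
    then show "(\<Sum>s<N. integral {T s..T (Suc s)} (\<lambda>t. \<Sum>l<p. (out x s l t - out X s l t)\<^sup>2)) \<le> (2 * r * sqrt u_energy)\<^sup>2" for N .
  qed (use c out_cont[OF x] out_cont[OF X] in \<open>auto intro!: continuous_intros sum_nonneg simp: signal_def idx_unique\<close>)
  moreover have "integrable ?\<Omega> (\<lambda>t. (?f l t)\<^sup>2)" if "l < p" for l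
  proof (rule Bochner_Integration.integrable_bound)
    show "integrable ?\<Omega> (\<lambda>t. \<Sum>l<p. (?f l t)\<^sup>2)" using calculation by simp
    show "(\<lambda>t. (?f l t)\<^sup>2) \<in> borel_measurable ?\<Omega>" using meas[of l] by (intro borel_measurable_power)
    show "AE t in ?\<Omega>. norm ((?f l t)\<^sup>2) \<le> norm (\<Sum>l<p. (?f l t)\<^sup>2)"
    proof (rule AE_I2)
      fix t
      have "(?f l t)\<^sup>2 \<le> (\<Sum>l<p. (?f l t)\<^sup>2)"
        using that by (intro member_le_sum[of l "{..<p}" "\<lambda>l. (?f l t)\<^sup>2"]) auto
      then show "norm ((?f l t)\<^sup>2) \<le> norm (\<Sum>l<p. (?f l t)\<^sup>2)" by simp
    qed
  qed
  ultimately show ?thesis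
    using meas \<open>0 < r\<close> u_energy_nonneg by (simp add: l2_bound_def)
qed

text \<open>The number of coordinates still to be dropped decreases, with \<open>k\<close> and
  \<open>x\<close> generalised because each step replaces the larger system by one that has a
  coordinate less.\<close>

theorem truncation_error:
  assumes "trajectory k x" and X: "trajectory r X"
    and "\<And>g. r g \<le> k g" "\<And>g. k g \<le> n g"
  shows "l2_bound p (\<lambda>l t. signal x l t - signal X l t)
    (2 * (\<Sum>g\<in>UNIV. \<Sum>i\<in>{r g..<k g}. \<sigma> g i) * sqrt u_energy)"
  using assms(1,3,4)
proof (induction "\<Sum>g\<in>UNIV. k g - r g" arbitrary: k x)
  case 0
  then have "k = r" by (auto intro!: ext le_antisym)
  \<comment> \<open>For equal orders \<open>x\<close> and \<open>X\<close> may still be different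
    solutions. No coordinate is dropped, so the one-step estimate holds for every positive number in
    place of the singular value, and its limit 0 takes over the task of a uniqueness
    theorem.\<close>
  have "l2_bound p (\<lambda>l t. signal x l t - signal X l t) (0 + (2 * sqrt u_energy) * e)" if "0 < e" for e
    using one_step_error[OF 0(2)[unfolded \<open>k = r\<close>] X that] 0(4) \<open>k = r\<close> by (simp add: mult_ac)
  then have "l2_bound p (\<lambda>l t. signal x l t - signal X l t) 0"
    by (rule l2_bound_limit[where c="2 * sqrt u_energy"]) auto
  then show ?case by (simp add: \<open>k = r\<close>)
next
  case (Suc d)
  have "\<exists>g0. r g0 < k g0"
  proof (rule ccontr)
    assume "\<nexists>g0. r g0 < k g0"
    then have "k g - r g = 0" for g by (simp add: not_less)
    then show False using Suc(2) by simp
  qed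
  then obtain g0 where g0: "r g0 < k g0" ..
  \<comment> \<open>Dropping the last kept coordinate of \<open>g0\<close> preserves the
    leading-block form, and the condition of a common singular value concerns just this
    coordinate.\<close>
  define k' where "k' = k(g0 := k g0 - 1)"
  have k': "k' g \<le> k g" "k' g \<le> n g" "r g \<le> k' g" for g
    using Suc(4)[of g] Suc(5)[of g] g0 by (auto simp: k'_def)
  obtain x' where x': "trajectory k' x'" using trajectory_exists[OF k'(2)] by blast
  have "(\<Sum>g\<in>UNIV. k g - r g) = (\<Sum>g\<in>UNIV. (k' g - r g) + (if g = g0 then 1 else 0))"
    using g0 by (intro sum.cong) (auto simp: k'_def)
  then have "d = (\<Sum>g\<in>UNIV. k' g - r g)"
    using Suc(2) by (simp add: sum.distrib)
  then have 1: "l2_bound p (\<lambda>l t. signal x' l t - signal X l t)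
    (2 * (\<Sum>g\<in>UNIV. \<Sum>i\<in>{r g..<k' g}. \<sigma> g i) * sqrt u_energy)"
    by (rule Suc(1)[OF _ x' k'(3) k'(2)])
  have "0 < \<sigma> g0 (k g0 - 1)"
    using g0 Suc(5)[of g0] by (intro sigma_pos) auto
  then have 2: "l2_bound p (\<lambda>l t. signal x l t - signal x' l t) (2 * \<sigma> g0 (k g0 - 1) * sqrt u_energy)"
  proof (rule one_step_error[OF Suc(3) x' _ k'(1) Suc(5)])
    fix g i assume "k' g \<le> i" "i < k g"
    then have "g = g0" "i = k g0 - 1" by (auto simp: k'_def split: if_splits)
    then show "\<sigma> g i = \<sigma> g0 (k g0 - 1)" by simp
  qed
  have "(\<Sum>i\<in>{r g..<k g}. \<sigma> g i) = (\<Sum>i\<in>{r g..<k' g}. \<sigma> g i) + (if g = g0 then \<sigma> g0 (k g0 - 1) else 0)" for g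
  proof (cases "g = g0")
    case True
    obtain c where c: "k g0 = Suc c" using g0 by (cases "k g0") auto
    then show ?thesis using g0 True by (simp add: k'_def)
  qed (simp add: k'_def)
  then have "(\<Sum>g\<in>UNIV. \<Sum>i\<in>{r g..<k g}. \<sigma> g i)
      = (\<Sum>g\<in>UNIV. \<Sum>i\<in>{r g..<k' g}. \<sigma> g i) + \<sigma> g0 (k g0 - 1)"
    by (simp add: sum.distrib)
  then show ?case
    using l2_bound_add[OF 2 1] by (simp add: algebra_simps)
qed

end

section \<open>Balancing\<close>

lemma scalar_prod_mult_mat_vec:
  fixes A :: "real mat"
  assumes "A \<in> carrier_mat k n" "x \<in> carrier_vec n" "y \<in> carrier_vec k"
  shows "y \<bullet> (A *\<^sub>v x) = (transpose_mat A *\<^sub>v y) \<bullet> x"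
  by (rule transpose_vec_mult_scalar[OF assms, symmetric])

lemma zero_minus_mult_vec:
  fixes X :: "real mat"
  assumes "X \<in> carrier_mat n n" "x \<in> carrier_vec n"
  shows "(0\<^sub>m n n - X) *\<^sub>v x = 0\<^sub>v n - X *\<^sub>v x"
proof -
  have "0\<^sub>m n n *\<^sub>v x = 0\<^sub>v n"
    using assms by (intro eq_vecI) (auto simp: scalar_prod_def)
  then show ?thesis
    using minus_mult_distrib_mat_vec[of "0\<^sub>m n n" n n X x] assms by simp
qed

text \<open>Symmetry of \<open>Q\<close> merges the two Lyapunov terms into one scalar product with
  factor 2.\<close>

lemma mat_less_zeroD:
  fixes A Q C :: "real mat"
  assumes A: "A \<in> carrier_mat n n" and Q: "Q \<in> carrier_mat n n" "transpose_mat Q = Q"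
    and C: "C \<in> carrier_mat p n"
    and less: "mat_less n (transpose_mat A * Q + Q * A + transpose_mat C * C) (0\<^sub>m n n)"
    and x: "x \<in> carrier_vec n"
  shows "2 * ((A *\<^sub>v x) \<bullet> (Q *\<^sub>v x)) + (C *\<^sub>v x) \<bullet> (C *\<^sub>v x) \<le> 0"
proof -
  define X where "X = transpose_mat A * Q + Q * A + transpose_mat C * C"
  have X: "X \<in> carrier_mat n n" using A Q C by (auto simp: X_def)
  have "x \<bullet> ((0\<^sub>m n n - X) *\<^sub>v x) \<ge> 0"
  proof (cases "x = 0\<^sub>v n")
    case True
    have "(0\<^sub>m n n - X) *\<^sub>v x \<in> carrier_vec n"
      using X x by (intro mult_mat_vec_carrier[of _ n n]) auto
    from scalar_prod_left_zero[OF this] show ?thesis using True by simp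
  next
    case False
    then show ?thesis using less x unfolding mat_less_def pos_def_def X_def[symmetric]
      by (auto intro: less_imp_le)
  qed
  moreover have "(0\<^sub>m n n - X) *\<^sub>v x = 0\<^sub>v n - X *\<^sub>v x"
    using X x by (rule zero_minus_mult_vec)
  moreover have "x \<bullet> (0\<^sub>v n - X *\<^sub>v x) = x \<bullet> 0\<^sub>v n - x \<bullet> (X *\<^sub>v x)"
    using X x by (intro scalar_prod_minus_distrib[of _ n]) auto
  ultimately have le: "x \<bullet> (X *\<^sub>v x) \<le> 0" using x by simp
  have Xx: "X *\<^sub>v x = transpose_mat A *\<^sub>v (Q *\<^sub>v x) + Q *\<^sub>v (A *\<^sub>v x) + transpose_mat C *\<^sub>v (C *\<^sub>v x)"
  proof -
    have "X *\<^sub>v x = (transpose_mat A * Q + Q * A) *\<^sub>v x + (transpose_mat C * C) *\<^sub>v x"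
      unfolding X_def using A Q C x by (intro add_mult_distrib_mat_vec[of _ n n]) auto
    also have "(transpose_mat A * Q + Q * A) *\<^sub>v x = (transpose_mat A * Q) *\<^sub>v x + (Q * A) *\<^sub>v x"
      using A Q x by (intro add_mult_distrib_mat_vec[of _ n n]) auto
    also have "(transpose_mat A * Q) *\<^sub>v x = transpose_mat A *\<^sub>v (Q *\<^sub>v x)"
      using A Q x by (intro assoc_mult_mat_vec[of _ n n]) auto
    also have "(Q * A) *\<^sub>v x = Q *\<^sub>v (A *\<^sub>v x)"
      using A Q x by (intro assoc_mult_mat_vec[of _ n n]) auto
    also have "(transpose_mat C * C) *\<^sub>v x = transpose_mat C *\<^sub>v (C *\<^sub>v x)"
      using C x by (intro assoc_mult_mat_vec[of _ n p]) auto
    finally show ?thesis .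
  qed
  have c: "A *\<^sub>v x \<in> carrier_vec n" "Q *\<^sub>v x \<in> carrier_vec n" "C *\<^sub>v x \<in> carrier_vec p"
    using A Q C x by auto
  have "x \<bullet> (X *\<^sub>v x) = x \<bullet> (transpose_mat A *\<^sub>v (Q *\<^sub>v x)) + x \<bullet> (Q *\<^sub>v (A *\<^sub>v x))
      + x \<bullet> (transpose_mat C *\<^sub>v (C *\<^sub>v x))"
  proof -
    have m: "transpose_mat A *\<^sub>v (Q *\<^sub>v x) \<in> carrier_vec n" "Q *\<^sub>v (A *\<^sub>v x) \<in> carrier_vec n"
      "transpose_mat C *\<^sub>v (C *\<^sub>v x) \<in> carrier_vec n"
      using A Q C c by auto
    show ?thesis unfolding Xx
      by (simp add: scalar_prod_add_distrib[OF x add_carrier_vec[OF m(1,2)] m(3)]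
          scalar_prod_add_distrib[OF x m(1,2)])
  qed
  also have "x \<bullet> (transpose_mat A *\<^sub>v (Q *\<^sub>v x)) = (A *\<^sub>v x) \<bullet> (Q *\<^sub>v x)"
    using scalar_prod_mult_mat_vec[of "transpose_mat A" n n "Q *\<^sub>v x" x] A x c by simp
  also have "x \<bullet> (Q *\<^sub>v (A *\<^sub>v x)) = (A *\<^sub>v x) \<bullet> (Q *\<^sub>v x)"
    using scalar_prod_mult_mat_vec[of Q n n "A *\<^sub>v x" x] Q x c comm_scalar_prod[OF c(1,2)] by simp
  also have "x \<bullet> (transpose_mat C *\<^sub>v (C *\<^sub>v x)) = (C *\<^sub>v x) \<bullet> (C *\<^sub>v x)"
    using scalar_prod_mult_mat_vec[of "transpose_mat C" n p "C *\<^sub>v x" x] C x c by simp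
  finally show ?thesis using le by simp
qed

lemma mat_le_zeroD:
  fixes M Q Q' :: "real mat"
  assumes M: "M \<in> carrier_mat n' n" and Q: "Q \<in> carrier_mat n n"
    and Q': "Q' \<in> carrier_mat n' n'"
    and le: "mat_le n (transpose_mat M * Q' * M - Q) (0\<^sub>m n n)"
    and x: "x \<in> carrier_vec n"
  shows "(M *\<^sub>v x) \<bullet> (Q' *\<^sub>v (M *\<^sub>v x)) \<le> x \<bullet> (Q *\<^sub>v x)"
proof -
  define X where "X = transpose_mat M * Q' * M - Q"
  have X: "X \<in> carrier_mat n n" using M Q by (auto simp: X_def)
  have "x \<bullet> ((0\<^sub>m n n - X) *\<^sub>v x) \<ge> 0"
    using le x unfolding mat_le_def pos_semidef_def X_def[symmetric] by blast
  moreover have "(0\<^sub>m n n - X) *\<^sub>v x = 0\<^sub>v n - X *\<^sub>v x"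
    using X x by (rule zero_minus_mult_vec)
  moreover have "x \<bullet> (0\<^sub>v n - X *\<^sub>v x) = x \<bullet> 0\<^sub>v n - x \<bullet> (X *\<^sub>v x)"
    using X x by (intro scalar_prod_minus_distrib[of _ n]) auto
  ultimately have le: "x \<bullet> (X *\<^sub>v x) \<le> 0" using x by simp
  have c: "M *\<^sub>v x \<in> carrier_vec n'" "Q' *\<^sub>v (M *\<^sub>v x) \<in> carrier_vec n'" "Q *\<^sub>v x \<in> carrier_vec n"
    using M Q Q' x by auto
  have "X *\<^sub>v x = (transpose_mat M * Q' * M) *\<^sub>v x - Q *\<^sub>v x"
    unfolding X_def using M Q Q' x by (intro minus_mult_distrib_mat_vec[of _ n n]) auto
  also have "(transpose_mat M * Q' * M) *\<^sub>v x = (transpose_mat M * Q') *\<^sub>v (M *\<^sub>v x)"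
    using M Q' x by (intro assoc_mult_mat_vec[of _ n n']) auto
  also have "\<dots> = transpose_mat M *\<^sub>v (Q' *\<^sub>v (M *\<^sub>v x))"
    using M Q' c by (intro assoc_mult_mat_vec[of _ n n']) auto
  finally have "x \<bullet> (X *\<^sub>v x) = x \<bullet> (transpose_mat M *\<^sub>v (Q' *\<^sub>v (M *\<^sub>v x))) - x \<bullet> (Q *\<^sub>v x)"
    using M x c by (simp add: scalar_prod_minus_distrib[of _ n])
  also have "x \<bullet> (transpose_mat M *\<^sub>v (Q' *\<^sub>v (M *\<^sub>v x))) = (M *\<^sub>v x) \<bullet> (Q' *\<^sub>v (M *\<^sub>v x))"
    using scalar_prod_mult_mat_vec[of "transpose_mat M" n n' "Q' *\<^sub>v (M *\<^sub>v x)" x] M x c by simp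
  finally show ?thesis using le by simp
qed

lemma congruence_scalar_prod:
  fixes Q T :: "real mat"
  assumes T: "T \<in> carrier_mat n n" and Q: "Q \<in> carrier_mat n n" and x: "x \<in> carrier_vec n" and y: "y \<in> carrier_vec n"
  shows "(T *\<^sub>v y) \<bullet> (Q *\<^sub>v (T *\<^sub>v x)) = y \<bullet> ((transpose_mat T * Q * T) *\<^sub>v x)"
proof -
  have "(transpose_mat T * Q * T) *\<^sub>v x = (transpose_mat T * Q) *\<^sub>v (T *\<^sub>v x)"
    using T Q x by (intro assoc_mult_mat_vec[of _ n n]) auto
  also have "\<dots> = transpose_mat T *\<^sub>v (Q *\<^sub>v (T *\<^sub>v x))"
    using T Q x by (intro assoc_mult_mat_vec[of _ n n]) auto
  finally show ?thesis
    using scalar_prod_mult_mat_vec[of "transpose_mat T" n n "Q *\<^sub>v (T *\<^sub>v x)" y] T Q x y by simp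
qed

text \<open>\<open>T * S = 1\<close> turns \<open>A\<close> applied to \<open>T x\<close> into
  \<open>T\<close> applied to \<open>(S * A * T) x\<close>, so the inequality at \<open>T x\<close>
  is the transformed one at \<open>x\<close>. With transposed matrices and the roles of
  \<open>S\<close> and \<open>T\<close> exchanged, the same statement covers reachability.\<close>

lemma lyapunov_congruence:
  fixes A Q C S T :: "real mat"
  assumes A: "A \<in> carrier_mat n n" and Q: "Q \<in> carrier_mat n n" "transpose_mat Q = Q"
    and C: "C \<in> carrier_mat p n"
    and less: "mat_less n (transpose_mat A * Q + Q * A + transpose_mat C * C) (0\<^sub>m n n)"
    and S: "S \<in> carrier_mat n n" and T: "T \<in> carrier_mat n n" and TS: "T * S = 1\<^sub>m n"
    and x: "x \<in> carrier_vec n"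
  shows "2 * (((S * A * T) *\<^sub>v x) \<bullet> ((transpose_mat T * Q * T) *\<^sub>v x)) + ((C * T) *\<^sub>v x) \<bullet> ((C * T) *\<^sub>v x) \<le> 0"
proof -
  have SAT: "S * A * T \<in> carrier_mat n n"
    using S A T by (intro mult_carrier_mat[of _ n n])
  then have SATx: "(S * A * T) *\<^sub>v x \<in> carrier_vec n" using x by (rule mult_mat_vec_carrier)
  have "A *\<^sub>v (T *\<^sub>v x) = T *\<^sub>v ((S * A * T) *\<^sub>v x)"
  proof -
    have "T *\<^sub>v ((S * A * T) *\<^sub>v x) = (T * (S * A * T)) *\<^sub>v x"
      by (rule assoc_mult_mat_vec[OF T SAT x, symmetric])
    also have "T * (S * A * T) = T * S * (A * T)"
      using S A T by (simp add: assoc_mult_mat[of _ n n _ n _ n])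
    also have "\<dots> = A * T" using A T by (simp add: TS)
    finally show ?thesis using A T x by (simp add: assoc_mult_mat_vec[of _ n n _ n])
  qed
  moreover have "C *\<^sub>v (T *\<^sub>v x) = (C * T) *\<^sub>v x"
    using C T x by (simp add: assoc_mult_mat_vec[of _ p n _ n])
  moreover have "(T *\<^sub>v ((S * A * T) *\<^sub>v x)) \<bullet> (Q *\<^sub>v (T *\<^sub>v x))
      = ((S * A * T) *\<^sub>v x) \<bullet> ((transpose_mat T * Q * T) *\<^sub>v x)"
    by (rule congruence_scalar_prod[OF T Q(1) x SATx])
  ultimately show ?thesis
    using mat_less_zeroD[OF A Q C less, of "T *\<^sub>v x"] T x by simp
qed

text \<open>As for the Lyapunov inequality, but the coordinates change separately in the source and
  the target mode. Transposition exchanges the two modes, which gives the reachability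
  version.\<close>

lemma reset_congruence:
  fixes M Q Q' S' T T' :: "real mat"
  assumes M: "M \<in> carrier_mat n' n" and Q: "Q \<in> carrier_mat n n"
    and Q': "Q' \<in> carrier_mat n' n'"
    and le: "mat_le n (transpose_mat M * Q' * M - Q) (0\<^sub>m n n)"
    and S': "S' \<in> carrier_mat n' n'" and T': "T' \<in> carrier_mat n' n'" and TS: "T' * S' = 1\<^sub>m n'"
    and T: "T \<in> carrier_mat n n" and x: "x \<in> carrier_vec n"
  shows "((S' * M * T) *\<^sub>v x) \<bullet> ((transpose_mat T' * Q' * T') *\<^sub>v ((S' * M * T) *\<^sub>v x))
    \<le> x \<bullet> ((transpose_mat T * Q * T) *\<^sub>v x)"
proof -
  have SMT: "S' * M * T \<in> carrier_mat n' n"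
    using S' M T by (intro mult_carrier_mat[of _ n' n] mult_carrier_mat[of _ n' n'])
  then have SMTx: "(S' * M * T) *\<^sub>v x \<in> carrier_vec n'" using x by (rule mult_mat_vec_carrier)
  have "M *\<^sub>v (T *\<^sub>v x) = T' *\<^sub>v ((S' * M * T) *\<^sub>v x)"
  proof -
    have "T' *\<^sub>v ((S' * M * T) *\<^sub>v x) = (T' * (S' * M * T)) *\<^sub>v x"
      by (rule assoc_mult_mat_vec[OF T' SMT x, symmetric])
    also have "T' * (S' * M * T) = T' * S' * (M * T)"
      using S' M T' T by (simp add: assoc_mult_mat[of _ n' n' _ n _ n] assoc_mult_mat[of _ n' n' _ n' _ n])
    also have "\<dots> = M * T" using M T by (simp add: TS)
    finally show ?thesis using M T x by (simp add: assoc_mult_mat_vec[of _ n' n _ n])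
  qed
  moreover have "(T' *\<^sub>v ((S' * M * T) *\<^sub>v x)) \<bullet> (Q' *\<^sub>v (T' *\<^sub>v ((S' * M * T) *\<^sub>v x)))
      = ((S' * M * T) *\<^sub>v x) \<bullet> ((transpose_mat T' * Q' * T') *\<^sub>v ((S' * M * T) *\<^sub>v x))"
    by (rule congruence_scalar_prod[OF T' Q' SMTx SMTx])
  moreover have "(T *\<^sub>v x) \<bullet> (Q *\<^sub>v (T *\<^sub>v x)) = x \<bullet> ((transpose_mat T * Q * T) *\<^sub>v x)"
    using T Q x by (intro congruence_scalar_prod) auto
  ultimately show ?thesis
    using mat_le_zeroD[OF M Q Q' le, of "T *\<^sub>v x"] T x by simp
qed

lemma scalar_prod_lessThan:
  "y \<in> carrier_vec n \<Longrightarrow> x \<bullet> y = (\<Sum>i<n. x $ i * y $ i)"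
  unfolding scalar_prod_def by (auto simp: lessThan_atLeast0)

lemma mult_mat_vec_lessThan:
  fixes A :: "real mat"
  assumes "A \<in> carrier_mat k n" "x \<in> carrier_vec n" "i < k"
  shows "(A *\<^sub>v x) $ i = (\<Sum>j<n. A $$ (i, j) * x $ j)"
  using assms by (simp add: scalar_prod_lessThan[of x n])

lemma mat_diag_mult_vec_index:
  assumes "x \<in> carrier_vec n" "i < n"
  shows "(mat_diag n f *\<^sub>v x) $ i = f i * (x $ i :: real)"
proof -
  have "(mat_diag n f *\<^sub>v x) $ i = (\<Sum>j<n. (mat_diag n f) $$ (i, j) * x $ j)"
    using assms by (intro mult_mat_vec_lessThan[of _ n]) auto
  also have "\<dots> = (\<Sum>j<n. if j = i then f i * x $ i else 0)"
    using assms by (intro sum.cong) (auto simp: mat_diag_def)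
  finally show ?thesis using assms by simp
qed

lemma quadratic_form_mat_diag:
  assumes "x \<in> carrier_vec n"
  shows "x \<bullet> (mat_diag n f *\<^sub>v x) = (\<Sum>i<n. f i * (x $ i :: real)\<^sup>2)"
proof -
  have "mat_diag n f *\<^sub>v x \<in> carrier_vec n"
    by (rule mult_mat_vec_carrier[OF mat_diag_dim assms])
  then have "x \<bullet> (mat_diag n f *\<^sub>v x) = (\<Sum>i<n. x $ i * (mat_diag n f *\<^sub>v x) $ i)"
    by (rule scalar_prod_lessThan)
  also have "\<dots> = (\<Sum>i<n. f i * (x $ i)\<^sup>2)"
    by (rule sum.cong) (simp_all add: mat_diag_mult_vec_index[OF assms] power2_eq_square del: index_mult_mat_vec)
  finally show ?thesis .
qed

section \<open>The balancing transformation\<close>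

lemma mat_inverse_eq:
  fixes X Y :: "real mat"
  assumes X: "X \<in> carrier_mat n n" and Y: "Y \<in> carrier_mat n n" and YX: "Y * X = 1\<^sub>m n"
  shows "the (mat_inverse X) = Y"
proof -
  have XY: "X * Y = 1\<^sub>m n" by (rule mat_mult_left_right_inverse[OF Y X YX])
  then have "X \<in> Units (ring_mat TYPE(real) n ())"
    using X Y YX by (auto simp: Units_def ring_mat_def)
  then obtain Z where Z: "mat_inverse X = Some Z"
    using mat_inverse(1)[OF X] by fastforce
  have "X * Z = 1\<^sub>m n" "Z \<in> carrier_mat n n" using mat_inverse(2)[OF X Z] by auto
  then have "Y * X * Z = Y * (X * Z)" "Y * (X * Z) = Y"
    using X Y by (auto intro: assoc_mult_mat[OF Y X])
  then have "Z = Y" using YX \<open>Z \<in> carrier_mat n n\<close> by simp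
  then show ?thesis using Z by simp
qed

text \<open>In both congruences \<open>U\<close> and \<open>V\<close> cancel. What is left of
  \<open>Q\<close> is \<Lambda>^2 between two factors \<Lambda>^(-1/2), and what is left of
  \<open>P\<close> is the square of \<Lambda>^(1/2).\<close>

lemma balancing_map:
  assumes bf: "balancing_factors n P Q U V s"
    and P: "P \<in> carrier_mat n n" and Q: "Q \<in> carrier_mat n n"
  defines "S \<equiv> balancing_map n U V s"
  defines "T \<equiv> the (mat_inverse S)"
  shows "S \<in> carrier_mat n n \<and> T \<in> carrier_mat n n \<and> S * T = 1\<^sub>m n \<and> T * S = 1\<^sub>m n \<and>
    transpose_mat T * Q * T = mat_diag n s \<and> S * P * transpose_mat S = mat_diag n s"
proof -
  \<comment> \<open>\<open>D f\<close> is \<open>f\<close> applied to \<Lambda>, so products of such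
    matrices become products of functions. By positivity of the singular values, identities between
    them need to hold only for positive arguments.\<close>
  define D where "D f = mat_diag n (\<lambda>i. f (s i))" for f :: "real \<Rightarrow> real"
  have D[simp]: "D f \<in> carrier_mat n n" "transpose_mat (D f) = D f" for f
    unfolding D_def by (simp, intro eq_matI) (auto simp: mat_diag_def)
  have spos: "0 < s i" if "i < n" for i using bf that by (auto simp: balancing_factors_def)
  have DD: "D f * D g = D (\<lambda>x. f x * g x)" for f g unfolding D_def by simp
  have D_cong: "D f = D g" if "\<And>x. 0 < x \<Longrightarrow> f x = g x" for f g
    unfolding D_def mat_diag_def using that spos by (intro eq_matI) auto
  have D1: "D (\<lambda>_. 1) = 1\<^sub>m n" by (simp add: D_def)
  from bf have U: "U \<in> carrier_mat n n" and P_eq: "P = U * transpose_mat U" and V: "V \<in> carrier_mat n n"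
    and VV: "transpose_mat V * V = 1\<^sub>m n" "V * transpose_mat V = 1\<^sub>m n"
    and UQU: "transpose_mat U * Q * U = V * D (\<lambda>x. x * x) * transpose_mat V"
    by (auto simp: balancing_factors_def D_def)
  note car = U V Q P D
  note mult_carrier_mat[of _ n n _ n, simp]
  \<comment> \<open>Invertibility of \<open>U\<close> comes from the eigenvalue decomposition: V
    \<Lambda>^(-2) V^T inverts U^T Q U, so multiplying it by U^T Q gives a left inverse of
    U.\<close>
  define Ui where "Ui = V * D (\<lambda>x. 1 / (x * x)) * transpose_mat V * (transpose_mat U * Q)"
  have Ui: "Ui \<in> carrier_mat n n" using car by (simp add: Ui_def)
  note assoc = assoc_mult_mat[of _ n n _ n _ n]
  have cancelV: "transpose_mat V * (V * X) = X" "V * (transpose_mat V * X) = X" if "X \<in> carrier_mat n n" for X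
    using that V VV by (simp_all flip: assoc_mult_mat[of _ n n _ n _ n])
  have cancelD: "D f * (D g * X) = D (\<lambda>x. f x * g x) * X" if "X \<in> carrier_mat n n" for X f g
    using that by (simp flip: assoc_mult_mat[of _ n n _ n _ n] add: DD)
  have UiU: "Ui * U = 1\<^sub>m n"
  proof -
    have "Ui * U = V * D (\<lambda>x. 1 / (x * x)) * transpose_mat V * (transpose_mat U * Q * U)"
      using car by (simp add: Ui_def assoc)
    also have "\<dots> = V * (D (\<lambda>x. 1 / (x * x) * (x * x)) * transpose_mat V)"
      using car by (simp add: UQU assoc cancelV cancelD)
    also have "D (\<lambda>x. 1 / (x * x) * (x * x)) = 1\<^sub>m n"
      unfolding D1[symmetric] by (rule D_cong) auto
    finally show ?thesis using V VV by simp
  qed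
  have UUi: "U * Ui = 1\<^sub>m n" by (rule mat_mult_left_right_inverse[OF Ui U UiU])
  have cancelU: "Ui * (U * X) = X" "U * (Ui * X) = X" if "X \<in> carrier_mat n n" for X
    using that U Ui UUi UiU by (simp_all flip: assoc_mult_mat[of _ n n _ n _ n])
  have S_eq: "S = D sqrt * transpose_mat V * Ui"
    unfolding S_def balancing_map_def mat_inverse_eq[OF U Ui UiU] by (simp add: D_def)
  have S: "S \<in> carrier_mat n n" using car Ui by (simp add: S_eq)
  \<comment> \<open>The inverse of S = \<Lambda>^(1/2) V^T U^(-1), written without inverse
    matrices.\<close>
  define R where "R = U * V * D (\<lambda>x. 1 / sqrt x)"
  have R: "R \<in> carrier_mat n n" using car by (simp add: R_def)
  have Dinv: "D (\<lambda>x. 1 / sqrt x * sqrt x) = 1\<^sub>m n"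
    unfolding D1[symmetric] by (rule D_cong) auto
  have TS: "R * S = 1\<^sub>m n"
  proof -
    have "R * S = U * (V * (D (\<lambda>x. 1 / sqrt x * sqrt x) * (transpose_mat V * Ui)))"
      using car Ui by (simp add: R_def S_eq assoc cancelD)
    also have "\<dots> = 1\<^sub>m n" unfolding Dinv using car Ui by (simp add: cancelV UUi)
    finally show ?thesis .
  qed
  have ST: "S * R = 1\<^sub>m n" by (rule mat_mult_left_right_inverse[OF R S TS])
  have inv: "the (mat_inverse S) = R" by (rule mat_inverse_eq[OF S R TS])
  have Tt: "transpose_mat R = D (\<lambda>x. 1 / sqrt x) * transpose_mat V * transpose_mat U"
    using car by (simp add: R_def transpose_mult[of _ n n _ n] assoc)
  have "transpose_mat R * Q * R = D (\<lambda>x. 1 / sqrt x) * (transpose_mat V * ((transpose_mat U * Q * U) * (V * D (\<lambda>x. 1 / sqrt x))))"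
    unfolding Tt unfolding R_def using car by (simp add: assoc)
  also have "\<dots> = D (\<lambda>x. 1 / sqrt x * (x * x) * (1 / sqrt x))"
    unfolding UQU using car by (simp add: assoc cancelV cancelD DD)
  also have "\<dots> = D (\<lambda>x. x)"
    by (rule D_cong) (simp add: field_simps flip: power2_eq_square)
  finally have Qd: "transpose_mat R * Q * R = mat_diag n s" by (simp add: D_def)
  have St: "transpose_mat S = transpose_mat Ui * V * D sqrt"
    using car Ui by (simp add: S_eq transpose_mult[of _ n n _ n] assoc)
  have UtUit: "transpose_mat U * transpose_mat Ui = 1\<^sub>m n"
    using transpose_mult[OF Ui U] UiU by simp
  have cancelUt: "transpose_mat U * (transpose_mat Ui * X) = X" if "X \<in> carrier_mat n n" for X
    using that U Ui UtUit by (simp flip: assoc_mult_mat[of _ n n _ n _ n])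
  have "S * P * transpose_mat S = D sqrt * D sqrt"
    unfolding S_eq P_eq St[unfolded S_eq] using car Ui by (simp add: assoc cancelU cancelUt cancelV)
  also have "\<dots> = D (\<lambda>x. x)" unfolding DD by (rule D_cong) simp
  finally have Pd: "S * P * transpose_mat S = mat_diag n s" by (simp add: D_def)
  have "T = R" unfolding T_def by (rule inv)
  then show ?thesis using S R ST TS Qd Pd by blast
qed

text \<open>The passage to the inverse weights is Young's inequality $2 d v \le \mu d^2 + v^2/\mu$.\<close>

lemma reset_duality:
  fixes M :: "nat \<Rightarrow> nat \<Rightarrow> real" and \<mu> \<nu> v :: "nat \<Rightarrow> real"
  assumes pos: "\<And>j. j < n \<Longrightarrow> 0 < \<mu> j" "\<And>i. i < n' \<Longrightarrow> 0 < \<nu> i"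
    and dual: "\<And>v. (\<Sum>j<n. \<mu> j * (\<Sum>i<n'. M i j * v i)\<^sup>2) \<le> (\<Sum>i<n'. \<nu> i * (v i)\<^sup>2)"
  shows "(\<Sum>i<n'. (\<Sum>j<n. M i j * v j)\<^sup>2 / \<nu> i) \<le> (\<Sum>j<n. (v j)\<^sup>2 / \<mu> j)"
proof -
  define c where "c i = (\<Sum>j<n. M i j * v j)" for i
  \<comment> \<open>For this \<open>w\<close> the left-hand side L of the claim equals both the
    weighted square sum of \<open>w\<close> and the pairing of \<open>d\<close> with
    \<open>v\<close>. Young's inequality and \<open>dual\<close> then give 2 L \<le> L + R, with R
    the right-hand side.\<close>
  define w where "w i = c i / \<nu> i" for i
  define d where "d j = (\<Sum>i<n'. M i j * w i)" for j
  have "(\<Sum>i<n'. \<nu> i * (w i)\<^sup>2) = (\<Sum>i<n'. (c i)\<^sup>2 / \<nu> i)"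
    by (rule sum.cong) (auto simp: w_def power_divide power2_eq_square)
  moreover have "(\<Sum>i<n'. (c i)\<^sup>2 / \<nu> i) = (\<Sum>j<n. d j * v j)"
  proof -
    have "(\<Sum>i<n'. (c i)\<^sup>2 / \<nu> i) = (\<Sum>i<n'. w i * c i)"
      by (rule sum.cong) (auto simp: w_def power2_eq_square)
    also have "\<dots> = (\<Sum>i<n'. \<Sum>j<n. M i j * w i * v j)"
      by (simp add: c_def sum_distrib_left mult_ac)
    also have "\<dots> = (\<Sum>j<n. d j * v j)"
      by (subst sum.swap) (simp add: d_def sum_distrib_right)
    finally show ?thesis .
  qed
  moreover have "2 * (\<Sum>j<n. d j * v j) \<le> (\<Sum>j<n. \<mu> j * (d j)\<^sup>2) + (\<Sum>j<n. (v j)\<^sup>2 / \<mu> j)"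
    unfolding sum_distrib_left sum.distrib[symmetric]
  proof (rule sum_mono)
    fix j assume "j \<in> {..<n}"
    then have "0 < \<mu> j" using pos by simp
    have "0 \<le> (\<mu> j * d j - v j)\<^sup>2 / \<mu> j" using \<open>0 < \<mu> j\<close> by simp
    also have "\<dots> = \<mu> j * (d j)\<^sup>2 + (v j)\<^sup>2 / \<mu> j - 2 * (d j * v j)"
      using \<open>0 < \<mu> j\<close> by (simp add: field_simps power2_eq_square)
    finally show "2 * (d j * v j) \<le> \<mu> j * (d j)\<^sup>2 + (v j)\<^sup>2 / \<mu> j" by simp
  qed
  moreover have "(\<Sum>j<n. \<mu> j * (d j)\<^sup>2) \<le> (\<Sum>i<n'. \<nu> i * (w i)\<^sup>2)"
    unfolding d_def by (rule dual)
  ultimately show ?thesis unfolding c_def by linarith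
qed

section \<open>Balanced truncation of hybrid systems\<close>

lemma caratheodory_solution_similar:
  assumes sol: "caratheodory_solution A B u a b z" and "0 \<le> a"
    and A: "A \<in> carrier_mat n n" and B: "B \<in> carrier_mat n m"
    and S: "S \<in> carrier_mat n' n" and A': "A' \<in> carrier_mat n' n'"
    and AS: "A' * S = S * A" and B': "B' = S * B"
    and u: "\<And>t. 0 \<le> t \<Longrightarrow> u t \<in> carrier_vec m"
  shows "caratheodory_solution A' B' u a b (\<lambda>t. S *\<^sub>v z t)"
proof -
  have z: "z t \<in> carrier_vec n" if "t \<in> {a..b}" for t
    using sol that A by (auto simp: caratheodory_solution_def)
  have ac: "abs_cont_on a b (\<lambda>t. z t $ i)" if "i < n" for i
    using sol that A by (auto simp: caratheodory_solution_def)
  have der: "AE t in lebesgue. t \<in> {a<..<b} \<longrightarrow> (\<forall>i<n.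
      ((\<lambda>s. z s $ i) has_real_derivative (A *\<^sub>v z t + B *\<^sub>v u t) $ i) (at t))"
    using sol A by (simp add: caratheodory_solution_def)
  have Sz: "(S *\<^sub>v z t) $ i = (\<Sum>j<n. S $$ (i, j) * z t $ j)" if "i < n'" "t \<in> {a..b}" for i t
    by (rule mult_mat_vec_lessThan[OF S z[OF that(2)] that(1)])
  have dim: "dim_row A' = n'" using A' by simp
  show ?thesis
    unfolding caratheodory_solution_def dim
  proof (intro conjI ballI allI impI)
    show "S *\<^sub>v z t \<in> carrier_vec n'" if "t \<in> {a..b}" for t
      using z[OF that] S by auto
    show "abs_cont_on a b (\<lambda>t. (S *\<^sub>v z t) $ i)" if "i < n'" for i
    proof (rule abs_cont_on_cong)
      show "abs_cont_on a b (\<lambda>t. \<Sum>j<n. S $$ (i, j) * z t $ j)"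
        using ac by (intro abs_cont_on_sum abs_cont_on_cmult) auto
    qed (simp add: Sz that del: index_mult_mat_vec)
    show "AE t in lebesgue. t \<in> {a<..<b} \<longrightarrow> (\<forall>i<n'.
      ((\<lambda>s. (S *\<^sub>v z s) $ i) has_real_derivative (A' *\<^sub>v (S *\<^sub>v z t) + B' *\<^sub>v u t) $ i) (at t))"
      using der
    proof eventually_elim
      case (elim t)
      show ?case
      proof (intro impI allI)
        fix i assume t: "t \<in> {a<..<b}" and i: "i < n'"
        have zt: "z t \<in> carrier_vec n" and ut: "u t \<in> carrier_vec m"
          using z u t \<open>0 \<le> a\<close> by auto
        define f where "f = A *\<^sub>v z t + B *\<^sub>v u t"
        have f: "f \<in> carrier_vec n" unfolding f_def using A B zt ut by auto
        have "A' *\<^sub>v (S *\<^sub>v z t) + B' *\<^sub>v u t = S *\<^sub>v f"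
        proof -
          have "A' *\<^sub>v (S *\<^sub>v z t) = S *\<^sub>v (A *\<^sub>v z t)"
            using AS assoc_mult_mat_vec[OF A' S zt] assoc_mult_mat_vec[OF S A zt] by simp
          moreover have "B' *\<^sub>v u t = S *\<^sub>v (B *\<^sub>v u t)"
            unfolding B' by (rule assoc_mult_mat_vec[OF S B ut])
          moreover have "S *\<^sub>v f = S *\<^sub>v (A *\<^sub>v z t) + S *\<^sub>v (B *\<^sub>v u t)"
            unfolding f_def using S A B zt ut by (intro mult_add_distrib_mat_vec) auto
          ultimately show ?thesis by simp
        qed
        then have eq: "(A' *\<^sub>v (S *\<^sub>v z t) + B' *\<^sub>v u t) $ i = (\<Sum>j<n. S $$ (i, j) * f $ j)"
          using mult_mat_vec_lessThan[OF S f i] by simp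
        have "((\<lambda>s. \<Sum>j<n. S $$ (i, j) * z s $ j) has_real_derivative (\<Sum>j<n. S $$ (i, j) * f $ j)) (at t)"
          using elim t by (intro DERIV_sum DERIV_cmult) (auto simp: f_def)
        \<comment> \<open>The coordinate formula \<open>Sz\<close> holds only on the interval, where
          \<open>z\<close> has the right dimension, so the derivative is compared on an open
          neighbourhood.\<close>
        then show "((\<lambda>s. (S *\<^sub>v z s) $ i) has_real_derivative (A' *\<^sub>v (S *\<^sub>v z t) + B' *\<^sub>v u t) $ i) (at t)"
          unfolding eq
          by (rule has_field_derivative_transform_within_open[where S="{a<..<b}"])
            (use t i in \<open>simp_all add: Sz del: index_mult_mat_vec\<close>)
      qed
    qed
  qed
qed

lemma event_time_nonneg:
  assumes "timed_event_seq w"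
  shows "0 \<le> event_time w i"
  using assms by (auto simp: timed_event_seq_def event_time_def intro: sum_nonneg)

lemma event_time_le_Suc:
  assumes "timed_event_seq w"
  shows "event_time w i \<le> event_time w (Suc i)"
  using assms by (auto simp: timed_event_seq_def event_time_def)

lemma disc_seq_cong:
  assumes "trans G' = trans G" "init_disc G' = init_disc G"
  shows "disc_seq G' w = disc_seq G w"
proof
  show "disc_seq G' w i = disc_seq G w i" for i
    using assms by (induction i) auto
qed

text \<open>Only intertwining relations are required of \<open>S\<close>, so the same statement
  carries solutions into balanced coordinates and back.\<close>

lemma solution_segments_similar:
  fixes G G' :: "('q, 'e, 'o) hybrid_system"
  assumes sol: "solution_segments G u w z" and w: "timed_event_seq w"
    and tr: "trans G' = trans G" "init_disc G' = init_disc G"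
    and A: "\<And>g. mat_A G g \<in> carrier_mat (n g) (n g)" and B: "\<And>g. mat_B G g \<in> carrier_mat (n g) m"
    and M: "\<And>g e. reset G g e \<in> carrier_mat (n (trans G g e)) (n g)"
    and S: "\<And>g. S g \<in> carrier_mat (n' g) (n g)"
    and A': "\<And>g. mat_A G' g \<in> carrier_mat (n' g) (n' g)"
    and M': "\<And>g e. reset G' g e \<in> carrier_mat (n' (trans G g e)) (n' g)"
    and AS: "\<And>g. mat_A G' g * S g = S g * mat_A G g"
    and B': "\<And>g. mat_B G' g = S g * mat_B G g"
    and MS: "\<And>g e. reset G' g e * S g = S (trans G g e) * reset G g e"
    and init: "init_cont G' = S (init_disc G) *\<^sub>v init_cont G"
    and u: "\<And>t. 0 \<le> t \<Longrightarrow> u t \<in> carrier_vec m"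
  shows "solution_segments G' u w (\<lambda>i t. S (disc_seq G w i) *\<^sub>v z i t)"
proof -
  note ds = disc_seq_cong[OF tr, of w]
  have car: "caratheodory_solution (mat_A G (disc_seq G w i)) (mat_B G (disc_seq G w i)) u
            (event_time w i) (event_time w (Suc i)) (z i)" for i
    using sol by (simp add: solution_segments_def)
  show ?thesis
    unfolding solution_segments_def ds
  proof (intro conjI allI)
    show "S (disc_seq G w 0) *\<^sub>v z 0 0 = init_cont G'"
      using sol init by (simp add: solution_segments_def)
    fix i
    show "caratheodory_solution (mat_A G' (disc_seq G w i)) (mat_B G' (disc_seq G w i)) u
            (event_time w i) (event_time w (Suc i)) (\<lambda>t. S (disc_seq G w i) *\<^sub>v z i t)"
      by (rule caratheodory_solution_similar[OF car event_time_nonneg[OF w] A B S A' AS B' u])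
    have z: "z i (event_time w (Suc i)) \<in> carrier_vec (n (disc_seq G w i))"
      using car[of i] A[of "disc_seq G w i"] event_time_le_Suc[OF w, of i]
      by (auto simp: caratheodory_solution_def)
    have "z (Suc i) (event_time w (Suc i)) = reset G (disc_seq G w i) (fst (w i)) *\<^sub>v z i (event_time w (Suc i))"
      using sol by (simp add: solution_segments_def)
    then show "S (disc_seq G w (Suc i)) *\<^sub>v z (Suc i) (event_time w (Suc i)) =
        reset G' (disc_seq G w i) (fst (w i)) *\<^sub>v (S (disc_seq G w i) *\<^sub>v z i (event_time w (Suc i)))"
      using MS assoc_mult_mat_vec[OF M' S z, of "fst (w i)"] assoc_mult_mat_vec[OF S M z, of "fst (w i)"]
      by simp
  qed
qed

section \<open>Leading blocks and coordinate form of the inequalities\<close>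

lemma leading_block_carrier: "leading_block k l X \<in> carrier_mat k l"
  by (simp add: leading_block_def)

lemma leading_block_index: "i < k \<Longrightarrow> j < l \<Longrightarrow> leading_block k l X $$ (i, j) = X $$ (i, j)"
  by (simp add: leading_block_def)

lemma leading_block_full: "X \<in> carrier_mat k l \<Longrightarrow> leading_block k l X = X"
  by (intro eq_matI) (auto simp: leading_block_def)

lemma leading_block_mult_vec:
  assumes "v \<in> carrier_vec l" "i < k"
  shows "(leading_block k l X *\<^sub>v v) $ i = (\<Sum>j<l. X $$ (i, j) * v $ j)"
  using mult_mat_vec_lessThan[OF leading_block_carrier assms]
  by (simp add: leading_block_index assms del: index_mult_mat_vec)

text \<open>The truncated vector field is the full one at the zero-padded state, read off in the
  first \<open>k\<close> coordinates. This is why inequalities of the full system apply to its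
  truncations.\<close>

lemma leading_block_vector_field:
  assumes "v \<in> carrier_vec k" "y \<in> carrier_vec m" "i < k" "k \<le> n"
  shows "(leading_block k k A *\<^sub>v v + leading_block k m B *\<^sub>v y) $ i
    = (\<Sum>j<n. A $$ (i, j) * (if j < k then v $ j else 0)) + (\<Sum>l<m. B $$ (i, l) * y $ l)"
proof -
  have "dim_vec (leading_block k m B *\<^sub>v y) = k" by (simp add: leading_block_def)
  then show ?thesis
    unfolding sum_lessThan_pad[OF assms(4)]
    using leading_block_mult_vec[OF assms(1,3), of A] leading_block_mult_vec[OF assms(2,3), of B] assms(3)
    by (simp del: index_mult_mat_vec)
qed

lemma lyapunov_coordinates:
  fixes A C :: "real mat"
  assumes A: "A \<in> carrier_mat n n" and C: "C \<in> carrier_mat p n"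
    and le: "\<And>x. x \<in> carrier_vec n \<Longrightarrow>
      2 * ((A *\<^sub>v x) \<bullet> (mat_diag n s *\<^sub>v x)) + (C *\<^sub>v x) \<bullet> (C *\<^sub>v x) \<le> 0"
  shows "2 * (\<Sum>i<n. s i * v i * (\<Sum>j<n. A $$ (i, j) * v j)) + (\<Sum>l<p. (\<Sum>j<n. C $$ (l, j) * v j)\<^sup>2) \<le> 0"
proof -
  define x where "x = vec n v"
  have xv: "x $ j = v j" if "j < n" for j using that by (auto simp: x_def)
  have x: "x \<in> carrier_vec n" by (simp add: x_def)
  have Dx: "mat_diag n s *\<^sub>v x \<in> carrier_vec n" using x by (rule mult_mat_vec_carrier[OF mat_diag_dim])
  have Cx: "C *\<^sub>v x \<in> carrier_vec p" using C x by (rule mult_mat_vec_carrier)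
  have "(A *\<^sub>v x) \<bullet> (mat_diag n s *\<^sub>v x) = (\<Sum>i<n. s i * v i * (\<Sum>j<n. A $$ (i, j) * v j))"
    unfolding scalar_prod_lessThan[OF Dx]
    by (rule sum.cong) (simp_all add: mult_mat_vec_lessThan[OF A x] mat_diag_mult_vec_index[OF x] xv del: index_mult_mat_vec)
  moreover have "(C *\<^sub>v x) \<bullet> (C *\<^sub>v x) = (\<Sum>l<p. (\<Sum>j<n. C $$ (l, j) * v j)\<^sup>2)"
    unfolding scalar_prod_lessThan[OF Cx]
    by (rule sum.cong) (simp_all add: mult_mat_vec_lessThan[OF C x] xv power2_eq_square del: index_mult_mat_vec)
  ultimately show ?thesis using le[OF x] by simp
qed

lemma reset_coordinates:
  fixes M :: "real mat"
  assumes M: "M \<in> carrier_mat n' n"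
    and le: "\<And>x. x \<in> carrier_vec n \<Longrightarrow> (M *\<^sub>v x) \<bullet> (mat_diag n' s' *\<^sub>v (M *\<^sub>v x)) \<le> x \<bullet> (mat_diag n s *\<^sub>v x)"
  shows "(\<Sum>i<n'. s' i * (\<Sum>j<n. M $$ (i, j) * v j)\<^sup>2) \<le> (\<Sum>j<n. s j * (v j)\<^sup>2)"
proof -
  define x where "x = vec n v"
  have xv: "x $ j = v j" if "j < n" for j using that by (auto simp: x_def)
  have x: "x \<in> carrier_vec n" by (simp add: x_def)
  have Mx: "M *\<^sub>v x \<in> carrier_vec n'" using M x by (rule mult_mat_vec_carrier)
  have "(M *\<^sub>v x) \<bullet> (mat_diag n' s' *\<^sub>v (M *\<^sub>v x)) = (\<Sum>i<n'. s' i * (\<Sum>j<n. M $$ (i, j) * v j)\<^sup>2)"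
    unfolding quadratic_form_mat_diag[OF Mx]
    by (rule sum.cong) (simp_all add: mult_mat_vec_lessThan[OF M x] xv del: index_mult_mat_vec)
  moreover have "x \<bullet> (mat_diag n s *\<^sub>v x) = (\<Sum>j<n. s j * (v j)\<^sup>2)"
    unfolding quadratic_form_mat_diag[OF x] by (rule sum.cong) (simp_all add: xv)
  ultimately show ?thesis using le[OF x] by simp
qed

section \<open>The balanced system and its truncations\<close>

text \<open>The parameters keep only the outcome of balancing: mutually inverse \<open>S g\<close>
  and \<open>T g\<close> that bring both Gramians to the same diagonal matrix.\<close>

locale balanced_hybrid_system =
  fixes H :: "('q::finite, 'e::finite, 'o::finite) hybrid_system"
    and Gp Gq S T :: "'q \<Rightarrow> real mat" and \<sigma> :: "'q \<Rightarrow> nat \<Rightarrow> real"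
    and u :: "real \<Rightarrow> real vec" and w :: "nat \<Rightarrow> 'e \<times> real"
  assumes H: "linear_hybrid_system H" and init: "init_cont H = 0\<^sub>v (state_dim H (init_disc H))"
    and Gp: "reachability_gramians H Gp" and Gq: "observability_gramians H Gq"
    and S: "S g \<in> carrier_mat (state_dim H g) (state_dim H g)"
    and T: "T g \<in> carrier_mat (state_dim H g) (state_dim H g)"
    and inv: "the (mat_inverse (S g)) = T g"
    and ST: "S g * T g = 1\<^sub>m (state_dim H g)" and TS: "T g * S g = 1\<^sub>m (state_dim H g)"
    and Gq_diag: "transpose_mat (T g) * Gq g * T g = mat_diag (state_dim H g) (\<sigma> g)"
    and Gp_diag: "S g * Gp g * transpose_mat (S g) = mat_diag (state_dim H g) (\<sigma> g)"
    and sigma_pos: "i < state_dim H g \<Longrightarrow> 0 < \<sigma> g i"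
    and u: "u \<in> L2 (in_dim H)" and w: "timed_event_seq w"
begin

abbreviation "n \<equiv> state_dim H"

definition "Hb = transformed_system H S"

lemma carriers:
  "mat_A H g \<in> carrier_mat (n g) (n g)" "mat_B H g \<in> carrier_mat (n g) (in_dim H)"
  "mat_C H g \<in> carrier_mat (out_dim H) (n g)" "reset H g e \<in> carrier_mat (n (trans H g e)) (n g)"
  using H by (auto simp: linear_hybrid_system_def)

lemma Hb_simps:
  "trans Hb = trans H" "disc_out Hb = disc_out H" "in_dim Hb = in_dim H" "out_dim Hb = out_dim H"
  "state_dim Hb = n" "init_disc Hb = init_disc H"
  "mat_A Hb g = S g * mat_A H g * T g" "mat_B Hb g = S g * mat_B H g" "mat_C Hb g = mat_C H g * T g"
  "reset Hb g e = S (trans H g e) * reset H g e * T g" "init_cont Hb = 0\<^sub>v (n (init_disc H))"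
proof -
  show "init_cont Hb = 0\<^sub>v (n (init_disc H))"
    using S[of "init_disc H"]
    by (intro eq_vecI) (auto simp: Hb_def transformed_system_def init)
qed (simp_all add: Hb_def transformed_system_def inv)

lemma Hb_carriers:
  "mat_A Hb g \<in> carrier_mat (n g) (n g)" "mat_B Hb g \<in> carrier_mat (n g) (in_dim H)"
  "mat_C Hb g \<in> carrier_mat (out_dim H) (n g)" "reset Hb g e \<in> carrier_mat (n (trans H g e)) (n g)"
  unfolding Hb_simps
  by (rule mult_carrier_mat[OF mult_carrier_mat[OF S carriers(1)] T] mult_carrier_mat[OF S carriers(2)]
      mult_carrier_mat[OF carriers(3) T] mult_carrier_mat[OF mult_carrier_mat[OF S carriers(4)] T])+

lemma StTt: "transpose_mat (S g) * transpose_mat (T g) = 1\<^sub>m (n g)"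
  using transpose_mult[OF T[of g] S[of g]] TS by simp

lemma u_dim: "0 \<le> t \<Longrightarrow> u t \<in> carrier_vec (in_dim H)"
  using u by (simp add: L2_def)

lemma balanced_observability:
  "2 * (\<Sum>i<n g. \<sigma> g i * v i * (\<Sum>j<n g. mat_A Hb g $$ (i, j) * v j))
      + (\<Sum>l<out_dim H. (\<Sum>j<n g. mat_C Hb g $$ (l, j) * v j)\<^sup>2) \<le> 0"
proof (rule lyapunov_coordinates[OF Hb_carriers(1,3)])
  have Q: "Gq g \<in> carrier_mat (n g) (n g)" "transpose_mat (Gq g) = Gq g"
    and less: "mat_less (n g) (transpose_mat (mat_A H g) * Gq g + Gq g * mat_A H g
          + transpose_mat (mat_C H g) * mat_C H g) (0\<^sub>m (n g) (n g))"
    using Gq by (auto simp: observability_gramians_def pos_def_def)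
  show "2 * ((mat_A Hb g *\<^sub>v x) \<bullet> (mat_diag (n g) (\<sigma> g) *\<^sub>v x)) + (mat_C Hb g *\<^sub>v x) \<bullet> (mat_C Hb g *\<^sub>v x) \<le> 0"
    if "x \<in> carrier_vec (n g)" for x
    using lyapunov_congruence[OF carriers(1) Q carriers(3) less S T TS that]
    unfolding Gq_diag Hb_simps .
qed

text \<open>This is the observability inequality of the transposed system, where the transposes of
  \<open>T g\<close> and \<open>S g\<close> take the places of \<open>S g\<close> and
  \<open>T g\<close>.\<close>

lemma balanced_reachability:
  "2 * (\<Sum>i<n g. v i * (\<Sum>j<n g. mat_A Hb g $$ (i, j) * (\<sigma> g j * v j)))
      + (\<Sum>l<in_dim H. (\<Sum>i<n g. mat_B Hb g $$ (i, l) * v i)\<^sup>2) \<le> 0"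
proof -
  have P: "Gp g \<in> carrier_mat (n g) (n g)" "transpose_mat (Gp g) = Gp g"
    and less: "mat_less (n g) (mat_A H g * Gp g + Gp g * transpose_mat (mat_A H g)
          + mat_B H g * transpose_mat (mat_B H g)) (0\<^sub>m (n g) (n g))"
    using Gp by (auto simp: reachability_gramians_def pos_def_def)
  have At: "transpose_mat (mat_A Hb g) = transpose_mat (T g) * transpose_mat (mat_A H g) * transpose_mat (S g)"
  proof -
    have "transpose_mat (mat_A Hb g) = transpose_mat (T g) * (transpose_mat (mat_A H g) * transpose_mat (S g))"
      unfolding Hb_simps transpose_mult[OF mult_carrier_mat[OF S carriers(1)] T] transpose_mult[OF S carriers(1)] ..
    then show ?thesis
      using S[of g] T[of g] carriers(1)[of g] by (simp add: assoc_mult_mat[of _ "n g" "n g" _ "n g" _ "n g"])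
  qed
  have Bt: "transpose_mat (mat_B Hb g) = transpose_mat (mat_B H g) * transpose_mat (S g)"
    unfolding Hb_simps by (rule transpose_mult[OF S carriers(2)])
  have "2 * (\<Sum>i<n g. \<sigma> g i * v i * (\<Sum>j<n g. transpose_mat (mat_A Hb g) $$ (i, j) * v j))
      + (\<Sum>l<in_dim H. (\<Sum>j<n g. transpose_mat (mat_B Hb g) $$ (l, j) * v j)\<^sup>2) \<le> 0"
  proof (rule lyapunov_coordinates)
    show "transpose_mat (mat_A Hb g) \<in> carrier_mat (n g) (n g)"
      "transpose_mat (mat_B Hb g) \<in> carrier_mat (in_dim H) (n g)"
      using Hb_carriers(1,2)[of g] by auto
    fix x :: "real vec" assume x: "x \<in> carrier_vec (n g)"
    have t: "transpose_mat (mat_A H g) \<in> carrier_mat (n g) (n g)"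
      "transpose_mat (mat_B H g) \<in> carrier_mat (in_dim H) (n g)"
      "transpose_mat (T g) \<in> carrier_mat (n g) (n g)" "transpose_mat (S g) \<in> carrier_mat (n g) (n g)"
      using carriers(1,2)[of g] S[of g] T[of g] by auto
    show "2 * ((transpose_mat (mat_A Hb g) *\<^sub>v x) \<bullet> (mat_diag (n g) (\<sigma> g) *\<^sub>v x))
        + (transpose_mat (mat_B Hb g) *\<^sub>v x) \<bullet> (transpose_mat (mat_B Hb g) *\<^sub>v x) \<le> 0"
      using lyapunov_congruence[OF t(1) P t(2) _ t(3,4) StTt x] less
      unfolding At Bt transpose_transpose Gp_diag by blast
  qed
  \<comment> \<open>Exchanging the two summations undoes the transposition of the matrix.\<close>
  moreover have "(\<Sum>i<n g. \<sigma> g i * v i * (\<Sum>j<n g. transpose_mat (mat_A Hb g) $$ (i, j) * v j))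
      = (\<Sum>i<n g. v i * (\<Sum>j<n g. mat_A Hb g $$ (i, j) * (\<sigma> g j * v j)))"
  proof -
    have "(\<Sum>i<n g. \<sigma> g i * v i * (\<Sum>j<n g. transpose_mat (mat_A Hb g) $$ (i, j) * v j))
      = (\<Sum>i<n g. \<Sum>j<n g. v j * (mat_A Hb g $$ (j, i) * (\<sigma> g i * v i)))"
      unfolding sum_distrib_left using Hb_carriers(1)[of g] by (intro sum.cong) auto
    also have "\<dots> = (\<Sum>i<n g. v i * (\<Sum>j<n g. mat_A Hb g $$ (i, j) * (\<sigma> g j * v j)))"
      unfolding sum_distrib_left by (rule sum.swap)
    finally show ?thesis .
  qed
  moreover have "(\<Sum>j<n g. transpose_mat (mat_B Hb g) $$ (l, j) * v j) = (\<Sum>i<n g. mat_B Hb g $$ (i, l) * v i)"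
    if "l < in_dim H" for l
    using Hb_carriers(2)[of g] that by (intro sum.cong) auto
  ultimately show ?thesis by simp
qed

lemma balanced_observability_reset:
  "(\<Sum>i<n (trans H g e). \<sigma> (trans H g e) i * (\<Sum>j<n g. reset Hb g e $$ (i, j) * v j)\<^sup>2)
      \<le> (\<Sum>j<n g. \<sigma> g j * (v j)\<^sup>2)"
proof (rule reset_coordinates[OF Hb_carriers(4)])
  have Q: "Gq g \<in> carrier_mat (n g) (n g)" for g
    using Gq by (auto simp: observability_gramians_def pos_def_def)
  have le: "mat_le (n g) (transpose_mat (reset H g e) * Gq (trans H g e) * reset H g e - Gq g) (0\<^sub>m (n g) (n g))"
    using Gq by (auto simp: observability_gramians_def)
  show "(reset Hb g e *\<^sub>v x) \<bullet> (mat_diag (n (trans H g e)) (\<sigma> (trans H g e)) *\<^sub>v (reset Hb g e *\<^sub>v x))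
      \<le> x \<bullet> (mat_diag (n g) (\<sigma> g) *\<^sub>v x)" if "x \<in> carrier_vec (n g)" for x
    using reset_congruence[OF carriers(4) Q Q le S T TS T that] unfolding Gq_diag Hb_simps .
qed

text \<open>The Gramian inequality bounds the transposed reset in the weights \<sigma>. Duality
  turns this into a bound for the reset itself in the inverse weights, which is what the second
  storage term needs.\<close>

lemma balanced_reachability_reset:
  "(\<Sum>i<n (trans H g e). (\<Sum>j<n g. reset Hb g e $$ (i, j) * v j)\<^sup>2 / \<sigma> (trans H g e) i)
      \<le> (\<Sum>j<n g. (v j)\<^sup>2 / \<sigma> g j)"
proof (rule reset_duality)
  let ?n' = "n (trans H g e)"
  have P: "Gp g \<in> carrier_mat (n g) (n g)" for g
    using Gp by (auto simp: reachability_gramians_def pos_def_def)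
  have le: "mat_le ?n' (reset H g e * Gp g * transpose_mat (reset H g e) - Gp (trans H g e)) (0\<^sub>m ?n' ?n')"
    using Gp by (auto simp: reachability_gramians_def)
  have t: "transpose_mat (reset H g e) \<in> carrier_mat (n g) ?n'"
    "transpose_mat (T g) \<in> carrier_mat (n g) (n g)" "transpose_mat (S g) \<in> carrier_mat (n g) (n g)"
    "transpose_mat (S (trans H g e)) \<in> carrier_mat ?n' ?n'"
    using carriers(4)[of g e] S[of g] T[of g] S[of "trans H g e"] by auto
  have Mt: "transpose_mat (reset Hb g e)
      = transpose_mat (T g) * transpose_mat (reset H g e) * transpose_mat (S (trans H g e))"
    unfolding Hb_simps transpose_mult[OF mult_carrier_mat[OF S carriers(4)] T] transpose_mult[OF S carriers(4)]
    by (rule assoc_mult_mat[OF t(2,1,4), symmetric])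
  fix v :: "nat \<Rightarrow> real"
  have "(\<Sum>j<n g. \<sigma> g j * (\<Sum>i<?n'. transpose_mat (reset Hb g e) $$ (j, i) * v i)\<^sup>2)
      \<le> (\<Sum>i<?n'. \<sigma> (trans H g e) i * (v i)\<^sup>2)"
  proof (rule reset_coordinates)
    show "transpose_mat (reset Hb g e) \<in> carrier_mat (n g) ?n'"
      using Hb_carriers(4)[of g e] by simp
    fix x :: "real vec" assume x: "x \<in> carrier_vec ?n'"
    show "(transpose_mat (reset Hb g e) *\<^sub>v x) \<bullet> (mat_diag (n g) (\<sigma> g) *\<^sub>v (transpose_mat (reset Hb g e) *\<^sub>v x))
        \<le> x \<bullet> (mat_diag ?n' (\<sigma> (trans H g e)) *\<^sub>v x)"
      using reset_congruence[OF t(1) P P _ t(2,3) StTt t(4) x] le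
      unfolding Mt transpose_transpose Gp_diag by blast
  qed
  moreover have "(\<Sum>i<?n'. transpose_mat (reset Hb g e) $$ (j, i) * v i) = (\<Sum>i<?n'. reset Hb g e $$ (i, j) * v i)"
    if "j < n g" for j
    using Hb_carriers(4)[of g e] that by (intro sum.cong) auto
  ultimately show "(\<Sum>j<n g. \<sigma> g j * (\<Sum>i<?n'. reset Hb g e $$ (i, j) * v i)\<^sup>2)
      \<le> (\<Sum>i<?n'. \<sigma> (trans H g e) i * (v i)\<^sup>2)" by simp
qed (use sigma_pos in auto)

sublocale balanced_run n "in_dim H" "out_dim H" "\<lambda>g i j. mat_A Hb g $$ (i, j)" "\<lambda>g i j. mat_B Hb g $$ (i, j)"
  "\<lambda>g i j. mat_C Hb g $$ (i, j)" "\<lambda>g e i j. reset Hb g e $$ (i, j)" "trans H" \<sigma>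
  "disc_seq H w" "\<lambda>s. fst (w s)" "event_time w" "\<lambda>l t. u t $ l"
proof
  show "filterlim (event_time w) at_top sequentially"
    using w by (simp add: timed_event_seq_def event_time_def[abs_def])
  show "(\<lambda>t. u t $ l) \<in> borel_measurable (lebesgue_on {0..})"
    "integrable (lebesgue_on {0..}) (\<lambda>t. (u t $ l)\<^sup>2)" if "l < in_dim H" for l
    using u that by (auto simp: L2_def)
qed (use sigma_pos balanced_observability balanced_reachability balanced_observability_reset
    balanced_reachability_reset event_time_le_Suc[OF w] in \<open>auto simp: event_time_def\<close>)

abbreviation "truncation k \<equiv> truncated_system Hb k"

lemma truncation_simps:
  "trans (truncation k) = trans H" "disc_out (truncation k) = disc_out H" "init_disc (truncation k) = init_disc H"
  "mat_A (truncation k) g = leading_block (k g) (k g) (mat_A Hb g)"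
  "mat_B (truncation k) g = leading_block (k g) (in_dim H) (mat_B Hb g)"
  "mat_C (truncation k) g = leading_block (out_dim H) (k g) (mat_C Hb g)"
  "reset (truncation k) g e = leading_block (k (trans H g e)) (k g) (reset Hb g e)"
  "init_cont (truncation k) = 0\<^sub>v (k (init_disc H))"
  by (simp_all add: truncated_system_def Hb_simps)

lemma disc_seq_truncation: "disc_seq (truncation k) w = disc_seq H w"
  by (rule disc_seq_cong) (simp_all add: truncation_simps)

definition pad :: "('q \<Rightarrow> nat) \<Rightarrow> (nat \<Rightarrow> real \<Rightarrow> real vec) \<Rightarrow> nat \<Rightarrow> nat \<Rightarrow> real \<Rightarrow> real" where
  "pad k z s i t = (if i < k (disc_seq H w s) then z s t $ i else 0)"

lemma solution_dim:
  assumes "solution_segments (truncation k) u w z" "t \<in> {event_time w s..event_time w (Suc s)}"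
  shows "z s t \<in> carrier_vec (k (disc_seq H w s))"
  using assms
  by (auto simp: solution_segments_def caratheodory_solution_def disc_seq_truncation truncation_simps leading_block_def)

text \<open>It applies to any solution, in particular to the one selected by
  \<open>segments\<close>.\<close>

lemma solution_imp_trajectory:
  assumes k: "\<And>g. k g \<le> n g" and sol: "solution_segments (truncation k) u w z"
  shows "trajectory k (pad k z)"
proof -
  have car: "caratheodory_solution (leading_block (k (disc_seq H w s)) (k (disc_seq H w s)) (mat_A Hb (disc_seq H w s)))
      (leading_block (k (disc_seq H w s)) (in_dim H) (mat_B Hb (disc_seq H w s))) u
      (event_time w s) (event_time w (Suc s)) (z s)" for s
    using sol by (simp add: solution_segments_def disc_seq_truncation truncation_simps)
  have dr: "dim_row (leading_block a b X) = a" for a b X by (simp add: leading_block_def)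
  show ?thesis
    unfolding trajectory_def
  proof (intro conjI allI impI)
    show "pad k z 0 i 0 = 0" for i
      using sol by (simp add: pad_def solution_segments_def truncation_simps)
    show "abs_cont_on (event_time w s) (event_time w (Suc s)) (pad k z s i)" for s i
      using car[of s] by (cases "i < k (disc_seq H w s)")
        (auto simp: pad_def[abs_def] caratheodory_solution_def dr abs_cont_on_const)
    show "pad k z s i t = 0" if "k (disc_seq H w s) \<le> i" for s i t
      using that by (simp add: pad_def)
    fix s
    define g where "g = disc_seq H w s"
    have "AE t in lebesgue. t \<in> {event_time w s<..<event_time w (Suc s)} \<longrightarrow> (\<forall>i<k g.
        ((\<lambda>t. z s t $ i) has_real_derivative (leading_block (k g) (k g) (mat_A Hb g) *\<^sub>v z s t
          + leading_block (k g) (in_dim H) (mat_B Hb g) *\<^sub>v u t) $ i) (at t))"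
      using car[of s] by (simp add: caratheodory_solution_def dr g_def)
    then show "AE t in lebesgue. t \<in> {event_time w s<..<event_time w (Suc s)} \<longrightarrow> (\<forall>i<k (disc_seq H w s).
        (pad k z s i has_real_derivative (\<Sum>j<n (disc_seq H w s). mat_A Hb (disc_seq H w s) $$ (i, j) * pad k z s j t)
          + (\<Sum>l<in_dim H. mat_B Hb (disc_seq H w s) $$ (i, l) * u t $ l)) (at t))"
      unfolding g_def[symmetric]
    proof eventually_elim
      case (elim t)
      show ?case
      proof (intro impI allI)
        fix i assume t: "t \<in> {event_time w s<..<event_time w (Suc s)}" and i: "i < k g"
        have "z s t \<in> carrier_vec (k g)" using solution_dim[OF sol, of t s] t by (auto simp: g_def)
        moreover have "u t \<in> carrier_vec (in_dim H)"
          using u_dim t event_time_nonneg[OF w, of s] by auto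
        moreover have "pad k z s i = (\<lambda>t. z s t $ i)" using i by (simp add: pad_def[abs_def] g_def)
        moreover have "((\<lambda>t. z s t $ i) has_real_derivative (leading_block (k g) (k g) (mat_A Hb g) *\<^sub>v z s t
          + leading_block (k g) (in_dim H) (mat_B Hb g) *\<^sub>v u t) $ i) (at t)"
          using elim t i by blast
        ultimately show "(pad k z s i has_real_derivative (\<Sum>j<n g. mat_A Hb g $$ (i, j) * pad k z s j t)
          + (\<Sum>l<in_dim H. mat_B Hb g $$ (i, l) * u t $ l)) (at t)"
          using leading_block_vector_field[of "z s t" "k g" "u t" "in_dim H" i "n g" "mat_A Hb g" "mat_B Hb g"] k[of g] i
          by (simp only: pad_def g_def[symmetric])
      qed
    qed
  next
    fix s i assume i: "i < k (disc_seq H w (Suc s))"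
    have zt: "z s (event_time w (Suc s)) \<in> carrier_vec (k (disc_seq H w s))"
      by (rule solution_dim[OF sol]) (simp add: event_time_le_Suc[OF w])
    have "z (Suc s) (event_time w (Suc s)) = leading_block (k (disc_seq H w (Suc s))) (k (disc_seq H w s))
        (reset Hb (disc_seq H w s) (fst (w s))) *\<^sub>v z s (event_time w (Suc s))"
      using sol by (simp add: solution_segments_def disc_seq_truncation truncation_simps)
    then show "pad k z (Suc s) i (event_time w (Suc s)) = (\<Sum>j<n (disc_seq H w s).
        reset Hb (disc_seq H w s) (fst (w s)) $$ (i, j) * pad k z s j (event_time w (Suc s)))"
      using i leading_block_mult_vec[OF zt i] unfolding pad_def sum_lessThan_pad[OF k] by simp
  qed
qed

text \<open>Serves existence: it turns a constructed trajectory into a witness for the choice made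
  in \<open>segments\<close>.\<close>

lemma trajectory_imp_solution:
  assumes k: "\<And>g. k g \<le> n g" and x: "trajectory k x"
  shows "solution_segments (truncation k) u w (\<lambda>s t. vec (k (disc_seq H w s)) (\<lambda>i. x s i t))"
  unfolding solution_segments_def disc_seq_truncation truncation_simps
proof (intro conjI allI)
  show "vec (k (disc_seq H w 0)) (\<lambda>i. x 0 i 0) = 0\<^sub>v (k (init_disc H))"
    using x by (intro eq_vecI) (auto simp: trajectory_def)
  fix s
  define g where "g = disc_seq H w s"
  have dr: "dim_row (leading_block a b X) = a" for a b X by (simp add: leading_block_def)
  \<comment> \<open>Cutting a trajectory to its first \<open>k g\<close> coordinates and padding it
    again changes nothing, since it vanishes beyond them.\<close>
  have x_pad: "(if j < k g then vec (k g) (\<lambda>i. x s i t) $ j else 0) = x s j t" for j t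
    using x by (auto simp: trajectory_def g_def)
  show "caratheodory_solution (leading_block (k (disc_seq H w s)) (k (disc_seq H w s)) (mat_A Hb (disc_seq H w s)))
      (leading_block (k (disc_seq H w s)) (in_dim H) (mat_B Hb (disc_seq H w s))) u
      (event_time w s) (event_time w (Suc s)) (\<lambda>t. vec (k (disc_seq H w s)) (\<lambda>i. x s i t))"
    unfolding g_def[symmetric] caratheodory_solution_def dr
  proof (intro conjI ballI allI impI)
    show "vec (k g) (\<lambda>i. x s i t) \<in> carrier_vec (k g)" for t by simp
    show "abs_cont_on (event_time w s) (event_time w (Suc s)) (\<lambda>t. vec (k g) (\<lambda>i. x s i t) $ i)" if "i < k g" for i
      using x that by (simp add: trajectory_def)
    have "AE t in lebesgue. t \<in> {event_time w s<..<event_time w (Suc s)} \<longrightarrow> (\<forall>i<k g.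
        (x s i has_real_derivative (\<Sum>j<n g. mat_A Hb g $$ (i, j) * x s j t)
          + (\<Sum>l<in_dim H. mat_B Hb g $$ (i, l) * u t $ l)) (at t))"
      using x by (simp add: trajectory_def g_def)
    then show "AE t in lebesgue. t \<in> {event_time w s<..<event_time w (Suc s)} \<longrightarrow> (\<forall>i<k g.
        ((\<lambda>t. vec (k g) (\<lambda>i. x s i t) $ i) has_real_derivative (leading_block (k g) (k g) (mat_A Hb g) *\<^sub>v vec (k g) (\<lambda>i. x s i t)
          + leading_block (k g) (in_dim H) (mat_B Hb g) *\<^sub>v u t) $ i) (at t))"
    proof eventually_elim
      case (elim t)
      show ?case
      proof (intro impI allI)
        fix i assume t: "t \<in> {event_time w s<..<event_time w (Suc s)}" and i: "i < k g"
        have ut: "u t \<in> carrier_vec (in_dim H)"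
          using u_dim t event_time_nonneg[OF w, of s] by auto
        have "(leading_block (k g) (k g) (mat_A Hb g) *\<^sub>v vec (k g) (\<lambda>i. x s i t)
          + leading_block (k g) (in_dim H) (mat_B Hb g) *\<^sub>v u t) $ i = (\<Sum>j<n g. mat_A Hb g $$ (i, j) * x s j t)
          + (\<Sum>l<in_dim H. mat_B Hb g $$ (i, l) * u t $ l)"
          using leading_block_vector_field[where v="vec (k g) (\<lambda>i. x s i t)" and A="mat_A Hb g" and B="mat_B Hb g",
            OF vec_carrier ut i k]
          by (simp only: x_pad)
        then show "((\<lambda>t. vec (k g) (\<lambda>i. x s i t) $ i) has_real_derivative (leading_block (k g) (k g) (mat_A Hb g) *\<^sub>v vec (k g) (\<lambda>i. x s i t)
          + leading_block (k g) (in_dim H) (mat_B Hb g) *\<^sub>v u t) $ i) (at t)"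
          using elim t i by simp
      qed
    qed
  qed
  show "vec (k (disc_seq H w (Suc s))) (\<lambda>i. x (Suc s) i (event_time w (Suc s))) =
      leading_block (k (trans H (disc_seq H w s) (fst (w s)))) (k (disc_seq H w s)) (reset Hb (disc_seq H w s) (fst (w s)))
        *\<^sub>v vec (k (disc_seq H w s)) (\<lambda>i. x s i (event_time w (Suc s)))"
    (is "?l = ?L *\<^sub>v ?v")
  proof (rule eq_vecI)
    fix i assume "i < dim_vec (?L *\<^sub>v ?v)"
    then have i: "i < k (trans H g (fst (w s)))" by (simp add: leading_block_def g_def)
    have "(?L *\<^sub>v ?v) $ i = (\<Sum>j<k g. reset Hb g (fst (w s)) $$ (i, j) * ?v $ j)"
      using i unfolding g_def by (intro leading_block_mult_vec) auto
    also have "\<dots> = (\<Sum>j<n g. reset Hb g (fst (w s)) $$ (i, j) * x s j (event_time w (Suc s)))"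
      using sum_lessThan_pad[OF k, of _ g "\<lambda>j. ?v $ j"] x_pad by (simp only: g_def)
    also have "\<dots> = ?l $ i"
      using x i by (simp add: trajectory_def g_def)
    finally show "?l $ i = (?L *\<^sub>v ?v) $ i" by simp
  qed (simp add: leading_block_def)
qed

lemma truncation_solvable:
  assumes "\<And>g. k g \<le> n g"
  shows "solution_segments (truncation k) u w (segments (truncation k) u w)"
proof -
  obtain x where "trajectory k x" using trajectory_exists[OF assms] by blast
  then have "\<exists>z. solution_segments (truncation k) u w z"
    using trajectory_imp_solution[OF assms] by (intro exI)
  then show ?thesis unfolding segments_def by (rule someI_ex)
qed

text \<open>The balanced system counts as its own truncation, so the full and the reduced model fall
  under the same lemmas.\<close>

lemma full_truncation: "truncation n = Hb"
  unfolding truncated_system_def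
  using Hb_carriers by (intro hybrid_system.equality)
    (auto simp: Hb_simps(1-6,11) leading_block_full intro!: ext)

lemma solution_to_balanced:
  assumes "solution_segments H u w z"
  shows "solution_segments Hb u w (\<lambda>s t. S (disc_seq H w s) *\<^sub>v z s t)"
proof (rule solution_segments_similar[OF assms w _ _ carriers(1,2,4) S Hb_carriers(1,4) _ _ _ _ u_dim])
  show "mat_A Hb g * S g = S g * mat_A H g" for g
    unfolding Hb_simps assoc_mult_mat[OF mult_carrier_mat[OF S carriers(1)] T S] TS
    by (rule right_mult_one_mat[OF mult_carrier_mat[OF S carriers(1)]])
  show "reset Hb g e * S g = S (trans H g e) * reset H g e" for g e
    unfolding Hb_simps assoc_mult_mat[OF mult_carrier_mat[OF S carriers(4)] T S] TS
    by (rule right_mult_one_mat[OF mult_carrier_mat[OF S carriers(4)]])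
qed (simp_all add: Hb_simps(1,6,8), simp add: Hb_def transformed_system_def)

lemma solution_from_balanced:
  assumes "solution_segments Hb u w z"
  shows "solution_segments H u w (\<lambda>s t. T (disc_seq Hb w s) *\<^sub>v z s t)"
proof (rule solution_segments_similar[OF assms w, where n=n and n'=n and m="in_dim H"])
  show "mat_A H g * T g = T g * mat_A Hb g" for g
    unfolding Hb_simps assoc_mult_mat[OF S carriers(1) T] assoc_mult_mat[OF T S mult_carrier_mat[OF carriers(1) T], symmetric] TS
    by (rule left_mult_one_mat[OF mult_carrier_mat[OF carriers(1) T], symmetric])
  show "reset H g e * T g = T (trans Hb g e) * reset Hb g e" for g e
    unfolding Hb_simps assoc_mult_mat[OF S carriers(4) T] assoc_mult_mat[OF T S mult_carrier_mat[OF carriers(4) T], symmetric] TS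
    by (rule left_mult_one_mat[OF mult_carrier_mat[OF carriers(4) T], symmetric])
  show "mat_B H g = T g * mat_B Hb g" for g
    unfolding Hb_simps assoc_mult_mat[OF T S carriers(2), symmetric] TS
    by (rule left_mult_one_mat[OF carriers(2), symmetric])
  show "init_cont H = T (init_disc Hb) *\<^sub>v init_cont Hb"
    unfolding Hb_simps init using T[of "init_disc H"] by (intro eq_vecI) auto
  show "u t \<in> carrier_vec (in_dim H)" if "0 \<le> t" for t by (rule u_dim[OF that])
qed (use carriers Hb_carriers T in \<open>simp_all add: Hb_simps(1,6)\<close>)

text \<open>Existence is known in balanced coordinates and is carried back by
  \<open>T\<close>.\<close>

lemma original_solvable: "solution_segments H u w (segments H u w)"
proof -
  have "solution_segments Hb u w (segments Hb u w)"
    using truncation_solvable[of n] by (simp add: full_truncation)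
  then have "\<exists>z. solution_segments H u w z" by (intro exI) (rule solution_from_balanced)
  then show ?thesis unfolding segments_def by (rule someI_ex)
qed

lemma idx_bounds:
  assumes "0 \<le> t"
  shows "event_time w (idx t) \<le> t" "t < event_time w (Suc (idx t))"
proof -
  obtain s where s: "event_time w s \<le> t" "t < event_time w (Suc s)" using idx_exists[OF assms] by blast
  then show "event_time w (idx t) \<le> t" "t < event_time w (Suc (idx t))"
    using idx_unique[OF s] by auto
qed

lemma active_index_eq: "active_index w t = idx t"
  by (simp add: active_index_def idx_def)

theorem balanced_truncation_error:
  assumes r: "\<And>g. r g \<le> n g"
    and y: "io_map H u w = (od, y)" and yr: "io_map (truncation r) u w = (odr, yr)"
  shows "odr = od" "(\<lambda>t. y t - yr t) \<in> L2 (out_dim H)"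
    "L2_norm (\<lambda>t. y t - yr t) \<le> 2 * (\<Sum>g\<in>UNIV. \<Sum>i\<in>{r g..<n g}. \<sigma> g i) * L2_norm u"
proof -
  show "odr = od"
    using y yr by (auto simp: io_map_def disc_state_def truncation_simps disc_seq_truncation)
  define z where "z = segments H u w"
  define zr where "zr = segments (truncation r) u w"
  have z: "solution_segments H u w z" unfolding z_def by (rule original_solvable)
  have zr: "solution_segments (truncation r) u w zr" unfolding zr_def by (rule truncation_solvable[OF r])
  \<comment> \<open>Only the state of \<open>H\<close> has to be transformed: \<open>zr\<close>
    already lives in balanced coordinates, and outputs do not depend on the coordinates.\<close>
  define zb where "zb s t = S (disc_seq H w s) *\<^sub>v z s t" for s t
  have zb: "solution_segments (truncation n) u w zb"
    unfolding full_truncation zb_def using solution_to_balanced[OF z] by simp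
  define x where "x = pad n zb"
  define X where "X = pad r zr"
  have x: "trajectory n x" unfolding x_def by (rule solution_imp_trajectory[OF _ zb]) simp
  have X: "trajectory r X" unfolding X_def by (rule solution_imp_trajectory[OF r zr])
  define e where "e l t = signal x l t - signal X l t" for l t
  define b where "b = 2 * (\<Sum>g\<in>UNIV. \<Sum>i\<in>{r g..<n g}. \<sigma> g i) * sqrt u_energy"
  have bound: "l2_bound (out_dim H) e b"
    unfolding e_def[abs_def] b_def by (rule truncation_error[OF x X r]) simp
  have y_eq: "y t = mat_C H (disc_seq H w (idx t)) *\<^sub>v z (idx t) t"
    and yr_eq: "yr t = leading_block (out_dim H) (r (disc_seq H w (idx t))) (mat_C Hb (disc_seq H w (idx t))) *\<^sub>v zr (idx t) t" for t
    using y yr by (auto simp: io_map_def disc_state_def cont_state_def truncation_simps disc_seq_truncation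
        active_index_eq z_def zr_def)
  have yl: "y t \<in> carrier_vec (out_dim H)" "l < out_dim H \<Longrightarrow> y t $ l = signal x l t" if t: "0 \<le> t" for t l
  proof -
    define g where "g = disc_seq H w (idx t)"
    have "caratheodory_solution (mat_A H g) (mat_B H g) u
        (event_time w (idx t)) (event_time w (Suc (idx t))) (z (idx t))"
      using z by (simp add: solution_segments_def g_def)
    then have zt: "z (idx t) t \<in> carrier_vec (n g)"
      using idx_bounds[OF t] carriers(1)[of g] by (simp add: caratheodory_solution_def)
    have zbt: "zb (idx t) t \<in> carrier_vec (n g)"
      unfolding zb_def g_def[symmetric] by (rule mult_mat_vec_carrier[OF S zt])
    show "y t \<in> carrier_vec (out_dim H)"
      unfolding y_eq g_def[symmetric] by (rule mult_mat_vec_carrier[OF carriers(3) zt])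
    assume l: "l < out_dim H"
    \<comment> \<open>The output matrix of the balanced system contains \<open>T g\<close>, which
      undoes the transformation by \<open>S g\<close>.\<close>
    have "T g *\<^sub>v zb (idx t) t = z (idx t) t"
      unfolding zb_def g_def[symmetric] assoc_mult_mat_vec[OF T S zt, symmetric] TS
      by (rule one_mult_mat_vec[OF zt])
    then have "y t = mat_C Hb g *\<^sub>v zb (idx t) t"
      unfolding y_eq g_def[symmetric] Hb_simps assoc_mult_mat_vec[OF carriers(3) T zbt] by simp
    then have "y t $ l = (\<Sum>j<n g. mat_C Hb g $$ (l, j) * zb (idx t) t $ j)"
      using mult_mat_vec_lessThan[OF Hb_carriers(3) zbt l] by simp
    then show "y t $ l = signal x l t"
      by (simp add: signal_def out_def x_def pad_def g_def)
  qed
  have yrl: "yr t \<in> carrier_vec (out_dim H)" "l < out_dim H \<Longrightarrow> yr t $ l = signal X l t" if t: "0 \<le> t" for t l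
  proof -
    have zt: "zr (idx t) t \<in> carrier_vec (r (disc_seq H w (idx t)))"
      using solution_dim[OF zr, of t "idx t"] idx_bounds[OF t] by auto
    show "yr t \<in> carrier_vec (out_dim H)"
      unfolding yr_eq by (rule mult_mat_vec_carrier[OF leading_block_carrier zt])
    assume "l < out_dim H"
    then show "yr t $ l = signal X l t"
      unfolding signal_def out_def X_def pad_def sum_lessThan_pad[OF r] yr_eq
      by (rule leading_block_mult_vec[OF zt])
  qed
  define d where "d t = y t - yr t" for t
  have d_dim: "d t \<in> carrier_vec (out_dim H)" if "0 \<le> t" for t
    unfolding d_def by (intro minus_carrier_vec yl(1) yrl(1) that)
  have d_eq: "d t $ l = e l t" if "0 \<le> t" "l < out_dim H" for t l
    using yl[OF that(1)] yrl[OF that(1)] that(2) by (auto simp: d_def e_def)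
  have "d \<in> L2 (out_dim H)"
    unfolding L2_def
  proof (intro CollectI conjI allI impI)
    fix l assume l: "l < out_dim H"
    have "e l \<in> borel_measurable (lebesgue_on {0..})" "integrable (lebesgue_on {0..}) (\<lambda>t. (e l t)\<^sup>2)"
      using bound l by (auto simp: l2_bound_def)
    moreover have "(\<lambda>t. d t $ l) \<in> borel_measurable (lebesgue_on {0..}) \<longleftrightarrow> e l \<in> borel_measurable (lebesgue_on {0..})"
      by (rule measurable_cong) (simp add: d_eq l)
    moreover have "integrable (lebesgue_on {0..}) (\<lambda>t. (d t $ l)\<^sup>2) \<longleftrightarrow> integrable (lebesgue_on {0..}) (\<lambda>t. (e l t)\<^sup>2)"
      by (rule Bochner_Integration.integrable_cong) (simp_all add: d_eq l)
    ultimately show "(\<lambda>t. d t $ l) \<in> borel_measurable (lebesgue_on {0..})"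
      "integrable (lebesgue_on {0..}) (\<lambda>t. (d t $ l)\<^sup>2)" by auto
  qed (rule d_dim)
  then show "(\<lambda>t. y t - yr t) \<in> L2 (out_dim H)" by (simp add: d_def[abs_def])
  have "(LINT t|lebesgue_on {0..}. d t \<bullet> d t) = (LINT t|lebesgue_on {0..}. (\<Sum>l<out_dim H. (e l t)\<^sup>2))"
    by (rule Bochner_Integration.integral_cong)
      (auto simp: scalar_prod_lessThan[OF d_dim] d_eq power2_eq_square intro!: sum.cong)
  also have "\<dots> \<le> b\<^sup>2" using bound by (rule l2_boundD)
  finally have "L2_norm d \<le> b"
    unfolding L2_norm_def using bound by (intro real_le_lsqrt) (auto simp: l2_bound_def)
  moreover have "L2_norm u = sqrt u_energy"
  proof -
    have "(LINT t|lebesgue_on {0..}. u t \<bullet> u t) = u_energy"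
      unfolding u_energy_def
      by (rule Bochner_Integration.integral_cong)
        (auto simp: scalar_prod_lessThan[OF u_dim] power2_eq_square)
    then show ?thesis by (simp add: L2_norm_def)
  qed
  ultimately show "L2_norm (\<lambda>t. y t - yr t) \<le> 2 * (\<Sum>g\<in>UNIV. \<Sum>i\<in>{r g..<n g}. \<sigma> g i) * L2_norm u"
    by (simp add: b_def d_def[abs_def])
qed

end

theorem theorem1:
  fixes H Hr :: "('q::finite, 'e::finite, 'o::finite) hybrid_system"
    and Gp Gq :: "'q \<Rightarrow> real mat"
    and r :: "'q \<Rightarrow> nat"
    and \<sigma> :: "'q \<Rightarrow> nat \<Rightarrow> real"
    and u y yr :: "real \<Rightarrow> real vec"
    and w :: "nat \<Rightarrow> 'e \<times> real"
    and od odr :: "real \<Rightarrow> 'o"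
  assumes "linear_hybrid_system H"
    and "init_cont H = 0\<^sub>v (state_dim H (init_disc H))"
    and "reachability_gramians H Gp"
    and "observability_gramians H Gq"
    and "\<And>q. 0 < r q \<and> r q \<le> state_dim H q"
    and "balanced_truncation H Gp Gq r \<sigma> Hr"
    and "u \<in> L2 (in_dim H)"
    and "timed_event_seq w"
    and "io_map H u w = (od, y)"
    and "io_map Hr u w = (odr, yr)"
  shows "(\<forall>t\<ge>0. odr t = od t) \<and>
    (\<lambda>t. y t - yr t) \<in> L2 (out_dim H) \<and>
    L2_norm (\<lambda>t. y t - yr t)
      \<le> 2 * (\<Sum>q\<in>UNIV. \<Sum>i<state_dim H q - r q. \<sigma> q (r q + i)) * L2_norm u"
proof -
  obtain U V where bf: "\<And>q. balancing_factors (state_dim H q) (Gp q) (Gq q) (U q) (V q) (\<sigma> q)"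
    and Hr: "Hr = truncated_system
       (transformed_system H (\<lambda>q. balancing_map (state_dim H q) (U q) (V q) (\<sigma> q))) r"
    using assms(6) unfolding balanced_truncation_def by blast
  define S where "S q = balancing_map (state_dim H q) (U q) (V q) (\<sigma> q)" for q
  define T where "T q = the (mat_inverse (S q))" for q
  have P: "Gp q \<in> carrier_mat (state_dim H q) (state_dim H q)" for q
    using assms(3) by (simp add: reachability_gramians_def pos_def_def)
  have Q: "Gq q \<in> carrier_mat (state_dim H q) (state_dim H q)" for q
    using assms(4) by (simp add: observability_gramians_def pos_def_def)
  have ST: "S q \<in> carrier_mat (state_dim H q) (state_dim H q)" "T q \<in> carrier_mat (state_dim H q) (state_dim H q)"
    "S q * T q = 1\<^sub>m (state_dim H q)" "T q * S q = 1\<^sub>m (state_dim H q)"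
    "transpose_mat (T q) * Gq q * T q = mat_diag (state_dim H q) (\<sigma> q)"
    "S q * Gp q * transpose_mat (S q) = mat_diag (state_dim H q) (\<sigma> q)" for q
    using balancing_map[OF bf[of q] P Q] by (simp_all add: S_def T_def)
  interpret balanced_hybrid_system H Gp Gq S T \<sigma> u w
    using assms(1-4,7,8) ST bf by unfold_locales (auto simp: T_def balancing_factors_def)
  have "(\<Sum>i<state_dim H q - r q. \<sigma> q (r q + i)) = (\<Sum>i\<in>{r q..<state_dim H q}. \<sigma> q i)" for q
    by (simp add: sum.atLeastLessThan_shift_0[of _ "r q"] lessThan_atLeast0 add.commute)
  moreover have "Hr = truncated_system Hb r"
    unfolding Hr Hb_def S_def ..
  ultimately show ?thesis
    using balanced_truncation_error[OF _ assms(9), of r odr yr] assms(5,10) by simp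
qed

end
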